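(* Suppose there exist a polynomial-time computable function $r$ and a set $A$ of Boolean formulas such that: (a) for each $k\in\{1,2,3,\ldots\}$, $r(0^n)=O(n^{1/k})$; (b) $A\in\mathrm{P}$ and $A\cap\mathrm{SAT}$ is $\mathrm{NP}$-complete; (c) each formula $G\in A$ has a strong backdoor $S$ with respect to the unit propagation subsolver with $\|S\|\leq r(0^{\|V(G)\|})$; and (d) there is a polynomial-time algorithm that, given $G\in A$, finds a strong backdoor of $G$ with respect to the unit propagation subsolver having the property in (c). Then $\mathrm{NP}\subseteq\bigcap_{\epsilon>0}\mathrm{DTIME}[2^{n^\epsilon}]$.
   Context: Formulas are encoded as strings over a finite alphabet $\Sigma$; $\mathrm{SAT}$ is the set of satisfiable Boolean formulas. $0^n$ denotes the string of $n$ zeros. For a formula $F$, $V(F)$ is its set of variables, and $\|X\|$ is the cardinality of a finite set $X$. A CNF formula is viewed as a set of clauses, each clause a set of literals; it is satisfiable iff some assignment makes at least one literal of every clause true. The empty CNF formula is trivially True, and a CNF formula containing the empty clause is trivially False. A partial assignment $a_S$ assigns truth values to the variables of a set $S\subseteq V(F)$; $F[a_S]$ denotes the simplified formula: for each variable $x$ set to True (resp. False), remove every clause containing the literal $x$ (resp. $\overline{x}$) and delete the literal $\overline{x}$ (resp. $x$) from the remaining clauses. A subsolver is a polynomial-time algorithm $A$ such that for each input formula $F$: (i) $A$ either rejects $F$ or determines $F$ (returns a satisfying assignment if $F$ is satisfiable, and proclaims unsatisfiability if $F$ is unsatisfiable); (ii) $A$ determines $F$ whenever $F$ is trivially True or trivially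 False; (iii) if $A$ determines $F$ then for each variable $x$ and value $v$, $A$ determines $F[v/x]$. The unit propagation subsolver works as follows: while the current formula is neither trivially True nor trivially False and contains a unit clause (a clause with exactly one literal), it takes the unit clause whose encoding is lexicographically least, sets its literal to True, and simplifies; if it reaches a trivially True formula it returns the satisfying assignment built, if it reaches a formula containing the empty clause it proclaims unsatisfiability, and otherwise it rejects. A strong backdoor of a formula $F$ for a subsolver $A$ is a nonempty set $S\subseteq V(F)$ such that for every partial assignment $a_S$, $A$ determines $F[a_S]$. $\mathrm{DTIME}[t(n)]$ is the class of languages decidable by a deterministic Turing machine in time $O(t(n))$. *)

theory Defs
  imports Complex_Main "HOL-Library.Landau_Symbols"
begin

datatype sym = S0 | S1 | SNeg | SComma | SBar

fun sym_rank :: "sym \<Rightarrow> nat" where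
  "sym_rank S0 = 0" | "sym_rank S1 = 1" | "sym_rank SNeg = 2"
| "sym_rank SComma = 3" | "sym_rank SBar = 4"

definition sym_less :: "(sym \<times> sym) set" where
  "sym_less = {(a, b). sym_rank a < sym_rank b}"

definition lex_less :: "sym list \<Rightarrow> sym list \<Rightarrow> bool" where
  "lex_less u v \<longleftrightarrow> (u, v) \<in> lexord sym_less"

text \<open>Literals: (x, True) is the positive literal x, (x, False) is its negation.\<close>
type_synonym lit = "nat \<times> bool"
type_synonym clause = "lit set"
type_synonym cnf = "clause set"

fun bin :: "nat \<Rightarrow> sym list" where
  "bin n = (if n < 2 then [if n = 0 then S0 else S1]
            else bin (n div 2) @ [if n mod 2 = 0 then S0 else S1])"

definition enc_lit :: "lit \<Rightarrow> sym list" where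
  "enc_lit l = (if snd l then [] else [SNeg]) @ bin (fst l)"

definition enc_clause :: "lit list \<Rightarrow> sym list" where
  "enc_clause C = concat (map (\<lambda>l. enc_lit l @ [SComma]) C) @ [SBar]"

definition enc_cnf :: "lit list list \<Rightarrow> sym list" where
  "enc_cnf cs = concat (map enc_clause cs)"

definition is_formula :: "sym list \<Rightarrow> bool" where
  "is_formula w \<longleftrightarrow> (\<exists>cs. enc_cnf cs = w)"

definition cnf_of :: "sym list \<Rightarrow> cnf" where
  "cnf_of w = (SOME F. \<exists>cs. enc_cnf cs = w \<and> F = set (map set cs))"

definition enc_vars :: "nat list \<Rightarrow> sym list" where
  "enc_vars xs = concat (map (\<lambda>x. bin x @ [SComma]) xs)"

definition vars :: "cnf \<Rightarrow> nat set" where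
  "vars F = (\<Union>C\<in>F. fst ` C)"

definition satisfies :: "(nat \<Rightarrow> bool) \<Rightarrow> cnf \<Rightarrow> bool" where
  "satisfies a F \<longleftrightarrow> (\<forall>C\<in>F. \<exists>l\<in>C. a (fst l) = snd l)"

definition satisfiable :: "cnf \<Rightarrow> bool" where
  "satisfiable F \<longleftrightarrow> (\<exists>a. satisfies a F)"

definition SAT :: "sym list set" where
  "SAT = {w. is_formula w \<and> satisfiable (cnf_of w)}"

definition assign :: "nat set \<Rightarrow> (nat \<Rightarrow> bool) \<Rightarrow> cnf \<Rightarrow> cnf" where
  "assign S a F = {C - {l. fst l \<in> S} | C. C \<in> F \<and> \<not> (\<exists>l\<in>C. fst l \<in> S \<and> a (fst l) = snd l)}"

definition trivially_true :: "cnf \<Rightarrow> bool" where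
  "trivially_true F \<longleftrightarrow> F = {}"

definition trivially_false :: "cnf \<Rightarrow> bool" where
  "trivially_false F \<longleftrightarrow> {} \<in> F"

definition least_unit :: "cnf \<Rightarrow> lit" where
  "least_unit F = (THE l. {l} \<in> F \<and>
     (\<forall>l'. {l'} \<in> F \<longrightarrow> l' = l \<or> lex_less (enc_clause [l]) (enc_clause [l'])))"

datatype result = Sat "nat \<Rightarrow> bool" | Unsat | Reject

text \<open>Unit propagation with fuel; with fuel card (vars F) + 1 the fuel never runs out
  on a finite formula, since each step removes a variable.\<close>
fun up_aux :: "nat \<Rightarrow> (nat \<Rightarrow> bool) \<Rightarrow> cnf \<Rightarrow> result" where
  "up_aux 0 a F =
     (if trivially_true F then Sat a else if trivially_false F then Unsat else Reject)"
| "up_aux (Suc k) a F =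
     (if trivially_true F then Sat a
      else if trivially_false F then Unsat
      else if (\<exists>l. {l} \<in> F) then
        (let l = least_unit F
         in up_aux k (a(fst l := snd l)) (assign {fst l} (\<lambda>_. snd l) F))
      else Reject)"

definition unit_prop :: "cnf \<Rightarrow> result" where
  "unit_prop F = up_aux (card (vars F) + 1) (\<lambda>_. False) F"

definition up_determines :: "cnf \<Rightarrow> bool" where
  "up_determines F \<longleftrightarrow>
     (\<exists>a. unit_prop F = Sat a \<and> satisfies a F) \<or> (unit_prop F = Unsat \<and> \<not> satisfiable F)"

definition strong_backdoor_up :: "cnf \<Rightarrow> nat set \<Rightarrow> bool" where
  "strong_backdoor_up F S \<longleftrightarrow> S \<noteq> {} \<and> S \<subseteq> vars F \<and>
     (\<forall>a. up_determines (assign S a F))"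

text \<open>Single-tape Turing machines. Tape symbols are naturals, 0 is the blank;
  states are naturals, 0 is the start state, 1 accept/halt, 2 reject.
  A machine is a finite set of transitions (q, a, q', b, d): in state q reading a,
  go to q', write b, move head by d \<in> {-1,0,1}.\<close>
type_synonym tm = "(nat \<times> nat \<times> nat \<times> nat \<times> int) set"
type_synonym config = "nat \<times> (int \<Rightarrow> nat) \<times> int"

definition sym_code :: "sym \<Rightarrow> nat" where
  "sym_code s = sym_rank s + 1"

definition ntm :: "tm \<Rightarrow> bool" where
  "ntm M \<longleftrightarrow> finite M \<and>
     (\<forall>(q, a, q', b, d)\<in>M. q \<noteq> 1 \<and> q \<noteq> 2 \<and> d \<in> {-1, 0, 1})"

definition dtm :: "tm \<Rightarrow> bool" where
  "dtm M \<longleftrightarrow> ntm M \<and>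
     (\<forall>q a t1 t2. (q, a, t1) \<in> M \<longrightarrow> (q, a, t2) \<in> M \<longrightarrow> t1 = t2)"

definition step :: "tm \<Rightarrow> config \<Rightarrow> config \<Rightarrow> bool" where
  "step M c c' \<longleftrightarrow> (\<exists>q tp p q' b d. c = (q, tp, p) \<and> (q, tp p, q', b, d) \<in> M \<and>
                      c' = (q', tp(p := b), p + d))"

definition init :: "sym list \<Rightarrow> config" where
  "init w = (0, (\<lambda>i. if 0 \<le> i \<and> i < int (length w) then sym_code (w ! nat i) else 0), 0)"

definition state :: "config \<Rightarrow> nat" where "state c = fst c"
definition tape :: "config \<Rightarrow> int \<Rightarrow> nat" where "tape c = fst (snd c)"

definition DTIME :: "(nat \<Rightarrow> real) \<Rightarrow> sym list set set" where
  "DTIME t = {L. \<exists>M (c::real) n0. dtm M \<and>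
     (\<forall>w. \<exists>n cf. (step M ^^ n) (init w) cf \<and> state cf \<in> {1, 2} \<and>
            (state cf = 1 \<longleftrightarrow> w \<in> L) \<and>
            (length w \<ge> n0 \<longrightarrow> real n \<le> c * t (length w)))}"

definition Pclass :: "sym list set set" where
  "Pclass = (\<Union>k. DTIME (\<lambda>n. real n ^ k))"

definition FP :: "(sym list \<Rightarrow> sym list) set" where
  "FP = {f. \<exists>M (k::nat). dtm M \<and>
     (\<forall>w. \<exists>n cf. (step M ^^ n) (init w) cf \<and> state cf = 1 \<and>
            map sym_code (f w) = map (\<lambda>i. tape cf (int i)) [0..<length (f w)] \<and>
            tape cf (int (length (f w))) = 0 \<and>
            n \<le> length w ^ k + k)}"

definition FP_nat :: "(sym list \<Rightarrow> nat) set" where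
  "FP_nat = {r. (\<lambda>w. bin (r w)) \<in> FP}"

definition NPclass :: "sym list set set" where
  "NPclass = {L. \<exists>M (k::nat). ntm M \<and>
     (\<forall>w. w \<in> L \<longleftrightarrow> (\<exists>n cf. (step M ^^ n) (init w) cf \<and> state cf = 1 \<and>
                         n \<le> length w ^ k + k))}"

definition pm_reduces :: "sym list set \<Rightarrow> sym list set \<Rightarrow> bool" where
  "pm_reduces L L' \<longleftrightarrow> (\<exists>f\<in>FP. \<forall>w. w \<in> L \<longleftrightarrow> f w \<in> L')"

definition NP_complete :: "sym list set \<Rightarrow> bool" where
  "NP_complete L \<longleftrightarrow> L \<in> NPclass \<and> (\<forall>L'\<in>NPclass. pm_reduces L' L)"

definition zeros :: "nat \<Rightarrow> sym list" where
  "zeros n = replicate n S0"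

end

theory Submission
  imports Defs "HOL-Real_Asymp.Real_Asymp"
begin

text \<open>
  To decide a language in NP, reduce the input to a formula \<open>G\<close>, test whether \<open>G\<close> belongs to \<open>A\<close>, compute a
  strong backdoor of \<open>G\<close>, and run unit propagation on \<open>G\<close> for every assignment of the backdoor
  variables. With \<open>m\<close> variables there are at most \<open>2 ^ r(0 ^ m)\<close> assignments, where \<open>m\<close> is polynomial in the
  input length \<open>n\<close>; as \<open>r(0 ^ m)\<close> is below every root of \<open>m\<close>, the total time is at most a polynomial times
  \<open>2 powr (C * n powr (\<epsilon> / 2))\<close>.

  The machine is obtained from a small language of resumable programs: the control state of the
  machine is the part of the program that remains to be executed, so that a program and its machine run in lock step
  and only the finiteness of the set of residual programs has to be shown. On top of this, stacks are
  stored on the tracks of the tape, and the three given machines are simulated with two stacks each.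

  Unit propagation is implemented as saturation: a literal \<open>l\<close> is added to the list \<open>P\<close> of true literals
  when \<open>\<not> l\<close> together with \<open>P\<close> falsifies every literal of some clause. If a strong backdoor assignment makes the
  subsolver answer \<open>Unsat\<close>, then each of its steps is matched by one saturation round.
\<close>
section \<open>Resumable programs and their runs on a tape\<close>

text \<open>The subsolver has to be imitated only when it answers \<open>Unsat\<close>: if the
  simplified formula is satisfiable, then so is \<open>G\<close>, and saturation is sound for every
  satisfying assignment. So saturation need not follow the lexicographic choice of unit clauses and
  needs no intermediate formulas, only a growing list of literals whose conflict test is monotone.
  The backdoor is nonempty, so at least one variable disappears, and the fuel of the subsolver is at
  most the number of literal occurrences in \<open>G\<close>. The list of backdoor variables may
  contain repetitions, whereas only the cardinality of its set is bounded; duplicates are therefore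
  removed before the enumeration. Passing from stack operations to tape steps squares the cost and
  turns the factor \<open>2 ^ k\<close> for a backdoor of size \<open>k\<close> into
  \<open>4 ^ k\<close>, which only doubles the constant in the exponent.\<close>

text \<open>
  \<open>Do i w d k\<close> reads the symbol \<open>a\<close> on track \<open>i\<close>, writes \<open>w a\<close>, moves by \<open>d a\<close> and continues with \<open>k a\<close>.
  The value returned by the body of a loop encodes a tag in its parity: \<open>2 * u\<close> leaves the loop with value \<open>u\<close>,
  \<open>2 * u + 1\<close> starts the next iteration with argument \<open>u\<close>.
\<close>

datatype prog =
    Ret nat
  | Do nat "nat \<Rightarrow> nat" "nat \<Rightarrow> int" "nat \<Rightarrow> prog"
  | Bind prog "nat \<Rightarrow> prog"
  | Loop "nat \<Rightarrow> prog" nat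

definition loop_cont :: "(nat \<Rightarrow> prog) \<Rightarrow> nat \<Rightarrow> prog" where
  "loop_cont f u = (if even u then Ret (u div 2) else Loop f (u div 2))"

primrec prog_step :: "prog \<Rightarrow> (nat \<Rightarrow> nat) \<Rightarrow> (prog \<times> (nat \<Rightarrow> nat) \<times> int) option" where
  "prog_step (Ret v) c = None"
| "prog_step (Do i w d k) c = Some (k (c i), c(i := w (c i)), d (c i))"
| "prog_step (Bind p f) c = (case prog_step p c of
      Some (p', c', e) \<Rightarrow> Some (Bind p' f, c', e)
    | None \<Rightarrow> (case p of Ret v \<Rightarrow> Some (f v, c, 0) | _ \<Rightarrow> None))"
| "prog_step (Loop f v) c = Some (Bind (f v) (loop_cont f), c, 0)"

definition tape_step :: "prog \<times> (int \<Rightarrow> nat \<Rightarrow> nat) \<times> int \<Rightarrow> prog \<times> (int \<Rightarrow> nat \<Rightarrow> nat) \<times> int \<Rightarrow> bool" where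
  "tape_step x y \<longleftrightarrow> (\<exists>p T h p' c e. x = (p, T, h) \<and> prog_step p (T h) = Some (p', c, e) \<and>
      y = (p', T(h := c), h + e))"

definition run where
  "run p T h n v T' h' \<longleftrightarrow> (tape_step ^^ n) (p, T, h) (Ret v, T', h')"

lemma tape_step_I: "prog_step p (T h) = Some (p', c, e) \<Longrightarrow> tape_step (p, T, h) (p', T(h := c), h + e)"
  by (auto simp: tape_step_def)

lemma tape_step_Bind: "tape_step (p, T, h) (p', T', h') \<Longrightarrow> tape_step (Bind p f, T, h) (Bind p' f, T', h')"
  by (auto simp: tape_step_def)

lemma tape_steps_Bind:
  "(tape_step ^^ n) (p, T, h) (p', T', h') \<Longrightarrow> (tape_step ^^ n) (Bind p f, T, h) (Bind p' f, T', h')"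
proof (induction n arbitrary: p T h)
  case (Suc n)
  from Suc.prems obtain y where y: "tape_step (p, T, h) y" "(tape_step ^^ n) y (p', T', h')"
    by (rule relpowp_Suc_E2)
  obtain q U g where "y = (q, U, g)" by (cases y)
  with y have "tape_step (Bind p f, T, h) (Bind q f, U, g)" "(tape_step ^^ n) (Bind q f, U, g) (Bind p' f, T', h')"
    by (auto intro: tape_step_Bind Suc.IH)
  then show ?case by (rule relpowp_Suc_I2)
qed auto

lemma run_step: "tape_step (p, T, h) (p', U, g) \<Longrightarrow> run p' U g n v T' h' \<Longrightarrow> run p T h (Suc n) v T' h'"
  unfolding run_def by (rule relpowp_Suc_I2)

lemma run_Ret: "run (Ret v) T h 0 v T h"
  by (simp add: run_def)

lemma run_Do:
  assumes "run (k (T h i)) (T(h := (T h)(i := w (T h i)))) (h + d (T h i)) n v T' h'"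
  shows "run (Do i w d k) T h (Suc n) v T' h'"
  by (rule run_step[OF tape_step_I assms]) simp

lemma run_Bind:
  assumes "run p T h n u U g" "run (f u) U g m v T' h'"
  shows "run (Bind p f) T h (n + Suc m) v T' h'"
proof -
  have "tape_step (Bind (Ret u) f, U, g) (f u, U, g)"
    using tape_step_I[of "Bind (Ret u) f" U g "f u" "U g" 0] by simp
  then show ?thesis
    using assms tape_steps_Bind unfolding run_def
    by (meson relpowp_Suc_I2 relpowp_trans)
qed

lemma run_Loop:
  assumes "run (Bind (f x) (loop_cont f)) T h n v T' h'"
  shows "run (Loop f x) T h (Suc n) v T' h'"
  using tape_step_I[of "Loop f x" T h "Bind (f x) (loop_cont f)" "T h" 0] assms
  by (auto intro: run_step)

text \<open>The two additional steps are the unfolding of \<open>Loop\<close> into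
  \<open>Bind\<close> and the transfer of the value to \<open>loop_cont\<close>.\<close>

lemma run_Loop_exit:
  assumes "run (f x) T h n (2 * u) T' h'"
  shows "run (Loop f x) T h (n + 2) u T' h'"
  using run_Loop[OF run_Bind[OF assms, of "loop_cont f" 0 u T' h']]
  by (simp add: loop_cont_def run_Ret)

lemma run_Loop_cont:
  assumes "run (f x) T h n (2 * u + 1) U g" "run (Loop f u) U g m v T' h'"
  shows "run (Loop f x) T h (n + m + 2) v T' h'"
  using run_Loop[OF run_Bind[OF assms(1), of "loop_cont f" m v T' h']] assms(2)
  by (simp add: loop_cont_def)

definition scanr :: "nat \<Rightarrow> prog" where
  "scanr i = Loop (\<lambda>_. Do i (\<lambda>a. a) (\<lambda>a. if a = 0 then 0 else 1) (\<lambda>a. if a = 0 then Ret 0 else Ret 1)) 0"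

definition home :: prog where
  "home = Loop (\<lambda>_. Do 0 (\<lambda>a. a) (\<lambda>a. if a = 0 then -1 else 0) (\<lambda>a. if a = 0 then Ret 1 else Ret 0)) 0"

lemma upd_same: "T h i = a \<Longrightarrow> T(h := (T h)(i := a)) = T"
  by auto

lemma run_scanr:
  assumes "\<And>q. h \<le> q \<Longrightarrow> q < h + int m \<Longrightarrow> T q i \<noteq> 0" "T (h + int m) i = 0"
  shows "run (scanr i) T h (3 * m + 3) 0 T (h + int m)"
  using assms
proof (induction m arbitrary: h)
  case 0
  have "run (Do i (\<lambda>a. a) (\<lambda>a. if a = 0 then 0 else 1) (\<lambda>a. if a = 0 then Ret 0 else Ret 1)) T h (Suc 0) (2 * 0) T h"
    by (rule run_Do) (use 0 in \<open>simp add: run_Ret upd_same\<close>)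
  then have "run (scanr i) T h (Suc 0 + 2) 0 T h"
    unfolding scanr_def by (rule run_Loop_exit)
  then show ?case by (simp add: numeral_3_eq_3)
next
  case (Suc m)
  have nz: "T h i \<noteq> 0" using Suc.prems(1)[of h] by simp
  have "run (scanr i) T (h + 1) (3 * m + 3) 0 T (h + 1 + int m)"
    using Suc.prems by (intro Suc.IH) (auto simp: add.assoc)
  moreover have "run (Do i (\<lambda>a. a) (\<lambda>a. if a = 0 then 0 else 1) (\<lambda>a. if a = 0 then Ret 0 else Ret 1)) T h (Suc 0) (2 * 0 + 1) T (h + 1)"
    by (rule run_Do) (use nz in \<open>simp add: run_Ret\<close>)
  ultimately have "run (scanr i) T h (Suc 0 + (3 * m + 3) + 2) 0 T (h + 1 + int m)"
    unfolding scanr_def by (rule run_Loop_cont[rotated])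
  then show ?case by (simp add: algebra_simps)
qed

text \<open>\<open>m\<close> is the distance of the head from position -1; the case
  \<open>m = 0\<close> arises after popping an empty stack.\<close>

lemma run_home:
  assumes "\<And>q. -1 < q \<Longrightarrow> T q 0 = 0" "T (-1) 0 \<noteq> 0"
  shows "run home T (int m - 1) (3 * m + 3) 0 T (-1)"
proof (induction m)
  case 0
  have "run (Do 0 (\<lambda>a. a) (\<lambda>a. if a = 0 then -1 else 0) (\<lambda>a. if a = 0 then Ret 1 else Ret 0)) T (-1) (Suc 0) (2 * 0) T (-1)"
    by (rule run_Do) (use assms in \<open>simp add: run_Ret\<close>)
  then have "run home T (-1) (Suc 0 + 2) 0 T (-1)"
    unfolding home_def by (rule run_Loop_exit)
  then show ?case by (simp add: numeral_3_eq_3)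
next
  case (Suc m)
  have "run (Do 0 (\<lambda>a. a) (\<lambda>a. if a = 0 then -1 else 0) (\<lambda>a. if a = 0 then Ret 1 else Ret 0)) T (int m) (Suc 0) (2 * 0 + 1) T (int m - 1)"
    by (rule run_Do) (use assms(1)[of "int m"] in \<open>simp add: run_Ret upd_same\<close>)
  then have "run home T (int m) (Suc 0 + (3 * m + 3) + 2) 0 T (-1)"
    using Suc unfolding home_def by (rule run_Loop_cont)
  then show ?case by (simp add: algebra_simps)
qed

section \<open>Stacks on tape tracks and the cost of stack operations\<close>

type_synonym store = "nat \<Rightarrow> nat list"

text \<open>
  Track \<open>i > 0\<close> holds the stack \<open>s i\<close> with its bottom at position \<open>0\<close>; an entry \<open>v\<close> is written as \<open>Suc v\<close> because
  \<open>0\<close> is the blank. Track \<open>0\<close> only marks the home position \<open>-1\<close>, to which the head returns after each operation.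
\<close>

definition stk :: "nat list \<Rightarrow> int \<Rightarrow> nat" where
  "stk xs p = (if 0 \<le> p \<and> p < int (length xs) then Suc (rev xs ! nat p) else 0)"

definition rep :: "store \<Rightarrow> (int \<Rightarrow> nat \<Rightarrow> nat) \<Rightarrow> bool" where
  "rep s T \<longleftrightarrow> (\<forall>p. T p 0 = (if p = -1 then 1 else 0)) \<and> (\<forall>i>0. \<forall>p. T p i = stk (s i) p)"

text \<open>
  The cost \<open>t\<close> counts stack operations. Each of them grows a stack by at most one and takes time linear in the
  stack heights, whence the quadratic bound on the number of tape steps.
\<close>

definition exec :: "prog \<Rightarrow> store \<Rightarrow> nat \<Rightarrow> nat \<Rightarrow> store \<Rightarrow> bool" where
  "exec p s t v s' \<longleftrightarrow> (\<forall>T H. rep s T \<and> (\<forall>i. length (s i) \<le> H) \<longrightarrow>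
     (\<exists>T' n. run p T (-1) n v T' (-1) \<and> rep s' T' \<and> n \<le> t * (30 * (H + t + 1))) \<and>
     (\<forall>i. length (s' i) \<le> H + t))"

lemma stk_Cons: "stk (x # xs) p = (if p = int (length xs) then Suc x else stk xs p)"
  by (auto simp: stk_def nth_append)

lemma exec_Ret: "exec (Ret v) s 0 v s"
  using run_Ret by (auto simp: exec_def)

lemma exec_mono: "exec p s t v s' \<Longrightarrow> t \<le> t' \<Longrightarrow> exec p s t' v s'"
  unfolding exec_def by (meson add_le_mono le_refl le_trans mult_le_mono)

text \<open>The quadratic bound is superadditive even though the second program starts on stacks
  that may be higher by \<open>t1\<close>. The extra unit in \<open>t1 + t2 + 1\<close> pays for the
  administrative tape steps of \<open>Bind\<close> and \<open>Loop\<close>.\<close>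

lemma cost_add:
  fixes n1 n2 :: nat
  assumes "n1 \<le> t1 * (30 * (H + t1 + 1))" "n2 \<le> t2 * (30 * ((H + t1) + t2 + 1))"
  shows "n1 + n2 + 2 \<le> (t1 + t2 + 1) * (30 * (H + (t1 + t2 + 1) + 1))"
proof -
  let ?A = "30 * (H + (t1 + t2 + 1) + 1)"
  have "n1 \<le> t1 * ?A" by (rule le_trans[OF assms(1)]) simp
  moreover have "n2 \<le> t2 * ?A" by (rule le_trans[OF assms(2)]) simp
  moreover have "2 \<le> ?A" by simp
  ultimately have "n1 + n2 + 2 \<le> t1 * ?A + t2 * ?A + ?A" by linarith
  then show ?thesis by (simp only: add_mult_distrib mult_1)
qed

lemma exec_Bind:
  assumes "exec p s t1 u s1" "exec (f u) s1 t2 v s2"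
  shows "exec (Bind p f) s (t1 + t2 + 1) v s2"
  unfolding exec_def
proof (intro allI impI conjI; elim conjE)
  fix T H assume r: "rep s T" "\<forall>i. length (s i) \<le> H"
  then obtain T1 n1 where 1: "run p T (-1) n1 u T1 (-1)" "rep s1 T1" "n1 \<le> t1 * (30 * (H + t1 + 1))"
    using assms(1) unfolding exec_def by blast
  have H1: "\<forall>i. length (s1 i) \<le> H + t1" using assms(1) r unfolding exec_def by blast
  then obtain T2 n2 where 2: "run (f u) T1 (-1) n2 v T2 (-1)" "rep s2 T2" "n2 \<le> t2 * (30 * ((H + t1) + t2 + 1))"
    using assms(2) 1 unfolding exec_def by blast
  have "\<forall>i. length (s2 i) \<le> (H + t1) + t2" using assms(2) 1 H1 unfolding exec_def by blast
  then show "length (s2 i) \<le> H + (t1 + t2 + 1)" for i by (simp add: add.assoc le_SucI)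
  show "\<exists>T' n. run (Bind p f) T (-1) n v T' (-1) \<and> rep s2 T' \<and> n \<le> (t1 + t2 + 1) * (30 * (H + (t1 + t2 + 1) + 1))"
    using run_Bind[where f=f, OF 1(1) 2(1)] cost_add[OF 1(3) 2(3)] 2(2)
    by (intro exI[of _ T2] exI[of _ "n1 + Suc n2"]) auto
qed

lemma exec_Loop_exit:
  assumes "exec (f x) s t (2 * u) s'"
  shows "exec (Loop f x) s (t + 1) u s'"
  unfolding exec_def
proof (intro allI impI conjI; elim conjE)
  fix T H assume r: "rep s T" "\<forall>i. length (s i) \<le> H"
  then obtain T1 n1 where 1: "run (f x) T (-1) n1 (2 * u) T1 (-1)" "rep s' T1" "n1 \<le> t * (30 * (H + t + 1))"
    using assms(1) unfolding exec_def by blast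
  have H1: "\<forall>i. length (s' i) \<le> H + t" using assms(1) r unfolding exec_def by blast
  then show "length (s' i) \<le> H + (t + 1)" for i by (simp add: le_SucI)
  show "\<exists>T' n. run (Loop f x) T (-1) n u T' (-1) \<and> rep s' T' \<and> n \<le> (t + 1) * (30 * (H + (t + 1) + 1))"
    using run_Loop_exit[where f=f, OF 1(1)] cost_add[OF 1(3), of 0 0] 1(2)
    by (intro exI[of _ T1] exI[of _ "n1 + 2"]) auto
qed

lemma exec_Loop_cont:
  assumes "exec (f x) s t1 (2 * u + 1) s1" "exec (Loop f u) s1 t2 v s2"
  shows "exec (Loop f x) s (t1 + t2 + 1) v s2"
  unfolding exec_def
proof (intro allI impI conjI; elim conjE)
  fix T H assume r: "rep s T" "\<forall>i. length (s i) \<le> H"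
  then obtain T1 n1 where 1: "run (f x) T (-1) n1 (2 * u + 1) T1 (-1)" "rep s1 T1" "n1 \<le> t1 * (30 * (H + t1 + 1))"
    using assms(1) unfolding exec_def by blast
  have H1: "\<forall>i. length (s1 i) \<le> H + t1" using assms(1) r unfolding exec_def by blast
  then obtain T2 n2 where 2: "run (Loop f u) T1 (-1) n2 v T2 (-1)" "rep s2 T2" "n2 \<le> t2 * (30 * ((H + t1) + t2 + 1))"
    using assms(2) 1 unfolding exec_def by blast
  have "\<forall>i. length (s2 i) \<le> (H + t1) + t2" using assms(2) 1 H1 unfolding exec_def by blast
  then show "length (s2 i) \<le> H + (t1 + t2 + 1)" for i by (simp add: add.assoc le_SucI)
  show "\<exists>T' n. run (Loop f x) T (-1) n v T' (-1) \<and> rep s2 T' \<and> n \<le> (t1 + t2 + 1) * (30 * (H + (t1 + t2 + 1) + 1))"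
    using run_Loop_cont[where f=f, OF 1(1) 2(1)] cost_add[OF 1(3) 2(3)] 2(2)
    by (intro exI[of _ T2] exI[of _ "n1 + n2 + 2"]) auto
qed

definition push :: "nat \<Rightarrow> nat \<Rightarrow> prog" where
  "push i v = Bind (Do i (\<lambda>a. a) (\<lambda>_. 1) (\<lambda>_. Ret 0)) (\<lambda>_. Bind (scanr i)
     (\<lambda>_. Bind (Do i (\<lambda>_. Suc v) (\<lambda>_. 0) (\<lambda>_. Ret 0)) (\<lambda>_. home)))"

text \<open>The value returned is the raw tape symbol, so \<open>0\<close> signals an empty stack
  and \<open>Suc x\<close> the entry \<open>x\<close>. On an empty stack the blank is written at
  position -1, where the track is blank anyway.\<close>

definition pop :: "nat \<Rightarrow> prog" where
  "pop i = Bind (Do i (\<lambda>a. a) (\<lambda>_. 1) (\<lambda>_. Ret 0)) (\<lambda>_. Bind (scanr i)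
     (\<lambda>_. Bind (Do i (\<lambda>a. a) (\<lambda>_. -1) (\<lambda>_. Ret 0))
     (\<lambda>_. Do i (\<lambda>_. 0) (\<lambda>_. 0) (\<lambda>a. Bind home (\<lambda>_. Ret a)))))"

lemma exec_push:
  assumes "i > 0"
  shows "exec (push i v) s 1 0 (s(i := v # s i))"
  unfolding exec_def
proof (intro allI impI conjI; elim conjE)
  fix T H assume r: "rep s T" and H: "\<forall>i. length (s i) \<le> H"
  show "length ((s(i := v # s i)) j) \<le> H + 1" for j
    using H by (simp add: le_SucI)
  let ?n = "length (s i)"
  let ?T' = "T(int ?n := (T (int ?n))(i := Suc v))"
  have Ti: "T p i = stk (s i) p" for p using r assms by (auto simp: rep_def)
  have 1: "run (Do i (\<lambda>a. a) (\<lambda>_. 1) (\<lambda>_. Ret 0)) T (-1) (Suc 0) 0 T 0"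
    by (rule run_Do) (simp add: run_Ret)
  have 2: "run (scanr i) T 0 (3 * ?n + 3) 0 T (0 + int ?n)"
    by (rule run_scanr) (auto simp: Ti stk_def)
  have 3: "run (Do i (\<lambda>_. Suc v) (\<lambda>_. 0) (\<lambda>_. Ret 0)) T (int ?n) (Suc 0) 0 ?T' (int ?n)"
    by (rule run_Do) (simp add: run_Ret)
  have "run home ?T' (int (Suc ?n) - 1) (3 * Suc ?n + 3) 0 ?T' (-1)"
    by (rule run_home) (use r assms in \<open>auto simp: rep_def\<close>)
  then have 4: "run home ?T' (int ?n) (3 * Suc ?n + 3) 0 ?T' (-1)" by simp
  have "run (push i v) T (-1) (Suc 0 + Suc (3 * ?n + 3 + Suc (Suc 0 + Suc (3 * Suc ?n + 3)))) 0 ?T' (-1)"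
    unfolding push_def
    by (rule run_Bind[OF 1], rule run_Bind[OF 2], simp only: add_0, rule run_Bind[OF 3], rule 4)
  moreover have "rep (s(i := v # s i)) ?T'"
    using r assms by (auto simp: rep_def stk_Cons)
  \<comment> \<open>The left side is \<open>6 * ?n + 14\<close>; the factor 30 is generous and
    serves \<open>pop\<close> as well.\<close>
  moreover have "Suc 0 + Suc (3 * ?n + 3 + Suc (Suc 0 + Suc (3 * Suc ?n + 3))) \<le> 1 * (30 * (H + 1 + 1))"
    using H[rule_format, of i] by simp
  ultimately show "\<exists>T' n. run (push i v) T (-1) n 0 T' (-1) \<and> rep (s(i := v # s i)) T' \<and> n \<le> 1 * (30 * (H + 1 + 1))"
    by blast
qed

definition topv :: "nat list \<Rightarrow> nat" where
  "topv xs = (case xs of [] \<Rightarrow> 0 | x # _ \<Rightarrow> Suc x)"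

lemma topv_simps [simp]: "topv [] = 0" "topv (x # xs) = Suc x"
  by (simp_all add: topv_def)

lemma stk_top: "stk xs (int (length xs) - 1) = topv xs"
  by (cases xs) (auto simp: stk_def nth_append)

lemma stk_tl: "stk (tl xs) p = (if p = int (length xs) - 1 then 0 else stk xs p)"
  by (cases xs) (auto simp: stk_def nth_append)

lemma exec_pop:
  assumes "i > 0"
  shows "exec (pop i) s 1 (topv (s i)) (s(i := tl (s i)))"
  unfolding exec_def
proof (intro allI impI conjI; elim conjE)
  fix T H assume r: "rep s T" and H: "\<forall>i. length (s i) \<le> H"
  have "length (tl (s i)) \<le> H" using H[rule_format, of i] by simp
  then show "length ((s(i := tl (s i))) j) \<le> H + 1" for j
    using H by (simp add: le_SucI)
  let ?n = "length (s i)"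
  let ?T' = "T(int ?n - 1 := (T (int ?n - 1))(i := 0))"
  have Ti: "T p i = stk (s i) p" for p using r assms by (auto simp: rep_def)
  have 1: "run (Do i (\<lambda>a. a) (\<lambda>_. 1) (\<lambda>_. Ret 0)) T (-1) (Suc 0) 0 T 0"
    by (rule run_Do) (simp add: run_Ret)
  have 2: "run (scanr i) T 0 (3 * ?n + 3) 0 T (0 + int ?n)"
    by (rule run_scanr) (auto simp: Ti stk_def)
  have 3: "run (Do i (\<lambda>a. a) (\<lambda>_. -1) (\<lambda>_. Ret 0)) T (int ?n) (Suc 0) 0 T (int ?n - 1)"
    by (rule run_Do) (simp add: run_Ret)
  have "run home ?T' (int ?n - 1) (3 * ?n + 3) 0 ?T' (-1)"
    by (rule run_home) (use r assms in \<open>auto simp: rep_def\<close>)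
  from run_Bind[OF this, of "\<lambda>_. Ret (topv (s i))"]
  have 4: "run (Bind home (\<lambda>_. Ret (topv (s i)))) ?T' (int ?n - 1) (3 * ?n + 3 + Suc 0) (topv (s i)) ?T' (-1)"
    using run_Ret by blast
  have 5: "run (Do i (\<lambda>_. 0) (\<lambda>_. 0) (\<lambda>a. Bind home (\<lambda>_. Ret a))) T (int ?n - 1) (Suc (3 * ?n + 3 + Suc 0)) (topv (s i)) ?T' (-1)"
    by (rule run_Do) (use 4 in \<open>simp add: Ti stk_top\<close>)
  have "run (pop i) T (-1) (Suc 0 + Suc (3 * ?n + 3 + Suc (Suc 0 + Suc (Suc (3 * ?n + 3 + Suc 0))))) (topv (s i)) ?T' (-1)"
    unfolding pop_def
    by (rule run_Bind[OF 1], rule run_Bind[OF 2], simp only: add_0, rule run_Bind[OF 3], rule 5)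
  moreover have "rep (s(i := tl (s i))) ?T'"
    using r assms by (auto simp: rep_def stk_tl)
  moreover have "Suc 0 + Suc (3 * ?n + 3 + Suc (Suc 0 + Suc (Suc (3 * ?n + 3 + Suc 0)))) \<le> 1 * (30 * (H + 1 + 1))"
    using H[rule_format, of i] by simp
  ultimately show "\<exists>T' n. run (pop i) T (-1) n (topv (s i)) T' (-1) \<and> rep (s(i := tl (s i))) T' \<and> n \<le> 1 * (30 * (H + 1 + 1))"
    by blast
qed

section \<open>Compiling programs to Turing machines\<close>

text \<open>\<open>B\<close> bounds all tape symbols and returned values, \<open>K\<close> the
  number of tracks. Within these bounds the functions inside a program have only finitely many
  relevant arguments.\<close>

primrec wf_prog :: "nat \<Rightarrow> nat \<Rightarrow> prog \<Rightarrow> bool" where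
  "wf_prog B K (Ret v) \<longleftrightarrow> v < B"
| "wf_prog B K (Do i w d k) \<longleftrightarrow> i < K \<and> (\<forall>a<B. w a < B \<and> d a \<in> {-1, 0, 1} \<and> wf_prog B K (k a))"
| "wf_prog B K (Bind p f) \<longleftrightarrow> wf_prog B K p \<and> (\<forall>v<B. wf_prog B K (f v))"
| "wf_prog B K (Loop f v) \<longleftrightarrow> v < B \<and> (\<forall>u<B. wf_prog B K (f u))"

text \<open>An over-approximation of what may remain to be executed. A loop contributes its body for
  every argument below \<open>B\<close>, not just for \<open>v\<close>, so the set is closed under
  re-entering the loop; halving a value keeps it below \<open>B\<close>.\<close>

primrec residuals :: "nat \<Rightarrow> prog \<Rightarrow> prog set" where
  "residuals B (Ret v) = {Ret v}"
| "residuals B (Do i w d k) = insert (Do i w d k) (\<Union>a<B. residuals B (k a))"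
| "residuals B (Bind p f) = (\<lambda>q. Bind q f) ` residuals B p \<union> (\<Union>v<B. residuals B (f v))"
| "residuals B (Loop f v) = (\<Union>u<B. {Loop f u, Ret u} \<union> (\<lambda>q. Bind q (loop_cont f)) ` residuals B (f u))"

definition cells :: "nat \<Rightarrow> nat \<Rightarrow> (nat \<Rightarrow> nat) set" where
  "cells B K = {c. \<forall>i. (i < K \<longrightarrow> c i < B) \<and> (K \<le> i \<longrightarrow> c i = 0)}"

lemma finite_cells: "finite (cells B K)"
proof -
  have "finite {f. \<forall>i. (i \<in> {..<K} \<longrightarrow> f i \<in> {..<B}) \<and> (i \<notin> {..<K} \<longrightarrow> f i = (0::nat))}"
    by (rule finite_set_of_finite_funs) auto
  then show ?thesis by (simp add: cells_def not_less)
qed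

lemma finite_residuals: "finite (residuals B p)"
  by (induction p) auto

lemma self_residuals: "wf_prog B K p \<Longrightarrow> p \<in> residuals B p"
  by (induction p) auto

lemma wf_prog_loop_cont: "wf_prog B K (Loop f u) \<Longrightarrow> v < B \<Longrightarrow> wf_prog B K (loop_cont f v)"
  by (auto simp: loop_cont_def)

text \<open>Rules out the fallback branch in the \<open>Bind\<close> clause of
  \<open>prog_step\<close>: nothing but \<open>Ret\<close> is ever stuck.\<close>

lemma prog_step_None: "prog_step p c = None \<longleftrightarrow> (\<exists>v. p = Ret v)"
  by (induction p) (auto split: option.splits prog.splits)

lemma prog_step_wf:
  "wf_prog B K p \<Longrightarrow> c \<in> cells B K \<Longrightarrow> prog_step p c = Some (p', c', e) \<Longrightarrow>
     wf_prog B K p' \<and> c' \<in> cells B K \<and> e \<in> {-1, 0, 1}"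
proof (induction p arbitrary: p')
  case (Do i w d k)
  then have "c i < B" by (auto simp: cells_def)
  then show ?case using Do by (auto simp: cells_def)
next
  case (Bind p f)
  then show ?case by (auto split: option.splits prog.splits)
next
  case (Loop f v)
  then show ?case using wf_prog_loop_cont[of B K f v] by auto
qed auto

lemma prog_step_residuals:
  "q \<in> residuals B p \<Longrightarrow> wf_prog B K p \<Longrightarrow> wf_prog B K q \<Longrightarrow> c \<in> cells B K \<Longrightarrow> prog_step q c = Some (q', c', e) \<Longrightarrow> q' \<in> residuals B p"
proof (induction p arbitrary: q q')
  case (Do i w d k)
  from Do.prems(1) consider "q = Do i w d k" | a where "a < B" "q \<in> residuals B (k a)" by auto
  then show ?case
  proof cases
    case 1
    then have "c i < B" "wf_prog B K (k (c i))" "q' = k (c i)" using Do.prems by (auto simp: cells_def)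
    then show ?thesis using self_residuals by auto
  next
    case 2
    have "q' \<in> residuals B (k a)"
      by (rule Do.IH[OF _ 2(2) _ Do.prems(3-5)]) (use 2 Do.prems in auto)
    then show ?thesis using 2 by auto
  qed
next
  case (Bind p f)
  from Bind.prems(1) consider p' where "q = Bind p' f" "p' \<in> residuals B p" | a where "a < B" "q \<in> residuals B (f a)" by auto
  then show ?case
  proof cases
    case 1
    show ?thesis
    proof (cases "prog_step p' c")
      case None
      then obtain v where v: "p' = Ret v" by (auto simp: prog_step_None)
      then have q': "v < B" "q' = f v" using 1 Bind.prems by auto
      have "f v \<in> residuals B (f v)" by (rule self_residuals[of B K]) (use q' Bind.prems in auto)
      then show ?thesis using q' by auto
    next
      case (Some x)
      then obtain p'' where x: "prog_step p' c = Some (p'', c', e)" "q' = Bind p'' f"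
        using 1 Bind.prems(5) by (cases x) auto
      have "p'' \<in> residuals B p"
        by (rule Bind.IH(1)[OF 1(2) _ _ Bind.prems(4) x(1)]) (use 1 Bind.prems in auto)
      then show ?thesis using x by auto
    qed
  next
    case 2
    have "q' \<in> residuals B (f a)"
      by (rule Bind.IH(2)[OF _ 2(2) _ Bind.prems(3-5)]) (use 2 Bind.prems in auto)
    then show ?thesis using 2 by auto
  qed
next
  case (Loop f v)
  from Loop.prems(1) consider u where "u < B" "q = Loop f u" | u where "q = Ret u"
    | u p' where "u < B" "q = Bind p' (loop_cont f)" "p' \<in> residuals B (f u)" by auto
  then show ?case
  proof cases
    case 1
    then show ?thesis using Loop.prems self_residuals[of B K "f u"] by auto
  next
    case 2
    then show ?thesis using Loop.prems by auto
  next
    case 3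
    show ?thesis
    proof (cases "prog_step p' c")
      case None
      then obtain v where v: "p' = Ret v" by (auto simp: prog_step_None)
      then have "v < B" "q' = loop_cont f v" using 3 Loop.prems by auto
      then have "v div 2 < B" "q' = Ret (v div 2) \<or> q' = Loop f (v div 2)" by (auto simp: loop_cont_def)
      then show ?thesis by auto
    next
      case (Some x)
      then obtain p'' where x: "prog_step p' c = Some (p'', c', e)" "q' = Bind p'' (loop_cont f)"
        using 3 Loop.prems(5) by (cases x) auto
      have "p'' \<in> residuals B (f u)"
        by (rule Loop.IH[OF _ 3(3) _ _ Loop.prems(4) x(1)]) (use 3 Loop.prems in auto)
      then show ?thesis using 3 x by auto
    qed
  qed
qed auto

section \<open>Numbering programs and cells as machine states and symbols\<close>

definition inp :: "nat \<Rightarrow> nat \<Rightarrow> nat" where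
  "inp a = (\<lambda>_. 0)(1 := a)"

lemma inp_inj: "inp a = inp b \<longleftrightarrow> a = b"
  unfolding inp_def by (metis fun_upd_same)

text \<open>The start and halting states and the codes of the blank and the input symbols are
  prescribed by the machine model, so the numbering of programs and cells has to extend given
  values.\<close>

lemma inj_extend:
  assumes "finite A" "inj_on g {..<k::nat}"
  shows "\<exists>e::'a \<Rightarrow> nat. inj_on e A \<and> (\<forall>j<k. e (g j) = j)"
proof -
  obtain h :: "'a \<Rightarrow> nat" where h: "inj_on h A"
    using assms(1) finite_imp_inj_to_nat_seg by blast
  \<comment> \<open>Shifting the remaining codes by \<open>k\<close> keeps them apart from the
    prescribed values below \<open>k\<close>.\<close>
  define e where "e x = (if x \<in> g ` {..<k} then inv_into {..<k} g x else h x + k)" for x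
  have "e (g j) = j" if "j < k" for j
    using that assms(2) by (auto simp: e_def)
  moreover have "inj_on e A"
  proof (rule inj_onI)
    fix x y assume A: "x \<in> A" "y \<in> A" "e x = e y"
    have lt: "inv_into {..<k} g z < k" if "z \<in> g ` {..<k}" for z
      using inv_into_into[OF that] by simp
    show "x = y"
      using A lt[of x] lt[of y] h
      by (auto simp: e_def inj_on_def split: if_splits intro: inv_into_injective)
  qed
  ultimately show ?thesis by blast
qed

text \<open>The initial tape carries no home mark, so it is written before \<open>p\<close> starts.
  Being a \<open>Do\<close>, the result differs from \<open>Ret 0\<close> and \<open>Ret 1\<close>,
  which keeps the start state apart from the halting states whatever \<open>p\<close> is.\<close>

definition boot :: "prog \<Rightarrow> prog" where
  "boot p = Do 0 (\<lambda>a. a) (\<lambda>_. -1) (\<lambda>_. Do 0 (\<lambda>_. 1) (\<lambda>_. 0) (\<lambda>_. p))"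

text \<open>The bottom of stack 1 lies at position 0 and the input extends to the right from there,
  so its last symbol is on top. \<open>sym_code\<close> is one more than \<open>sym_rank\<close>,
  which matches the shift by \<open>Suc\<close> in \<open>stk\<close>.\<close>

definition start :: "sym list \<Rightarrow> store" where
  "start w = (\<lambda>_. [])(1 := rev (map sym_rank w))"

definition tape0 :: "sym list \<Rightarrow> int \<Rightarrow> nat \<Rightarrow> nat" where
  "tape0 w i = inp (if 0 \<le> i \<and> i < int (length w) then sym_code (w ! nat i) else 0)"

lemma run_boot:
  assumes "exec p (start w) t v s'"
  shows "\<exists>T' n. run (boot p) (tape0 w) 0 n v T' (-1) \<and> n \<le> 2 + t * (30 * (length w + t + 1))"
proof -
  let ?T = "(tape0 w)(-1 := (tape0 w (-1))(0 := 1))"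
  have "rep (start w) ?T"
    by (auto simp: rep_def start_def tape0_def inp_def stk_def sym_code_def)
  moreover have "\<forall>i. length (start w i) \<le> length w" by (simp add: start_def)
  ultimately obtain T' n where "run p ?T (-1) n v T' (-1)" "n \<le> t * (30 * (length w + t + 1))"
    using assms unfolding exec_def by blast
  then have "run (boot p) (tape0 w) 0 (Suc (Suc n)) v T' (-1)"
    unfolding boot_def by (intro run_Do) simp
  then show ?thesis using \<open>n \<le> _\<close> by (intro exI[of _ T'] exI[of _ "Suc (Suc n)"]) auto
qed

text \<open>States are the residual programs and symbols the columns of cells, both numbered
  injectively; the table is deterministic because \<open>prog_step\<close> is a function.
  \<open>6 \<le> B\<close> admits the blank and the five input codes, \<open>2 \<le> K\<close> the
  input track.\<close>

lemma prog_machine: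
  assumes wf: "wf_prog B K p" and BK: "6 \<le> B" "2 \<le> K"
  shows "\<exists>M. dtm M \<and> (\<forall>w t v s'. exec p (start w) t v s' \<longrightarrow> v \<in> {0, 1} \<longrightarrow>
    (\<exists>n cf. (step M ^^ n) (init w) cf \<and> state cf = (if v = 1 then 1 else 2) \<and>
        n \<le> 2 + t * (30 * (length w + t + 1))))"
proof -
  let ?p = "boot p"
  \<comment> \<open>Restricting to well-formed residuals gives closure under
    \<open>prog_step\<close>; the two results are added so that they receive state numbers.\<close>
  define Q where "Q = {q \<in> residuals B ?p \<union> {Ret 0, Ret 1}. wf_prog B K q}"
  define g where "g j = (if j = 0 then ?p else if j = 1 then Ret 1 else Ret 0)" for j :: nat
  have wfb: "wf_prog B K ?p" using wf BK by (simp add: boot_def)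
  have finQ: "finite Q" using finite_residuals by (auto simp: Q_def)
  have "inj_on g {..<3}" by (auto simp: inj_on_def g_def boot_def split: if_splits)
  then obtain e where e: "inj_on e Q" "\<forall>j<3. e (g j) = j"
    using inj_extend[OF finQ] by blast
  have e012: "e ?p = 0" "e (Ret 1) = 1" "e (Ret 0) = 2"
    using e(2)[rule_format, of 0] e(2)[rule_format, of 1] e(2)[rule_format, of 2] by (auto simp: g_def)
  have inQ: "Ret 0 \<in> Q" "Ret 1 \<in> Q" "?p \<in> Q" using BK wfb self_residuals by (auto simp: Q_def)
  have "inj_on inp {..<6}" by (auto simp: inj_on_def inp_inj)
  then obtain ec where ec: "inj_on ec (cells B K)" "\<forall>j<6. ec (inp j) = j"
    using inj_extend[OF finite_cells] by blast
  define tr where "tr = (\<lambda>(q, c). case prog_step q c of Some (q', c', d) \<Rightarrow> (e q, ec c, e q', ec c', d) | None \<Rightarrow> undefined)"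
  define M where "M = tr ` {(q, c) \<in> Q \<times> cells B K. prog_step q c \<noteq> None}"
  have Mmem: "x \<in> M \<longleftrightarrow> (\<exists>q c q' c' d. q \<in> Q \<and> c \<in> cells B K \<and> prog_step q c = Some (q', c', d) \<and> x = (e q, ec c, e q', ec c', d))" for x
  proof
    assume "x \<in> M"
    then obtain q c where qc: "q \<in> Q" "c \<in> cells B K" "prog_step q c \<noteq> None" "x = tr (q, c)"
      unfolding M_def by blast
    then obtain q' c' d where "prog_step q c = Some (q', c', d)" by (cases "prog_step q c") auto
    with qc show "\<exists>q c q' c' d. q \<in> Q \<and> c \<in> cells B K \<and> prog_step q c = Some (q', c', d) \<and> x = (e q, ec c, e q', ec c', d)"
      by (intro exI[of _ q] exI[of _ c] exI[of _ q'] exI[of _ c'] exI[of _ d]) (simp add: tr_def)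
  next
    assume "\<exists>q c q' c' d. q \<in> Q \<and> c \<in> cells B K \<and> prog_step q c = Some (q', c', d) \<and> x = (e q, ec c, e q', ec c', d)"
    then obtain q c q' c' d where qc: "q \<in> Q" "c \<in> cells B K" "prog_step q c = Some (q', c', d)" "x = (e q, ec c, e q', ec c', d)"
      by blast
    then have "x = tr (q, c)" by (simp add: tr_def)
    with qc show "x \<in> M" unfolding M_def by blast
  qed
  have clos: "q' \<in> Q \<and> c' \<in> cells B K \<and> d \<in> {-1,0,1}" if "q \<in> Q" "c \<in> cells B K" "prog_step q c = Some (q', c', d)" for q c q' c' d
  proof -
    have "q \<in> residuals B ?p" "wf_prog B K q" using that by (auto simp: Q_def)
    then show ?thesis
      using prog_step_wf[OF _ that(2,3)] prog_step_residuals[OF _ wfb _ that(2,3)] by (simp add: Q_def)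
  qed
  have "finite M"
    unfolding M_def using finQ finite_cells by (intro finite_imageI finite_subset[of "{(q, c) \<in> Q \<times> cells B K. prog_step q c \<noteq> None}" "Q \<times> cells B K"]) auto
  moreover have q12: "e q \<noteq> 1 \<and> e q \<noteq> 2" if "q \<in> Q" "prog_step q c = Some y" for q c y
  proof -
    \<comment> \<open>A program that can take a step is not a \<open>Ret\<close>, so no transition
      leaves the halting states 1 and 2.\<close>
    have "q \<noteq> Ret 0" "q \<noteq> Ret 1" using that by auto
    then show ?thesis using inj_onD[OF e(1), of q "Ret 0"] inj_onD[OF e(1), of q "Ret 1"] inQ that(1) e012 by auto
  qed
  moreover have "case x of (q, a, q', b, d) \<Rightarrow> q \<noteq> 1 \<and> q \<noteq> 2 \<and> d \<in> {-1, 0, 1}" if xM: "x \<in> M" for x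
  proof -
    obtain q c q' c' d where 1: "q \<in> Q" "c \<in> cells B K" "prog_step q c = Some (q', c', d)" "x = (e q, ec c, e q', ec c', d)"
      using xM unfolding Mmem by blast
    have "d \<in> {-1, 0, 1}" using clos[OF 1(1-3)] by blast
    moreover have "e q \<noteq> 1 \<and> e q \<noteq> 2" by (rule q12[OF 1(1,3)])
    ultimately show ?thesis unfolding 1(4) by blast
  qed
  ultimately have "ntm M" unfolding ntm_def by blast
  moreover have "t1 = t2" if m: "(a, b, t1) \<in> M" "(a, b, t2) \<in> M" for a b t1 t2
  proof -
    from m(1) obtain q c q' c' d where 1: "q \<in> Q" "c \<in> cells B K" "prog_step q c = Some (q', c', d)" "a = e q" "b = ec c" "t1 = (e q', ec c', d)"
      unfolding Mmem by blast
    from m(2) obtain r x r' x' d' where 2: "r \<in> Q" "x \<in> cells B K" "prog_step r x = Some (r', x', d')" "a = e r" "b = ec x" "t2 = (e r', ec x', d')"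
      unfolding Mmem by blast
    have "q = r" "c = x" using 1 2 e(1) ec(1) by (auto simp: inj_on_def)
    then show ?thesis using 1 2 by simp
  qed
  ultimately have dtm: "dtm M" unfolding dtm_def by blast
  have sim: "\<exists>cf. (step M ^^ n) (e q, (\<lambda>x. ec (T x)), h) cf \<and> state cf = e (Ret v)"
    if "run q T h n v T' h'" "q \<in> Q" "\<And>x. T x \<in> cells B K" for n q T h v T' h'
    using that unfolding run_def
  proof (induction n arbitrary: q T h)
    case 0
    then show ?case by (auto simp: state_def)
  next
    case (Suc n)
    from Suc.prems(1) obtain y where y: "tape_step (q, T, h) y" "(tape_step ^^ n) y (Ret v, T', h')"
      by (rule relpowp_Suc_E2)
    then obtain q' c d where q': "prog_step q (T h) = Some (q', c, d)" "y = (q', T(h := c), h + d)"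
      by (auto simp: tape_step_def)
    have cl: "q' \<in> Q" "c \<in> cells B K" using clos[OF Suc.prems(2) Suc.prems(3) q'(1)] by auto
    have "(T(h := c)) x \<in> cells B K" for x using cl(2) Suc.prems(3) by simp
    then obtain cf where cf: "(step M ^^ n) (e q', (\<lambda>x. ec ((T(h := c)) x)), h + d) cf" "state cf = e (Ret v)"
      using Suc.IH[OF y(2)[unfolded q'(2)] cl(1)] by blast
    have "(e q, ec (T h), e q', ec c, d) \<in> M"
      using Mmem q'(1) Suc.prems by blast
    then have "step M (e q, (\<lambda>x. ec (T x)), h) (e q', (\<lambda>x. ec ((T(h := c)) x)), h + d)"
      by (auto simp: step_def fun_eq_iff)
    from relpowp_Suc_I2[of "step M", OF this cf(1)] show ?case using cf(2) by blast
  qed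
  have "sym_code s < 6" for s by (cases s) (auto simp: sym_code_def)
  moreover from this have "tape0 w x \<in> cells B K" for w x
    using BK by (auto simp: tape0_def cells_def inp_def intro: less_le_trans)
  moreover have "ec (inp j) = j" if "j < 6" for j using ec(2) that by blast
  ultimately have ini: "init w = (e ?p, (\<lambda>x. ec (tape0 w x)), 0)" "\<And>x. tape0 w x \<in> cells B K" for w
    by (auto simp: init_def e012 tape0_def)
  show ?thesis
  proof (intro exI[of _ M] conjI allI impI)
    show "dtm M" by (rule dtm)
    fix w t v s' assume a: "exec p (start w) t v s'" "v \<in> {0, 1}"
    obtain T' n where n: "run ?p (tape0 w) 0 n v T' (-1)" "n \<le> 2 + t * (30 * (length w + t + 1))"
      using run_boot[OF a(1)] by blast
    obtain cf where "(step M ^^ n) (init w) cf" "state cf = e (Ret v)"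
      using sim[OF n(1) inQ(3) ini(2)] ini(1) by auto
    then show "\<exists>n cf. (step M ^^ n) (init w) cf \<and> state cf = (if v = 1 then 1 else 2) \<and>
        n \<le> 2 + t * (30 * (length w + t + 1))"
      using n(2) a(2) e012 by (intro exI[of _ n] exI[of _ cf]) auto
  qed
qed

section \<open>Unit propagation by saturation\<close>

definition neg :: "lit \<Rightarrow> lit" where
  "neg l = (fst l, \<not> snd l)"

lemma neg_neg [simp]: "neg (neg l) = l"
  by (simp add: neg_def)

lemma fst_neg [simp]: "fst (neg l) = fst l"
  by (simp add: neg_def)

definition conf :: "lit list list \<Rightarrow> lit list \<Rightarrow> bool" where
  "conf cs P \<longleftrightarrow> (\<exists>C\<in>set cs. \<forall>l\<in>set C. neg l \<in> set P)"

text \<open>This subsumes the unit rule: if all literals of a clause except \<open>l\<close> are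
  falsified by \<open>P\<close>, then \<open>neg l\<close> completes a conflict. Once
  \<open>P\<close> itself has a conflict every literal is added, which does no harm because
  \<open>conf\<close> is monotone.\<close>

definition prop1 :: "lit list list \<Rightarrow> lit \<Rightarrow> lit list \<Rightarrow> lit list" where
  "prop1 cs l P = (if conf cs (neg l # P) then l # P else P)"

definition up_round :: "lit list list \<Rightarrow> lit list \<Rightarrow> lit list" where
  "up_round cs P = fold (prop1 cs) (concat cs) P"

lemma conf_mono: "conf cs P \<Longrightarrow> set P \<subseteq> set Q \<Longrightarrow> conf cs Q"
  unfolding conf_def by blast

lemma prop1_ext: "set P \<subseteq> set (prop1 cs l P)"
  by (auto simp: prop1_def)

lemma fold_prop1_ext: "set P \<subseteq> set (fold (prop1 cs) ls P)"
proof (induction ls arbitrary: P)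
  case (Cons l ls)
  show ?case using Cons[of "prop1 cs l P"] prop1_ext[of P cs l] by simp
qed simp

text \<open>The list only grows during the pass, so a literal that is forced at the start is still
  forced when its turn comes.\<close>

lemma fold_prop1_unit:
  "l \<in> set ls \<Longrightarrow> conf cs (neg l # P) \<Longrightarrow> l \<in> set (fold (prop1 cs) ls P)"
proof (induction ls arbitrary: P)
  case (Cons k ls)
  show ?case
  proof (cases "l = k")
    case True
    then have "l \<in> set (prop1 cs k P)" using Cons.prems by (simp add: prop1_def)
    then show ?thesis using fold_prop1_ext[of "prop1 cs k P" cs ls] by auto
  next
    case False
    have "conf cs (neg l # prop1 cs k P)"
      using Cons.prems(2) prop1_ext[of P cs k] by (elim conf_mono) auto
    then show ?thesis using Cons False by simp
  qed
qed simp

lemma up_rounds_ext: "set P \<subseteq> set ((up_round cs ^^ n) P)"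
proof (induction n)
  case (Suc n)
  then show ?case using fold_prop1_ext[of "(up_round cs ^^ n) P" cs "concat cs"]
    unfolding funpow.simps o_apply up_round_def[of cs "(up_round cs ^^ n) P"] by (rule order_trans)
qed simp

lemma up_rounds_mono: "m \<le> n \<Longrightarrow> set ((up_round cs ^^ m) P) \<subseteq> set ((up_round cs ^^ n) P)"
  using up_rounds_ext[of "(up_round cs ^^ m) P" "n - m" cs] funpow_add[of "n - m" m "up_round cs"]
  by simp

section \<open>Injectivity of literal codes and the order of unit clauses\<close>

declare bin.simps [simp del]

lemma bin_nonempty [simp]: "bin n \<noteq> []"
  by (subst bin.simps) simp

lemma set_bin: "set (bin n) \<subseteq> {S0, S1}"
proof (induction n rule: bin.induct)
  case (1 n)
  then show ?case by (subst bin.simps) auto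
qed

lemma bin_inj: "bin m = bin n \<longleftrightarrow> m = n"
proof -
  \<comment> \<open>Horner evaluation of the binary digits, a left inverse of
    \<open>bin\<close>.\<close>
  define bval where "bval = foldl (\<lambda>a s. 2 * a + (if s = S0 then 0 else 1::nat)) 0"
  have "bval (bin n) = n" for n
  proof (induction n rule: bin.induct)
    case (1 n)
    show ?case
    proof (cases "n < 2")
      case True
      then show ?thesis by (subst bin.simps) (auto simp: bval_def)
    next
      case False
      then have "bval (bin (n div 2)) = n div 2" by (rule 1)
      then show ?thesis using False by (subst bin.simps) (simp add: bval_def; presburger)
    qed
  qed
  then show ?thesis by metis
qed

lemma enc_lit_inj: "enc_lit l = enc_lit k \<longleftrightarrow> l = k"
proof -
  have "bin m \<noteq> SNeg # x" for m x
    using set_bin[of m] by auto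
  moreover from this have "SNeg # x \<noteq> bin m" for m x
    by metis
  ultimately show ?thesis
    by (simp add: enc_lit_def bin_inj prod_eq_iff)
qed

lemma lex_less_total: "lex_less u v \<or> u = v \<or> lex_less v u"
proof -
  have "inj sym_rank"
  proof (rule injI)
    fix a b show "sym_rank a = sym_rank b \<Longrightarrow> a = b" by (cases a; cases b) auto
  qed
  then have "\<forall>a b. (a, b) \<in> sym_less \<or> a = b \<or> (b, a) \<in> sym_less"
    by (auto simp: sym_less_def inj_def)
  then show ?thesis unfolding lex_less_def by (rule lexord_linear)
qed

lemma lex_less_trans: "lex_less u v \<Longrightarrow> lex_less v w \<Longrightarrow> lex_less u w"
  unfolding lex_less_def by (rule lexord_trans) (auto simp: trans_def sym_less_def)

lemma lex_less_irrefl: "\<not> lex_less u u"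
  unfolding lex_less_def by (rule lexord_irreflexive) (auto simp: sym_less_def)

text \<open>\<open>least_unit\<close> is a definite description, so existence and uniqueness of the
  lexicographic minimum come first: the unit clauses are finitely many, and their encodings are
  distinct and totally ordered.\<close>

lemma least_unit_mem:
  assumes "finite F" "{l0} \<in> F"
  shows "{least_unit F} \<in> F"
proof -
  let ?R = "\<lambda>l l'. lex_less (enc_clause [l]) (enc_clause [l'])"
  let ?P = "\<lambda>l. {l} \<in> F \<and> (\<forall>l'. {l'} \<in> F \<longrightarrow> l' = l \<or> ?R l l')"
  have tot: "?R l k \<or> l = k \<or> ?R k l" for l k
    using lex_less_total[of "enc_clause [l]" "enc_clause [k]"] by (auto simp: enc_clause_def enc_lit_inj)
  have "finite U \<Longrightarrow> U \<noteq> {} \<Longrightarrow> \<exists>l\<in>U. \<forall>l'\<in>U. l' = l \<or> ?R l l'" for U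
  proof (induction U rule: finite_ne_induct)
    case (insert x U)
    then obtain l where l: "l \<in> U" "\<forall>l'\<in>U. l' = l \<or> ?R l l'" by blast
    show ?case
    proof (cases "?R x l")
      case True
      have "?R x l'" if "l' \<in> U" for l'
        using l that True lex_less_trans[OF True, of "enc_clause [l']"] by auto
      then have "\<forall>l'\<in>insert x U. l' = x \<or> ?R x l'" by simp
      then show ?thesis by blast
    next
      case False
      then have "x = l \<or> ?R l x" using tot by blast
      then show ?thesis using l by blast
    qed
  qed simp
  moreover have "finite {l. {l} \<in> F}"
    using assms(1) by (rule finite_inverse_image[of F "\<lambda>l. {l}", unfolded vimage_def]) (auto simp: inj_on_def)
  moreover have "{l. {l} \<in> F} \<noteq> {}" using assms(2) by blast
  ultimately have "\<exists>l\<in>{l. {l} \<in> F}. \<forall>l'\<in>{l. {l} \<in> F}. l' = l \<or> ?R l l'" by metis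
  then obtain l where l: "?P l" by auto
  have uniq: "k = l" if k: "?P k" for k
  proof (rule ccontr)
    assume "k \<noteq> l"
    then have "?R l k" "?R k l" using k l by (metis, metis)
    then have "?R k k" using lex_less_trans by metis
    then show False using lex_less_irrefl by metis
  qed
  have "least_unit F = l" unfolding least_unit_def using l uniq by (rule the_equality)
  then show ?thesis using l by blast
qed

text \<open>The third assumption is the invariant: every clause of the current formula
  \<open>H\<close> is a clause of \<open>cs\<close> from which only literals falsified by
  \<open>P\<close> were deleted. A step of the subsolver deletes \<open>neg l\<close> for the chosen
  unit \<open>l\<close>, and one round puts \<open>l\<close> into the list, so the invariant
  survives. An empty clause in \<open>H\<close> is then a conflict.\<close>

lemma up_aux_unsat:
  assumes "up_aux k a H = Unsat" "finite H"
    and "\<And>C'. C' \<in> H \<Longrightarrow> \<exists>C\<in>set cs. C' \<subseteq> set C \<and> (\<forall>l\<in>set C - C'. neg l \<in> set P)"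
  shows "conf cs ((up_round cs ^^ k) P)"
  using assms
proof (induction k arbitrary: a H P)
  case 0
  then have "{} \<in> H" by (auto simp: trivially_false_def split: if_splits)
  then show ?case using 0(3) by (force simp: conf_def)
next
  case (Suc k)
  let ?Q = "up_round cs P"
  show ?case
  proof (cases "{} \<in> H")
    case True
    then have "conf cs P" using Suc.prems(3) by (force simp: conf_def)
    then show ?thesis using conf_mono up_rounds_ext by blast
  next
    case False
    define l where "l = least_unit H"
    have exec: "\<exists>l. {l} \<in> H" and
      un: "up_aux k (a(fst l := snd l)) (assign {fst l} (\<lambda>_. snd l) H) = Unsat"
      using Suc.prems(1) False by (auto simp: trivially_false_def l_def Let_def split: if_splits)
    then have lH: "{l} \<in> H" using least_unit_mem[OF Suc.prems(2)] by (auto simp: l_def)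
    then obtain C where C: "C \<in> set cs" "l \<in> set C" "\<forall>k\<in>set C - {l}. neg k \<in> set P"
      using Suc.prems(3) by blast
    then have "conf cs (neg l # P)" by (auto simp: conf_def)
    moreover have "l \<in> set (concat cs)" using C by auto
    ultimately have lQ: "l \<in> set ?Q" unfolding up_round_def by (rule fold_prop1_unit[rotated])
    have PQ: "set P \<subseteq> set ?Q" unfolding up_round_def by (rule fold_prop1_ext)
    have "conf cs ((up_round cs ^^ k) ?Q)"
    proof (rule Suc.IH[OF un])
      show "finite (assign {fst l} (\<lambda>_. snd l) H)"
        unfolding assign_def using Suc.prems(2) by simp
      fix C' assume "C' \<in> assign {fst l} (\<lambda>_. snd l) H"
      then obtain D where D: "D \<in> H" "C' = D - {m. fst m \<in> {fst l}}"
        "\<not> (\<exists>m\<in>D. fst m \<in> {fst l} \<and> snd l = snd m)"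
        unfolding assign_def by blast
      then obtain E where E: "E \<in> set cs" "D \<subseteq> set E" "\<forall>m\<in>set E - D. neg m \<in> set P"
        using Suc.prems(3) by blast
      \<comment> \<open>A literal lost in this step has the variable of \<open>l\<close>; as the
        clause \<open>D\<close> was not removed as true, it must be \<open>neg l\<close>.\<close>
      have "neg m \<in> set ?Q" if "m \<in> set E - C'" for m
      proof (cases "m \<in> D")
        case True
        then have "fst m = fst l" "snd m \<noteq> snd l" using that D by auto
        then have "neg m = l" by (auto simp: neg_def prod_eq_iff)
        then show ?thesis using lQ by simp
      next
        case False
        then show ?thesis using that E PQ by blast
      qed
      then show "\<exists>C\<in>set cs. C' \<subseteq> set C \<and> (\<forall>m\<in>set C - C'. neg m \<in> set ?Q)"
        using E(1,2) D(2) by blast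
    qed
    then show ?thesis by (simp add: funpow_swap1)
  qed
qed

section \<open>Soundness of saturation and the backdoor criterion\<close>

lemma conf_sound:
  assumes "satisfies a (set (map set cs))" "\<forall>l\<in>set P. a (fst l) = snd l"
  shows "\<not> conf cs P"
proof
  assume "conf cs P"
  then obtain C where C: "C \<in> set cs" "\<forall>l\<in>set C. neg l \<in> set P" by (auto simp: conf_def)
  then obtain l where "l \<in> set C" "a (fst l) = snd l" using assms(1) by (auto simp: satisfies_def)
  then show False using C assms(2) by (force simp: neg_def)
qed

text \<open>If \<open>a\<close> satisfies the formula and \<open>P\<close>, a conflict of
  \<open>neg k # P\<close> can only be due to \<open>neg k\<close>, so \<open>a\<close> makes
  \<open>k\<close> true.\<close>

lemma prop1_sound:
  assumes "satisfies a (set (map set cs))" "\<forall>l\<in>set P. a (fst l) = snd l"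
  shows "\<forall>l\<in>set (prop1 cs k P). a (fst l) = snd l"
proof (cases "conf cs (neg k # P)")
  case True
  then have "\<not> (\<forall>l\<in>set (neg k # P). a (fst l) = snd l)" using conf_sound[OF assms(1)] by blast
  then have "a (fst k) = snd k" using assms(2) by (auto simp: neg_def)
  then show ?thesis using assms(2) by (auto simp: prop1_def)
qed (use assms(2) in \<open>auto simp: prop1_def\<close>)

lemma up_rounds_sound:
  assumes "satisfies a (set (map set cs))" "\<forall>l\<in>set P. a (fst l) = snd l"
  shows "\<forall>l\<in>set ((up_round cs ^^ n) P). a (fst l) = snd l"
proof -
  have "\<forall>l\<in>set Q. a (fst l) = snd l \<Longrightarrow> \<forall>l\<in>set (fold (prop1 cs) ls Q). a (fst l) = snd l" for Q ls
  proof (induction ls arbitrary: Q)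
    case (Cons l ls)
    show ?case unfolding fold_simps o_apply by (rule Cons.IH[OF prop1_sound[OF assms(1) Cons.prems]])
  qed simp
  note fold = this
  show ?thesis
  proof (induction n)
    case (Suc n)
    show ?case unfolding funpow.simps o_apply up_round_def[of cs "(up_round cs ^^ n) P"] by (rule fold[OF Suc.IH])
  qed (use assms(2) in simp)
qed

lemma satisfiable_assign:
  assumes "satisfiable (assign S a F)"
  shows "satisfiable F"
proof -
  obtain b where b: "satisfies b (assign S a F)" using assms by (auto simp: satisfiable_def)
  have "satisfies (\<lambda>x. if x \<in> S then a x else b x) F"
    unfolding satisfies_def
  proof
    fix C assume C: "C \<in> F"
    show "\<exists>l\<in>C. (if fst l \<in> S then a (fst l) else b (fst l)) = snd l"
    proof (cases "\<exists>l\<in>C. fst l \<in> S \<and> a (fst l) = snd l")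
      case True
      then obtain l where "l \<in> C" "fst l \<in> S" "a (fst l) = snd l" by blast
      then show ?thesis by (intro bexI[of _ l]) simp_all
    next
      case False
      then have "C - {l. fst l \<in> S} \<in> assign S a F" using C by (auto simp: assign_def)
      then obtain l where "l \<in> C - {l. fst l \<in> S}" "b (fst l) = snd l" using b unfolding satisfies_def by blast
      then show ?thesis by (intro bexI[of _ l]) simp_all
    qed
  qed
  then show ?thesis by (auto simp: satisfiable_def)
qed

text \<open>From left to right, a satisfying assignment restricted to \<open>vs\<close> works, since
  saturation derives only literals true under it. Conversely, the signs in \<open>D\<close> define a
  partial assignment; either the simplified formula is satisfiable, or the subsolver answers
  \<open>Unsat\<close> on it and \<open>up_aux_unsat\<close> yields a conflict, against the choice
  of \<open>D\<close>.\<close>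

lemma backdoor_rounds:
  assumes bd: "strong_backdoor_up (set (map set cs)) (set vs)" and d: "distinct vs"
    and n: "length (concat cs) \<le> n"
  shows "satisfiable (set (map set cs)) \<longleftrightarrow>
    (\<exists>D. map fst D = vs \<and> \<not> conf cs ((up_round cs ^^ n) D))"
proof
  let ?F = "set (map set cs)"
  assume "satisfiable ?F"
  then obtain a where a: "satisfies a ?F" by (auto simp: satisfiable_def)
  let ?D = "map (\<lambda>x. (x, a x)) vs"
  have "\<not> conf cs ((up_round cs ^^ n) ?D)"
    by (rule conf_sound[OF a up_rounds_sound[OF a]]) auto
  moreover have "map fst ?D = vs" by (simp add: comp_def)
  ultimately show "\<exists>D. map fst D = vs \<and> \<not> conf cs ((up_round cs ^^ n) D)" by blast
next
  let ?F = "set (map set cs)"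
  assume "\<exists>D. map fst D = vs \<and> \<not> conf cs ((up_round cs ^^ n) D)"
  then obtain D where D: "map fst D = vs" "\<not> conf cs ((up_round cs ^^ n) D)" by blast
  define a where "a x = the (map_of D x)" for x
  have a: "(x, a x) \<in> set D" if x: "x \<in> set vs" for x
  proof -
    have "map_of D x \<noteq> None" unfolding map_of_eq_None_iff using x D(1) by auto
    then have "map_of D x = Some (a x)" by (simp add: a_def)
    then show ?thesis by (rule map_of_SomeD)
  qed
  let ?G = "assign (set vs) a ?F"
  have S: "set vs \<noteq> {}" "set vs \<subseteq> vars ?F" "up_determines ?G"
    using bd unfolding strong_backdoor_up_def by blast+
  have varF: "vars ?F = fst ` set (concat cs)" unfolding vars_def by auto
  then have finF: "finite (vars ?F)" by simp
  have sub: "vars ?G \<subseteq> vars ?F - set vs"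
  proof
    fix x assume "x \<in> vars ?G"
    then obtain C l where "l \<in> C - {l. fst l \<in> set vs}" "C \<in> ?F" "x = fst l"
      unfolding vars_def assign_def by blast
    then show "x \<in> vars ?F - set vs" unfolding vars_def by blast
  qed
  \<comment> \<open>The backdoor is nonempty, so at least one variable disappears; this compensates
    the \<open>+ 1\<close> in the fuel of \<open>unit_prop\<close>.\<close>
  obtain x where "x \<in> set vs" using S(1) by (meson ex_in_conv)
  then have "x \<in> vars ?F" "x \<notin> vars ?G" using S(2) sub by auto
  then have "vars ?G \<subset> vars ?F" using sub by (intro psubsetI) auto
  then have "card (vars ?G) < card (vars ?F)" by (rule psubset_card_mono[OF finF])
  also have "card (vars ?F) \<le> length (concat cs)"
    using card_image_le[of "set (concat cs)" fst] card_length[of "concat cs"] unfolding varF by simp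
  finally have k: "card (vars ?G) + 1 \<le> n" using n by linarith
  show "satisfiable ?F"
  proof (cases "satisfiable ?G")
    case False
    then have "unit_prop ?G = Unsat" using S(3) unfolding up_determines_def satisfiable_def by blast
    then have "conf cs ((up_round cs ^^ (card (vars ?G) + 1)) D)"
      unfolding unit_prop_def
    proof (rule up_aux_unsat)
      show "finite ?G" by (simp add: assign_def)
      fix C' assume "C' \<in> ?G"
      then obtain C where C: "C \<in> set cs" "C' = set C - {l. fst l \<in> set vs}"
        "\<not> (\<exists>l\<in>set C. fst l \<in> set vs \<and> a (fst l) = snd l)" unfolding assign_def by auto
      have "neg l \<in> set D" if l: "l \<in> set C - C'" for l
      proof -
        have "fst l \<in> set vs" "a (fst l) \<noteq> snd l" using l C(2,3) by blast+
        then show ?thesis using a[of "fst l"] by (simp add: neg_def)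
      qed
      then show "\<exists>C\<in>set cs. C' \<subseteq> set C \<and> (\<forall>l\<in>set C - C'. neg l \<in> set D)"
        using C(1,2) by blast
    qed
    then have "conf cs ((up_round cs ^^ n) D)" using conf_mono up_rounds_mono[OF k] by blast
    then show ?thesis using D by blast
  qed (rule satisfiable_assign)
qed

section \<open>Simulating a Turing machine on stacks\<close>

abbreviation seq (infixr ";;" 60) where "p ;; q \<equiv> Bind p (\<lambda>_. q)"

lemma exec_conv: "exec p s t v s' \<Longrightarrow> t \<le> t' \<Longrightarrow> v = v' \<Longrightarrow> s' = s'' \<Longrightarrow> exec p s t' v' s''"
  using exec_mono by blast

lemma exec_popB: "0 < i \<Longrightarrow> exec (f (topv (s i))) (s(i := tl (s i))) t v s' \<Longrightarrow> exec (Bind (pop i) f) s (t + 2) v s'"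
  using exec_Bind[OF exec_pop] by (simp add: add.commute)

lemma exec_pushB: "0 < i \<Longrightarrow> exec p (s(i := x # s i)) t v s' \<Longrightarrow> exec (push i x ;; p) s (t + 2) v s'"
  using exec_Bind[OF exec_push, where f="\<lambda>_. p"] by (simp add: add.commute)

lemma wf_prog_pop [simp]: "i < K \<Longrightarrow> 2 \<le> B \<Longrightarrow> wf_prog B K (pop i)"
  by (auto simp: pop_def scanr_def home_def)

lemma wf_prog_push [simp]: "i < K \<Longrightarrow> 2 \<le> B \<Longrightarrow> Suc v < B \<Longrightarrow> wf_prog B K (push i v)"
  by (auto simp: push_def scanr_def home_def)

section \<open>Moving, copying and clearing stacks\<close>

definition mvg :: "(nat \<Rightarrow> nat) \<Rightarrow> nat \<Rightarrow> nat \<Rightarrow> prog" where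
  "mvg g i j = Loop (\<lambda>_. Bind (pop i) (\<lambda>r. if r = 0 then Ret 0 else push j (g (r - 1)) ;; Ret 1)) 0"

abbreviation "mv \<equiv> mvg (\<lambda>v. v)"

lemma wf_prog_mvg [simp]:
  "i < K \<Longrightarrow> j < K \<Longrightarrow> 2 \<le> B \<Longrightarrow> (\<And>v. Suc v < B \<Longrightarrow> Suc (g v) < B) \<Longrightarrow> wf_prog B K (mvg g i j)"
  by (auto simp: mvg_def)

lemma exec_mvg:
  assumes "0 < i" "0 < j" "i \<noteq> j"
  shows "exec (mvg g i j) s (10 * length (s i) + 10) 0 (s(i := [], j := rev (map g (s i)) @ s j))"
proof (induction "s i" arbitrary: s)
  case Nil
  let ?f = "\<lambda>_. Bind (pop i) (\<lambda>r. if r = 0 then Ret 0 else push j (g (r - 1)) ;; Ret 1)"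
  have "exec (?f 0) s (0 + 2) (2 * 0) (s(i := tl (s i)))"
    by (rule exec_popB[OF assms(1)]) (use Nil[symmetric] in \<open>simp add: exec_Ret\<close>)
  from exec_Loop_exit[where f="?f", OF this] show ?case unfolding mvg_def
    by (rule exec_conv) (use Nil[symmetric] in \<open>auto simp: fun_eq_iff\<close>)
next
  case (Cons x xs)
  let ?f = "\<lambda>_. Bind (pop i) (\<lambda>r. if r = 0 then Ret 0 else push j (g (r - 1)) ;; Ret 1)"
  let ?s = "s(i := xs, j := g x # s j)"
  have si: "s i = x # xs" using Cons by simp
  have "exec (push j (g x) ;; Ret 1) (s(i := xs)) (0 + 2) (2 * 0 + 1) ?s"
    by (rule exec_conv[OF exec_pushB[OF assms(2) exec_Ret]]) (use assms in auto)
  then have b: "exec (?f 0) s (0 + 2 + 2) (2 * 0 + 1) ?s"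
    by (intro exec_popB[OF assms(1)]) (simp add: si)
  have "exec (mvg g i j) ?s (10 * length xs + 10) 0 (s(i := [], j := rev (map g xs) @ g x # s j))"
    using Cons(1)[of ?s] assms by (simp add: fun_upd_twist)
  from exec_Loop_cont[where f="?f", OF b this[unfolded mvg_def]] show ?case unfolding mvg_def
    by (rule exec_conv) (auto simp: si)
qed

text \<open>A stack is read by popping it, so a copy has to be made while the stack is being
  moved.\<close>

definition mv2 :: "nat \<Rightarrow> nat \<Rightarrow> nat \<Rightarrow> prog" where
  "mv2 i j k = Loop (\<lambda>_. Bind (pop i) (\<lambda>r. if r = 0 then Ret 0 else push j (r - 1) ;; push k (r - 1) ;; Ret 1)) 0"

lemma wf_prog_mv2 [simp]:
  "i < K \<Longrightarrow> j < K \<Longrightarrow> k < K \<Longrightarrow> 2 \<le> B \<Longrightarrow> wf_prog B K (mv2 i j k)"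
  by (auto simp: mv2_def)

lemma exec_mv2:
  assumes "0 < i" "0 < j" "0 < k" "i \<noteq> j" "i \<noteq> k" "j \<noteq> k"
  shows "exec (mv2 i j k) s (10 * length (s i) + 10) 0
    (s(i := [], j := rev (s i) @ s j, k := rev (s i) @ s k))"
proof (induction "s i" arbitrary: s)
  case Nil
  let ?f = "\<lambda>_. Bind (pop i) (\<lambda>r. if r = 0 then Ret 0 else push j (r - 1) ;; push k (r - 1) ;; Ret 1)"
  have "exec (?f 0) s (0 + 2) (2 * 0) (s(i := tl (s i)))"
    by (rule exec_popB[OF assms(1)]) (use Nil[symmetric] in \<open>simp add: exec_Ret\<close>)
  from exec_Loop_exit[where f="?f", OF this] show ?case unfolding mv2_def
    by (rule exec_conv) (use Nil[symmetric] in \<open>auto simp: fun_eq_iff\<close>)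
next
  case (Cons x xs)
  let ?f = "\<lambda>_. Bind (pop i) (\<lambda>r. if r = 0 then Ret 0 else push j (r - 1) ;; push k (r - 1) ;; Ret 1)"
  let ?s = "s(i := xs, j := x # s j, k := x # s k)"
  have si: "s i = x # xs" using Cons by simp
  have "exec (push j x ;; push k x ;; Ret 1) (s(i := xs)) (0 + 2 + 2) (2 * 0 + 1) ?s"
    by (rule exec_conv[OF exec_pushB[OF assms(2) exec_pushB[OF assms(3) exec_Ret]]]) (use assms in auto)
  then have b: "exec (?f 0) s (0 + 2 + 2 + 2) (2 * 0 + 1) ?s"
    by (intro exec_popB[OF assms(1)]) (simp add: si)
  have "exec (mv2 i j k) ?s (10 * length xs + 10) 0
      (s(i := [], j := rev xs @ x # s j, k := rev xs @ x # s k))"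
    using Cons(1)[of ?s] assms by (simp add: fun_upd_twist)
  from exec_Loop_cont[where f="?f", OF b this[unfolded mv2_def]] show ?case unfolding mv2_def
    by (rule exec_conv) (auto simp: si)
qed

definition clr :: "nat \<Rightarrow> prog" where
  "clr i = Loop (\<lambda>_. Bind (pop i) (\<lambda>r. if r = 0 then Ret 0 else Ret 1)) 0"

lemma wf_prog_clr [simp]: "i < K \<Longrightarrow> 2 \<le> B \<Longrightarrow> wf_prog B K (clr i)"
  by (auto simp: clr_def)

lemma exec_clr:
  assumes "0 < i"
  shows "exec (clr i) s (10 * length (s i) + 10) 0 (s(i := []))"
proof (induction "s i" arbitrary: s)
  case Nil
  let ?f = "\<lambda>_. Bind (pop i) (\<lambda>r. if r = 0 then Ret 0 else Ret 1)"
  have "exec (?f 0) s (0 + 2) (2 * 0) (s(i := tl (s i)))"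
    by (rule exec_popB[OF assms]) (use Nil[symmetric] in \<open>simp add: exec_Ret\<close>)
  from exec_Loop_exit[where f="?f", OF this] show ?case unfolding clr_def
    by (rule exec_conv) (use Nil[symmetric] in \<open>auto simp: fun_eq_iff\<close>)
next
  case (Cons x xs)
  let ?f = "\<lambda>_. Bind (pop i) (\<lambda>r. if r = 0 then Ret 0 else Ret 1)"
  let ?s = "s(i := xs)"
  have si: "s i = x # xs" using Cons by simp
  have b: "exec (?f 0) s (0 + 2) (2 * 0 + 1) ?s"
    by (rule exec_popB[OF assms]) (use exec_Ret in \<open>simp add: si\<close>)
  have "exec (clr i) ?s (10 * length xs + 10) 0 (s(i := []))"
    using Cons(1)[of ?s] by simp
  from exec_Loop_cont[where f="?f", OF b this[unfolded clr_def]] show ?case unfolding clr_def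
    by (rule exec_conv) (auto simp: si)
qed

text \<open>Reading past the end gives \<open>0\<close>, the entry of an unmarked blank cell, so a
  finite list stands for an infinite half of the tape.\<close>

definition nthd :: "nat list \<Rightarrow> nat \<Rightarrow> nat" where
  "nthd xs k = (if k < length xs then xs ! k else 0)"

lemma nthd_simps [simp]: "nthd [] k = 0" "nthd (x # xs) 0 = x" "nthd (x # xs) (Suc k) = nthd xs k"
  by (auto simp: nthd_def)

lemma nthd_topv: "topv xs - Suc 0 = nthd xs 0"
  by (cases xs) auto

lemma nthd_tl: "nthd (tl xs) k = nthd xs (Suc k)"
  by (cases xs) auto

text \<open>
  The parity of an entry marks position \<open>0\<close> of the simulated tape, which has to be found again when the output is read.
\<close>

definition cell :: "(int \<Rightarrow> nat) \<Rightarrow> int \<Rightarrow> nat" where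
  "cell tp x = 2 * tp x + (if x = 0 then 1 else 0)"

text \<open>A zipper: \<open>rs\<close> lists the tape from the head to the right, \<open>ls\<close>
  the cells to its left with the nearest first, so a head move transfers one entry.\<close>

definition simrep :: "nat list \<Rightarrow> nat list \<Rightarrow> (int \<Rightarrow> nat) \<Rightarrow> int \<Rightarrow> bool" where
  "simrep ls rs tp h \<longleftrightarrow> (\<forall>k. nthd rs k = cell tp (h + int k)) \<and> (\<forall>k. nthd ls k = cell tp (h - 1 - int k))"

definition trans_fun :: "tm \<Rightarrow> nat \<Rightarrow> nat \<Rightarrow> (nat \<times> nat \<times> int) option" where
  "trans_fun M q a = (if \<exists>x. (q, a, x) \<in> M then Some (SOME x. (q, a, x) \<in> M) else None)"

text \<open>The loop argument is the simulated state, and \<open>2 * q' + 1\<close> continues in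
  \<open>q'\<close>. Without an applicable transition the loop ends, with value 1 exactly in state
  1. The summand \<open>(r - 1) mod 2\<close> writes the mark of position 0 back; an exhausted stack
  gives \<open>r - 1 = 0\<close>, a blank.\<close>

definition sim_body :: "tm \<Rightarrow> nat \<Rightarrow> prog" where
  "sim_body M q = Bind (pop 3) (\<lambda>r. case trans_fun M q ((r - 1) div 2) of
      None \<Rightarrow> push 3 (r - 1) ;; Ret (if q = 1 then 2 else 0)
    | Some (q', b, d) \<Rightarrow>
        if d = 0 then push 3 (2 * b + (r - 1) mod 2) ;; Ret (2 * q' + 1)
        else if d = 1 then push 2 (2 * b + (r - 1) mod 2) ;; Ret (2 * q' + 1)
        else push 3 (2 * b + (r - 1) mod 2) ;; Bind (pop 2) (\<lambda>x. push 3 (x - 1) ;; Ret (2 * q' + 1)))"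

lemma trans_fun_det: "dtm M \<Longrightarrow> (q, a, x) \<in> M \<Longrightarrow> trans_fun M q a = Some x"
  unfolding trans_fun_def dtm_def by (metis (mono_tags, lifting) someI)

lemma trans_fun_mem: "trans_fun M q a = Some x \<Longrightarrow> (q, a, x) \<in> M"
  unfolding trans_fun_def by (metis option.distinct(1) option.inject someI_ex)

lemma cell_upd: "cell (tp(h := b)) x = (if x = h then 2 * b + cell tp h mod 2 else cell tp x)"
  by (auto simp: cell_def)

lemma simrep_stay:
  "simrep ls rs tp h \<Longrightarrow> simrep ls ((2 * b + nthd rs 0 mod 2) # tl rs) (tp(h := b)) h"
  unfolding simrep_def by (auto simp: cell_upd nthd_tl nth_Cons' split: nat.split) (case_tac k; auto simp: cell_upd nthd_tl)

lemma simrep_right: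
  "simrep ls rs tp h \<Longrightarrow> simrep ((2 * b + nthd rs 0 mod 2) # ls) (tl rs) (tp(h := b)) (h + 1)"
proof -
  assume r: "simrep ls rs tp h"
  have "nthd ((2 * b + nthd rs 0 mod 2) # ls) k = cell (tp(h := b)) (h + 1 - 1 - int k)" for k
    using r by (cases k) (auto simp: simrep_def cell_upd algebra_simps)
  moreover have "nthd (tl rs) k = cell (tp(h := b)) (h + 1 + int k)" for k
    using r by (auto simp: simrep_def cell_upd nthd_tl algebra_simps)
  ultimately show ?thesis by (simp add: simrep_def)
qed

lemma simrep_left:
  "simrep ls rs tp h \<Longrightarrow> simrep (tl ls) (nthd ls 0 # (2 * b + nthd rs 0 mod 2) # tl rs) (tp(h := b)) (h - 1)"
proof -
  assume r: "simrep ls rs tp h"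
  have "nthd (tl ls) k = cell (tp(h := b)) (h - 1 - 1 - int k)" for k
    using r by (auto simp: simrep_def cell_upd nthd_tl algebra_simps)
  moreover have "nthd (nthd ls 0 # (2 * b + nthd rs 0 mod 2) # tl rs) k = cell (tp(h := b)) (h - 1 + int k)" for k
  proof (cases k)
    case (Suc j)
    then show ?thesis using r by (cases j) (auto simp: simrep_def cell_upd nthd_tl algebra_simps)
  qed (use r in \<open>auto simp: simrep_def cell_upd\<close>)
  ultimately show ?thesis by (simp add: simrep_def)
qed

text \<open>In the halting step the popped cell is pushed back; on an exhausted stack this makes a
  blank explicit.\<close>

lemma simrep_pad:
  "simrep ls rs tp h \<Longrightarrow> simrep ls (nthd rs 0 # tl rs) tp h"
proof -
  assume r: "simrep ls rs tp h"
  have "nthd (nthd rs 0 # tl rs) k = nthd rs k" for k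
    by (cases k) (auto simp: nthd_tl)
  then show ?thesis using r by (simp add: simrep_def)
qed

lemma dtm_trans:
  assumes "dtm M" "(q, a, q', b, d) \<in> M"
  shows "q \<noteq> 1 \<and> q \<noteq> 2 \<and> d \<in> {-1, 0, 1}"
proof -
  have "\<forall>(q, a, q', b, d)\<in>M. q \<noteq> 1 \<and> q \<noteq> 2 \<and> d \<in> {-1, 0, 1}"
    using assms(1) unfolding dtm_def ntm_def by (elim conjE)
  from bspec[OF this assms(2)] show ?thesis by simp
qed

text \<open>Each simulated step lengthens the two lists by at most two entries in total, the worst
  case being a left move on exhausted lists. The resulting bound pays for clearing the stacks and
  also limits the length of an output.\<close>

lemma exec_sim:
  assumes M: "dtm M" and q': "q' \<in> {1, 2}"
  shows "(step M ^^ n) (q, tp, h) (q', tp', h') \<Longrightarrow> simrep (s 2) (s 3) tp h \<Longrightarrow>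
    \<exists>ls rs. exec (Loop (sim_body M) q) s (12 * n + 12) (if q' = 1 then 1 else 0) (s(2 := ls, 3 := rs)) \<and>
      simrep ls rs tp' h' \<and> length ls + length rs \<le> length (s 2) + length (s 3) + 2 * n + 2"
proof (induction n arbitrary: q tp h s)
  case 0
  have "(q', a, x) \<notin> M" for a x
    using dtm_trans[OF M, of q' a] q' by (cases x) auto
  then have N: "trans_fun M q' a = None" for a by (simp add: trans_fun_def)
  let ?s = "s(3 := nthd (s 3) 0 # tl (s 3))"
  have "exec (sim_body M q') s 4 (2 * (if q' = 1 then 1 else 0)) ?s"
    unfolding sim_body_def
    by (rule exec_conv, rule exec_popB, simp, simp add: N split del: if_split, rule exec_pushB, simp, rule exec_Ret)
      (auto simp: nthd_topv)
  from exec_Loop_exit[where f="sim_body M", OF this]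
  have "exec (Loop (sim_body M) q') s 12 (if q' = 1 then 1 else 0) (s(2 := s 2, 3 := nthd (s 3) 0 # tl (s 3)))"
    by (rule exec_conv) (auto simp: fun_eq_iff)
  moreover have "simrep (s 2) (nthd (s 3) 0 # tl (s 3)) tp' h'" using simrep_pad[OF 0(2)] 0(1) by simp
  moreover have "q = q'" using 0(1) by simp
  ultimately have "exec (Loop (sim_body M) q) s (12 * 0 + 12) (if q' = 1 then 1 else 0) (s(2 := s 2, 3 := nthd (s 3) 0 # tl (s 3))) \<and>
     simrep (s 2) (nthd (s 3) 0 # tl (s 3)) tp' h' \<and>
     length (s 2) + length (nthd (s 3) 0 # tl (s 3)) \<le> length (s 2) + length (s 3) + 2 * 0 + 2" by simp
  then show ?case by - (rule exI, rule exI, assumption)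
next
  case (Suc n)
  from Suc.prems(1) obtain c where c: "step M (q, tp, h) c" "(step M ^^ n) c (q', tp', h')"
    by (rule relpowp_Suc_E2)
  then obtain q1 b d where m: "(q, tp h, q1, b, d) \<in> M" "c = (q1, tp(h := b), h + d)"
    unfolding step_def by auto
  have d: "d \<in> {-1, 0, 1}" using dtm_trans[OF M m(1)] by (elim conjE)
  have tf: "trans_fun M q (tp h) = Some (q1, b, d)" using trans_fun_det[OF M m(1)] .
  have n0: "nthd (s 3) 0 = cell tp h" using Suc.prems(2) unfolding simrep_def
    by (metis add.right_neutral of_nat_0)
  have t0: "(topv (s 3) - Suc 0) div 2 = tp h" by (simp add: nthd_topv n0 cell_def)
  let ?x = "2 * b + nthd (s 3) 0 mod 2"
  have "\<exists>ls rs. exec (sim_body M q) s 11 (2 * q1 + 1) (s(2 := ls, 3 := rs)) \<and>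
      simrep ls rs (tp(h := b)) (h + d) \<and> length ls + length rs \<le> length (s 2) + length (s 3) + 2"
  proof -
    consider "d = 0" | "d = 1" | "d = -1" using d by auto
    then show ?thesis
    proof cases
      case 1
      have "exec (sim_body M q) s 11 (2 * q1 + 1) (s(2 := s 2, 3 := ?x # tl (s 3)))"
        unfolding sim_body_def
        by (rule exec_conv, rule exec_popB, simp, simp add: t0 tf 1, rule exec_pushB, simp, rule exec_Ret)
          (auto simp: nthd_topv)
      then show ?thesis using simrep_stay[OF Suc.prems(2), of b] 1
        by - (rule exI[of _ "s 2"], rule exI[of _ "?x # tl (s 3)"], auto)
    next
      case 2
      have "exec (sim_body M q) s 11 (2 * q1 + 1) (s(2 := ?x # s 2, 3 := tl (s 3)))"
        unfolding sim_body_def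
        by (rule exec_conv, rule exec_popB, simp, simp add: t0 tf 2, rule exec_pushB, simp, rule exec_Ret)
          (auto simp: nthd_topv)
      then show ?thesis using simrep_right[OF Suc.prems(2), of b] 2
        by - (rule exI[of _ "?x # s 2"], rule exI[of _ "tl (s 3)"], auto)
    next
      case 3
      have "exec (sim_body M q) s 11 (2 * q1 + 1) (s(2 := tl (s 2), 3 := nthd (s 2) 0 # ?x # tl (s 3)))"
        unfolding sim_body_def
        by (rule exec_conv, rule exec_popB, simp, simp add: t0 tf 3, rule exec_pushB, simp, rule exec_popB, simp,
            rule exec_pushB, simp, rule exec_Ret)
          (auto simp: nthd_topv)
      then show ?thesis using simrep_left[OF Suc.prems(2), of b] 3
        by - (rule exI[of _ "tl (s 2)"], rule exI[of _ "nthd (s 2) 0 # ?x # tl (s 3)"], auto)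
    qed
  qed
  then obtain ls1 rs1 where 1: "exec (sim_body M q) s 11 (2 * q1 + 1) (s(2 := ls1, 3 := rs1))"
    "simrep ls1 rs1 (tp(h := b)) (h + d)" "length ls1 + length rs1 \<le> length (s 2) + length (s 3) + 2"
    by blast
  let ?s = "s(2 := ls1, 3 := rs1)"
  have "\<exists>ls rs. exec (Loop (sim_body M) q1) ?s (12 * n + 12) (if q' = 1 then 1 else 0) (?s(2 := ls, 3 := rs)) \<and>
      simrep ls rs tp' h' \<and> length ls + length rs \<le> length (?s 2) + length (?s 3) + 2 * n + 2"
    by (rule Suc.IH, rule c(2)[unfolded m(2)]) (use 1(2) in \<open>simp add: fun_upd_def\<close>)
  then obtain ls rs where 2: "exec (Loop (sim_body M) q1) ?s (12 * n + 12) (if q' = 1 then 1 else 0) (?s(2 := ls, 3 := rs))"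
      "simrep ls rs tp' h'" "length ls + length rs \<le> length (?s 2) + length (?s 3) + 2 * n + 2"
    by (elim exE conjE)
  have "exec (Loop (sim_body M) q) s (12 * Suc n + 12) (if q' = 1 then 1 else 0) (s(2 := ls, 3 := rs))"
    by (rule exec_conv[OF exec_Loop_cont[where f="sim_body M", OF 1(1) 2(1)]]) (auto simp: fun_eq_iff)
  moreover have "length ls + length rs \<le> length (s 2) + length (s 3) + 2 * Suc n + 2"
    using 2(3) 1(3) by simp
  ultimately show ?case using 2(2) by (intro exI conjI)
qed

section \<open>Rewinding a simulated tape and reading off its output\<close>

definition drop_unmarked :: prog where
  "drop_unmarked = Loop (\<lambda>_. Bind (pop 3) (\<lambda>r. if odd (r - 1) then push 3 (r - 1) ;; Ret 0 else Ret 1)) 0"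

lemma exec_drop_unmarked:
  "s 3 = us @ x # rs \<Longrightarrow> \<forall>u\<in>set us. even u \<Longrightarrow> odd x \<Longrightarrow>
    exec drop_unmarked s (10 * length us + 10) 0 (s(3 := x # rs))"
proof (induction us arbitrary: s)
  case Nil
  let ?f = "\<lambda>_. Bind (pop 3) (\<lambda>r. if odd (r - 1) then push 3 (r - 1) ;; Ret 0 else Ret 1)"
  have "exec (?f 0) s 4 (2 * 0) (s(3 := x # rs))"
    by (rule exec_conv, rule exec_popB, simp, simp add: Nil, rule exec_pushB, simp, rule exec_Ret) auto
  from exec_Loop_exit[where f="?f", OF this] show ?case unfolding drop_unmarked_def
    by (rule exec_conv) auto
next
  case (Cons u us)
  let ?f = "\<lambda>_. Bind (pop 3) (\<lambda>r. if odd (r - 1) then push 3 (r - 1) ;; Ret 0 else Ret 1)"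
  have "exec (?f 0) s 4 (2 * 0 + 1) (s(3 := us @ x # rs))"
    by (rule exec_conv, rule exec_popB, simp, use Cons.prems in simp, rule exec_Ret) (use Cons.prems in auto)
  moreover have "exec drop_unmarked (s(3 := us @ x # rs)) (10 * length us + 10) 0 (s(3 := us @ x # rs, 3 := x # rs))"
    by (rule Cons.IH) (use Cons.prems in auto)
  ultimately show ?case unfolding drop_unmarked_def
    by (rule exec_conv[OF exec_Loop_cont[where f="?f"]]) (auto simp: fun_eq_iff)
qed

text \<open>Halving removes the mark, and a tape symbol is \<open>sym_rank\<close> plus one, so
  \<open>0\<close> is the blank that ends the output. The result has its last symbol on top, the
  format in which \<open>load\<close> expects an input.\<close>

definition emit :: "nat \<Rightarrow> prog" where
  "emit j = Loop (\<lambda>_. Bind (pop 3) (\<lambda>r. if (r - 1) div 2 = 0 then Ret 0 else push j ((r - 1) div 2 - 1) ;; Ret 1)) 0"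

lemma exec_emit:
  assumes j: "0 < j" "j \<noteq> 3"
  shows "(\<And>k. k < length us \<Longrightarrow> nthd (s 3) k div 2 = Suc (us ! k)) \<Longrightarrow> nthd (s 3) (length us) div 2 = 0 \<Longrightarrow>
    \<exists>rs. exec (emit j) s (10 * length us + 10) 0 (s(3 := rs, j := rev us @ s j)) \<and> length rs \<le> length (s 3)"
proof (induction us arbitrary: s)
  case Nil
  let ?f = "\<lambda>_. Bind (pop 3) (\<lambda>r. if (r - 1) div 2 = 0 then Ret 0 else push j ((r - 1) div 2 - 1) ;; Ret 1)"
  have "exec (?f 0) s 4 (2 * 0) (s(3 := tl (s 3)))"
    by (rule exec_conv, rule exec_popB, simp, use Nil in \<open>simp add: nthd_topv\<close>, rule exec_Ret) auto
  from exec_Loop_exit[where f="?f", OF this]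
  have "exec (emit j) s (10 * length [] + 10) 0 (s(3 := tl (s 3), j := rev [] @ s j))" unfolding emit_def
    by (rule exec_conv) (use j in \<open>auto simp: fun_eq_iff\<close>)
  then show ?case by (intro exI[of _ "tl (s 3)"] conjI, assumption) simp
next
  case (Cons u us)
  let ?f = "\<lambda>_. Bind (pop 3) (\<lambda>r. if (r - 1) div 2 = 0 then Ret 0 else push j ((r - 1) div 2 - 1) ;; Ret 1)"
  let ?s = "s(3 := tl (s 3), j := u # s j)"
  have h: "nthd (s 3) 0 div 2 = Suc u" using Cons.prems(1)[of 0] by simp
  have 1: "exec (?f 0) s 4 (2 * 0 + 1) ?s"
    by (rule exec_conv, rule exec_popB, simp, use h in \<open>simp add: nthd_topv\<close>, rule exec_pushB, rule j, rule exec_Ret)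
      (use j in auto)
  have "nthd (?s 3) k div 2 = Suc (us ! k)" if "k < length us" for k
    using Cons.prems(1)[of "Suc k"] that j by (simp add: nthd_tl)
  moreover have "nthd (?s 3) (length us) div 2 = 0"
    using Cons.prems(2) j by (simp add: nthd_tl)
  ultimately obtain rs where 2: "exec (emit j) ?s (10 * length us + 10) 0 (?s(3 := rs, j := rev us @ ?s j))"
    "length rs \<le> length (?s 3)"
    using Cons.IH[of ?s] by blast
  have "exec (emit j) s (10 * length (u # us) + 10) 0 (s(3 := rs, j := rev (u # us) @ s j))"
    unfolding emit_def
    by (rule exec_conv[OF exec_Loop_cont[where f="?f", OF 1 2(1)[unfolded emit_def]]]) (use j in \<open>auto simp: fun_eq_iff\<close>)
  moreover have "length rs \<le> length (s 3)" using 2(2) j by simp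
  ultimately show ?case by blast
qed

lemma wf_prog_drop_unmarked [simp]: "3 < K \<Longrightarrow> 3 \<le> B \<Longrightarrow> wf_prog B K drop_unmarked"
  by (auto simp: drop_unmarked_def)

lemma wf_prog_emit [simp]: "3 < K \<Longrightarrow> j < K \<Longrightarrow> 3 \<le> B \<Longrightarrow> wf_prog B K (emit j)"
  by (auto simp: emit_def)

lemma wf_prog_sim:
  assumes "\<forall>(q, a, q', b, d) \<in> M. 2 * q' + 1 < B \<and> 2 * b + 2 < B" "3 < K" "4 \<le> B"
  shows "wf_prog B K (Loop (sim_body M) 0)"
proof -
  have "wf_prog B K (sim_body M q)" for q
  proof -
    have "wf_prog B K (case trans_fun M q ((r - 1) div 2) of
      None \<Rightarrow> push 3 (r - 1) ;; Ret (if q = 1 then 2 else 0)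
    | Some (q', b, d) \<Rightarrow>
        if d = 0 then push 3 (2 * b + (r - 1) mod 2) ;; Ret (2 * q' + 1)
        else if d = 1 then push 2 (2 * b + (r - 1) mod 2) ;; Ret (2 * q' + 1)
        else push 3 (2 * b + (r - 1) mod 2) ;; Bind (pop 2) (\<lambda>x. push 3 (x - 1) ;; Ret (2 * q' + 1)))"
      if r: "r < B" for r
    proof (cases "trans_fun M q ((r - 1) div 2)")
      case None
      then show ?thesis unfolding None option.case using assms(2,3) r by auto
    next
      case (Some x)
      obtain q' b d where x: "x = (q', b, d)" by (cases x)
      have "2 * q' + 1 < B \<and> 2 * b + 2 < B"
        using assms(1) trans_fun_mem[OF Some] x by blast
      moreover have "(r - 1) mod 2 \<le> 1" by simp
      ultimately have "Suc (2 * b + (r - 1) mod 2) < B" "2 * q' + 1 < B" by linarith+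
      then show ?thesis unfolding Some x option.case prod.case using assms(2,3) by auto
    qed
    then show ?thesis unfolding sim_body_def using assms(2,3) by simp
  qed
  then show ?thesis using assms(3) by simp
qed

text \<open>Rank \<open>v\<close> becomes the cell entry \<open>2 * (v + 1)\<close> of its tape
  symbol. \<open>pop\<close> returns an entry plus one, so pushing the returned value sets the mark
  of position 0; for the empty input, \<open>max 1\<close> creates a marked blank. The caps at 10
  and 11 never take effect on ranks up to 4; they keep all symbols bounded for
  \<open>wf_prog\<close>.\<close>

definition load :: "nat \<Rightarrow> prog" where
  "load i = mvg (\<lambda>v. min (2 * (v + 1)) 10) i 3 ;; Bind (pop 3) (\<lambda>r. push 3 (max 1 (min r 11)))"

definition mark0 :: "nat list \<Rightarrow> nat list" where
  "mark0 us = (nthd us 0 + 1) # tl us"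

lemma exec_load:
  assumes "0 < i" "i \<noteq> 3" "s i = rev us" "\<forall>u\<in>set us. u \<le> 4" "s 3 = []"
  shows "exec (load i) s (10 * length us + 20) 0 (s(i := [], 3 := mark0 (map (\<lambda>v. 2 * (v + 1)) us)))"
proof -
  let ?us = "map (\<lambda>v. 2 * (v + 1)) us"
  have "map (\<lambda>v. min (2 * (v + 1)) 10) us = ?us" using assms(4) by simp
  then have r: "rev (map (\<lambda>v. min (2 * (v + 1)) 10) (s i)) @ s 3 = ?us"
    using assms by (simp add: rev_map)
  have m: "max 1 (min (topv ?us) 11) = nthd ?us 0 + 1" using assms(4) by (cases us) auto
  have "exec (Bind (pop 3) (\<lambda>r. push 3 (max 1 (min r 11)))) (s(i := [], 3 := ?us)) (1 + 2) 0 (s(i := [], 3 := mark0 ?us))"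
    by (rule exec_popB, simp, rule exec_conv, rule exec_push) (use m in \<open>auto simp: mark0_def\<close>)
  moreover have "exec (mvg (\<lambda>v. min (2 * (v + 1)) 10) i 3) s (10 * length (s i) + 10) 0 (s(i := [], 3 := ?us))"
    by (rule exec_conv[OF exec_mvg]) (use assms r in auto)
  ultimately show ?thesis unfolding load_def
    by (rule exec_conv[OF exec_Bind[rotated]]) (use assms in auto)
qed

lemma wf_prog_load [simp]: "3 < K \<Longrightarrow> i < K \<Longrightarrow> 13 \<le> B \<Longrightarrow> wf_prog B K (load i)"
  by (auto simp: load_def)

lemma sym_rank_le: "sym_rank x \<le> 4"
  by (cases x) auto

lemma simrep_init:
  assumes "init w = (q, tp, h)"
  shows "simrep [] (mark0 (map (\<lambda>v. 2 * (v + 1)) (map sym_rank w))) tp h"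
proof -
  have h: "h = 0" "tp = (\<lambda>i. if 0 \<le> i \<and> i < int (length w) then sym_code (w ! nat i) else 0)"
    using assms by (auto simp: init_def)
  have "nthd (mark0 (map (\<lambda>v. 2 * (v + 1)) (map sym_rank w))) k = cell tp (int k)" for k
  proof (cases k)
    case (Suc j)
    have [simp]: "nat (1 + int j) = Suc j" by simp
    show ?thesis using Suc by (cases w) (auto simp: mark0_def nthd_tl nthd_def cell_def h sym_code_def)
  qed (auto simp: mark0_def nthd_def cell_def h sym_code_def)
  then show ?thesis unfolding simrep_def h(1) by (auto simp: cell_def h)
qed

definition run_decider :: "tm \<Rightarrow> nat \<Rightarrow> prog" where
  "run_decider M i = load i ;; Bind (Loop (sim_body M) 0) (\<lambda>v. clr 2 ;; clr 3 ;; Ret v)"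

lemma exec_run_decider:
  assumes M: "dtm M" and n: "(step M ^^ n) (init w) cf" "state cf \<in> {1, 2}"
    and i: "0 < i" "i \<noteq> 2" "i \<noteq> 3" "s i = rev (map sym_rank w)" "s 2 = []" "s 3 = []"
  shows "exec (run_decider M i) s (300 * (length w + n + 1)) (if state cf = 1 then 1 else 0) (s(i := []))"
proof -
  let ?us = "map (\<lambda>v. 2 * (v + 1)) (map sym_rank w)"
  let ?s = "s(i := [], 3 := mark0 ?us)"
  obtain q tp h where ini: "init w = (q, tp, h)" by (cases "init w")
  have q: "q = 0" using ini by (simp add: init_def)
  obtain q' tp' h' where cf: "cf = (q', tp', h')" by (cases cf)
  have 1: "exec (load i) s (10 * length (map sym_rank w) + 20) 0 ?s"
    by (rule exec_load) (use i sym_rank_le in auto)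
  have "simrep (?s 2) (?s 3) tp h" using simrep_init[OF ini] i by simp
  then obtain ls rs where 2: "exec (Loop (sim_body M) 0) ?s (12 * n + 12) (if q' = 1 then 1 else 0) (?s(2 := ls, 3 := rs))"
      "length ls + length rs \<le> length (?s 2) + length (?s 3) + 2 * n + 2"
    using exec_sim[OF M, of q' n q tp h tp' h' ?s] n[unfolded cf ini] q by (auto simp: state_def)
  have len: "length ls + length rs \<le> length w + 2 * n + 3"
    using 2(2) i by (simp add: mark0_def)
  show ?thesis unfolding run_decider_def
    by (rule exec_conv, rule exec_Bind[OF 1], rule exec_Bind[OF 2(1)], rule exec_Bind[OF exec_clr], simp,
        rule exec_Bind[OF exec_clr], simp, rule exec_Ret)
      (use len i in \<open>auto simp: fun_eq_iff cf state_def\<close>)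
qed

definition run_transducer :: "tm \<Rightarrow> nat \<Rightarrow> nat \<Rightarrow> prog" where
  "run_transducer M i j = load i ;; Loop (sim_body M) 0 ;; mv 2 3 ;; drop_unmarked ;; emit j ;; clr 3"

text \<open>Only the cell of position 0 is odd. It cannot lie past the end of either list, because
  \<open>nthd\<close> is \<open>0\<close> there; so it occurs in \<open>rev ls @ rs\<close>, and
  everything in front of it is even.\<close>

lemma simrep_rewind:
  assumes "simrep ls rs tp h"
  obtains us x vs where "rev ls @ rs = us @ x # vs" "\<forall>u\<in>set us. even u" "odd x"
    "\<forall>k. nthd (x # vs) k = cell tp (int k)"
proof -
  let ?R = "rev ls @ rs"
  \<comment> \<open>The index of position 0, since entry \<open>k\<close> of \<open>?R\<close>
    belongs to position \<open>h - int (length ls) + int k\<close>.\<close>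
  let ?m = "nat (int (length ls) - h)"
  have R: "nthd ?R k = cell tp (h - int (length ls) + int k)" for k
  proof (cases "k < length ls")
    case True
    moreover from this have "length ls - Suc k < length ls" by linarith
    ultimately have "nthd ?R k = nthd ls (length ls - 1 - k)" by (simp add: nthd_def nth_append rev_nth)
    also have "\<dots> = cell tp (h - 1 - int (length ls - 1 - k))" using assms by (simp add: simrep_def)
    also have "h - 1 - int (length ls - 1 - k) = h - int (length ls) + int k" using True by simp
    finally show ?thesis .
  next
    case False
    then have "nthd ?R k = nthd rs (k - length ls)" by (auto simp: nthd_def nth_append)
    also have "\<dots> = cell tp (h + int (k - length ls))" using assms by (simp add: simrep_def)
    also have "h + int (k - length ls) = h - int (length ls) + int k" using False by simp
    finally show ?thesis .
  qed
  have h: "h \<le> int (length ls)"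
  proof (rule ccontr)
    assume "\<not> h \<le> int (length ls)"
    then have "nthd ls (nat (h - 1)) = 0" by (auto simp: nthd_def)
    moreover have "nthd ls (nat (h - 1)) = cell tp 0"
      using assms \<open>\<not> h \<le> int (length ls)\<close> by (auto simp: simrep_def)
    ultimately show False by (simp add: cell_def)
  qed
  have "nthd ?R ?m = cell tp 0" using R[of ?m] h by simp
  then have m: "?m < length ?R" by (auto simp: nthd_def cell_def split: if_splits)
  show ?thesis
  proof (rule that)
    show "?R = take ?m ?R @ ?R ! ?m # drop (Suc ?m) ?R" by (rule id_take_nth_drop[OF m])
    show "\<forall>u\<in>set (take ?m ?R). even u"
    proof
      fix u assume "u \<in> set (take ?m ?R)"
      then obtain k where k: "k < length (take ?m ?R)" "u = take ?m ?R ! k" unfolding in_set_conv_nth by blast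
      then have "k < ?m" "k < length ?R" by auto
      then have "u = nthd ?R k" using k(2) by (simp add: nthd_def del: length_append take_append)
      then show "even u" using R[of k] \<open>k < ?m\<close> by (auto simp: cell_def)
    qed
    show "odd (?R ! ?m)" using \<open>nthd ?R ?m = cell tp 0\<close> m by (simp add: nthd_def cell_def del: length_append)
    show "\<forall>k. nthd (?R ! ?m # drop (Suc ?m) ?R) k = cell tp (int k)"
    proof
    fix k
    have "?R ! ?m # drop (Suc ?m) ?R = drop ?m ?R" using m by (rule Cons_nth_drop_Suc)
    moreover have "nthd (drop ?m ?R) k = nthd ?R (?m + k)"
      using m by (auto simp: nthd_def simp del: length_append drop_append)
    ultimately show "nthd (?R ! ?m # drop (Suc ?m) ?R) k = cell tp (int k)"
      using R[of "?m + k"] h by simp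
    qed
  qed
qed

lemma exec_run_transducer:
  assumes M: "dtm M" and n: "(step M ^^ n) (init w) cf" "state cf = 1"
    and out: "map sym_code u = map (\<lambda>i. tape cf (int i)) [0..<length u]" "tape cf (int (length u)) = 0"
    and i: "0 < i" "i \<noteq> 2" "i \<noteq> 3" "3 < j" "i \<noteq> j" "s i = rev (map sym_rank w)" "s 2 = []" "s 3 = []"
  shows "exec (run_transducer M i j) s (300 * (length w + n + 1)) 0 (s(i := [], j := rev (map sym_rank u) @ s j))"
    and "length u \<le> length w + 2 * n + 3"
proof -
  let ?us = "map (\<lambda>v. 2 * (v + 1)) (map sym_rank w)"
  let ?s = "s(i := [], 3 := mark0 ?us)"
  obtain q tp h where ini: "init w = (q, tp, h)" by (cases "init w")
  have q: "q = 0" using ini by (simp add: init_def)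
  obtain q' tp' h' where cf: "cf = (q', tp', h')" by (cases cf)
  have 1: "exec (load i) s (10 * length (map sym_rank w) + 20) 0 ?s"
    by (rule exec_load) (use i sym_rank_le in auto)
  have "simrep (?s 2) (?s 3) tp h" using simrep_init[OF ini] i by simp
  then obtain ls rs where 2: "exec (Loop (sim_body M) 0) ?s (12 * n + 12) (if q' = 1 then 1 else 0) (?s(2 := ls, 3 := rs))"
      "simrep ls rs tp' h'" "length ls + length rs \<le> length (?s 2) + length (?s 3) + 2 * n + 2"
    using exec_sim[OF M, of q' n q tp h tp' h' ?s] n[unfolded cf ini] q by (auto simp: state_def)
  have len: "length ls + length rs \<le> length w + 2 * n + 3"
    using 2(3) i by (simp add: mark0_def)
  obtain us x vs where R: "rev ls @ rs = us @ x # vs" "\<forall>u\<in>set us. even u" "odd x"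
    "\<forall>k. nthd (x # vs) k = cell tp' (int k)"
    by (rule simrep_rewind[OF 2(2)])
  have lenR: "length us + length (x # vs) = length ls + length rs"
    using arg_cong[OF R(1), of length] by simp
  let ?s2 = "?s(2 := [], 3 := us @ x # vs)"
  have 3: "exec (mv 2 3) (?s(2 := ls, 3 := rs)) (10 * length ls + 10) 0 ?s2"
    by (rule exec_conv[OF exec_mvg]) (use R(1) in \<open>auto simp: fun_eq_iff\<close>)
  let ?s3 = "?s2(3 := x # vs)"
  have 4: "exec drop_unmarked ?s2 (10 * length us + 10) 0 ?s3"
    by (rule exec_drop_unmarked) (use R in auto)
  have tu: "tp' (int k) = Suc (sym_rank (u ! k))" if "k < length u" for k
    using arg_cong[OF out(1), of "\<lambda>l. l ! k"] that by (simp add: cf tape_def sym_code_def)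
  have div: "nthd (x # vs) k div 2 = tp' (int k)" for k
    unfolding R(4)[rule_format] by (simp add: cell_def)
  have "\<exists>rs. exec (emit j) ?s3 (10 * length (map sym_rank u) + 10) 0
      (?s3(3 := rs, j := rev (map sym_rank u) @ ?s3 j)) \<and> length rs \<le> length (?s3 3)"
  proof (rule exec_emit)
    show "nthd (?s3 3) k div 2 = Suc (map sym_rank u ! k)" if "k < length (map sym_rank u)" for k
      using that tu[of k] div[of k] by simp
    show "nthd (?s3 3) (length (map sym_rank u)) div 2 = 0"
      using out(2) div[of "length u"] by (simp add: cf tape_def)
  qed (use i in auto)
  then obtain ws where 5: "exec (emit j) ?s3 (10 * length (map sym_rank u) + 10) 0
      (?s3(3 := ws, j := rev (map sym_rank u) @ ?s3 j))" "length ws \<le> length (?s3 3)"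
    by blast
  \<comment> \<open>An output symbol is not blank, so its cell lies within the list; this bounds the
    output by the space used.\<close>
  have "length u \<le> length (x # vs)"
  proof (rule ccontr)
    assume "\<not> length u \<le> length (x # vs)"
    then show False using tu[of "length (x # vs)"] div[of "length (x # vs)"]
      by (simp add: nthd_def)
  qed
  then show u: "length u \<le> length w + 2 * n + 3" using lenR len by simp
  have ws: "length ws \<le> length w + 2 * n + 3" using 5(2) lenR len by simp
  show "exec (run_transducer M i j) s (300 * (length w + n + 1)) 0 (s(i := [], j := rev (map sym_rank u) @ s j))"
    unfolding run_transducer_def
    by (rule exec_conv, rule exec_Bind[OF 1], rule exec_Bind[OF 2(1)], rule exec_Bind[OF 3], rule exec_Bind[OF 4],
        rule exec_Bind[OF 5(1)], rule exec_clr, simp)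
      (use len lenR u ws i in \<open>auto simp: fun_eq_iff\<close>)
qed

section \<open>Comparing and moving words\<close>

definition wl :: "nat list list \<Rightarrow> nat list" where
  "wl ws = concat (map (\<lambda>w. w @ [3]) ws)"

lemma wl_simps [simp]: "wl [] = []" "wl (w # ws) = w @ 3 # wl ws"
  by (simp_all add: wl_def)

lemma wl_append [simp]: "wl (us @ ws) = wl us @ wl ws"
  by (simp add: wl_def)

lemma length_wl_ge: "w \<in> set ws \<Longrightarrow> length w < length (wl ws)"
  by (induction ws) auto

lemma length_le_wl: "length ws \<le> length (wl ws)"
  by (induction ws) auto

text \<open>The word is kept on \<open>j\<close> so that the source can be rebuilt later. The comma
  has rank 3 and is therefore returned by \<open>pop\<close> as 4.\<close>

definition take_word :: "nat \<Rightarrow> nat \<Rightarrow> nat \<Rightarrow> prog" where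
  "take_word i j k = Loop (\<lambda>_. Bind (pop i) (\<lambda>r. push j (r - 1) ;;
     (if r = 4 then Ret 0 else push k (r - 1) ;; Ret 1))) 0"

lemma wf_prog_take_word [simp]: "i < K \<Longrightarrow> j < K \<Longrightarrow> k < K \<Longrightarrow> 2 \<le> B \<Longrightarrow> wf_prog B K (take_word i j k)"
  by (auto simp: take_word_def)

lemma exec_take_word:
  assumes "0 < i" "0 < j" "0 < k" "i \<noteq> j" "i \<noteq> k" "j \<noteq> k"
  shows "s i = w @ 3 # rest \<Longrightarrow> 3 \<notin> set w \<Longrightarrow>
    exec (take_word i j k) s (10 * length w + 10) 0 (s(i := rest, j := 3 # rev w @ s j, k := rev w @ s k))"
proof (induction w arbitrary: s)
  case Nil
  let ?f = "\<lambda>_. Bind (pop i) (\<lambda>r. push j (r - 1) ;; (if r = 4 then Ret 0 else push k (r - 1) ;; Ret 1))"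
  have "exec (?f 0) s 4 (2 * 0) (s(i := rest, j := 3 # s j))"
    by (rule exec_conv, rule exec_popB, rule assms, rule exec_pushB, rule assms, use Nil assms in simp, rule exec_Ret)
      (use Nil assms in auto)
  from exec_Loop_exit[where f="?f", OF this] show ?case unfolding take_word_def
    by (rule exec_conv) (use assms in \<open>auto simp: fun_eq_iff\<close>)
next
  case (Cons x w)
  let ?f = "\<lambda>_. Bind (pop i) (\<lambda>r. push j (r - 1) ;; (if r = 4 then Ret 0 else push k (r - 1) ;; Ret 1))"
  let ?s = "s(i := w @ 3 # rest, j := x # s j, k := x # s k)"
  have 1: "exec (?f 0) s 6 (2 * 0 + 1) ?s"
    by (rule exec_conv, rule exec_popB, rule assms, rule exec_pushB, rule assms, use Cons.prems assms in simp,
        rule exec_pushB, rule assms, rule exec_Ret)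
      (use Cons.prems assms in auto)
  have 2: "exec (take_word i j k) ?s (10 * length w + 10) 0 (?s(i := rest, j := 3 # rev w @ ?s j, k := rev w @ ?s k))"
    by (rule Cons.IH) (use Cons.prems assms in auto)
  show ?case unfolding take_word_def
    by (rule exec_conv[OF exec_Loop_cont[where f="?f", OF 1 2[unfolded take_word_def]]])
      (use assms in \<open>auto simp: fun_eq_iff\<close>)
qed

definition move_word :: "nat \<Rightarrow> nat \<Rightarrow> prog" where
  "move_word i j = Loop (\<lambda>_. Bind (pop i) (\<lambda>r. push j (r - 1) ;; Ret (if r = 4 then 0 else 1))) 0"

lemma wf_prog_move_word [simp]: "i < K \<Longrightarrow> j < K \<Longrightarrow> 2 \<le> B \<Longrightarrow> wf_prog B K (move_word i j)"
  by (auto simp: move_word_def)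

lemma exec_move_word:
  assumes "0 < i" "0 < j" "i \<noteq> j"
  shows "s i = w @ 3 # rest \<Longrightarrow> 3 \<notin> set w \<Longrightarrow>
    exec (move_word i j) s (10 * length w + 10) 0 (s(i := rest, j := 3 # rev w @ s j))"
proof (induction w arbitrary: s)
  case Nil
  let ?f = "\<lambda>_. Bind (pop i) (\<lambda>r. push j (r - 1) ;; Ret (if r = 4 then 0 else 1))"
  have "exec (?f 0) s 4 (2 * 0) (s(i := rest, j := 3 # s j))"
    by (rule exec_conv, rule exec_popB, rule assms, rule exec_pushB, rule assms, rule exec_Ret)
      (use Nil assms in auto)
  from exec_Loop_exit[where f="?f", OF this] show ?case unfolding move_word_def
    by (rule exec_conv) (use assms in \<open>auto simp: fun_eq_iff\<close>)
next
  case (Cons x w)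
  let ?f = "\<lambda>_. Bind (pop i) (\<lambda>r. push j (r - 1) ;; Ret (if r = 4 then 0 else 1))"
  let ?s = "s(i := w @ 3 # rest, j := x # s j)"
  have 1: "exec (?f 0) s 4 (2 * 0 + 1) ?s"
    by (rule exec_conv, rule exec_popB, rule assms, rule exec_pushB, rule assms, rule exec_Ret)
      (use Cons.prems assms in auto)
  have 2: "exec (move_word i j) ?s (10 * length w + 10) 0 (?s(i := rest, j := 3 # rev w @ ?s j))"
    by (rule Cons.IH) (use Cons.prems assms in auto)
  show ?case unfolding move_word_def
    by (rule exec_conv[OF exec_Loop_cont[where f="?f", OF 1 2[unfolded move_word_def]]])
      (use assms in \<open>auto simp: fun_eq_iff\<close>)
qed

definition drop_word :: "nat \<Rightarrow> prog" where
  "drop_word i = Loop (\<lambda>_. Bind (pop i) (\<lambda>r. Ret (if r = 4 then 0 else 1))) 0"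

lemma wf_prog_drop_word [simp]: "i < K \<Longrightarrow> 2 \<le> B \<Longrightarrow> wf_prog B K (drop_word i)"
  by (auto simp: drop_word_def)

lemma exec_drop_word:
  assumes "0 < i"
  shows "s i = w @ 3 # rest \<Longrightarrow> 3 \<notin> set w \<Longrightarrow> exec (drop_word i) s (10 * length w + 10) 0 (s(i := rest))"
proof (induction w arbitrary: s)
  case Nil
  let ?f = "\<lambda>_. Bind (pop i) (\<lambda>r. Ret (if r = 4 then 0 else 1))"
  have "exec (?f 0) s 4 (2 * 0) (s(i := rest))"
    by (rule exec_conv, rule exec_popB, rule assms, rule exec_Ret) (use Nil assms in auto)
  from exec_Loop_exit[where f="?f", OF this] show ?case unfolding drop_word_def
    by (rule exec_conv) (use assms in \<open>auto simp: fun_eq_iff\<close>)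
next
  case (Cons x w)
  let ?f = "\<lambda>_. Bind (pop i) (\<lambda>r. Ret (if r = 4 then 0 else 1))"
  let ?s = "s(i := w @ 3 # rest)"
  have 1: "exec (?f 0) s 4 (2 * 0 + 1) ?s"
    by (rule exec_conv, rule exec_popB, rule assms, rule exec_Ret) (use Cons.prems assms in auto)
  have 2: "exec (drop_word i) ?s (10 * length w + 10) 0 (?s(i := rest))"
    by (rule Cons.IH) (use Cons.prems assms in auto)
  show ?case unfolding drop_word_def
    by (rule exec_conv[OF exec_Loop_cont[where f="?f", OF 1 2[unfolded drop_word_def]]])
      (use assms in \<open>auto simp: fun_eq_iff\<close>)
qed

text \<open>The popped value 3 stands for \<open>SNeg\<close>, whose rank is 2 and which can only be
  the first symbol of a literal.\<close>

definition flip_word :: "nat \<Rightarrow> prog" where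
  "flip_word i = Bind (pop i) (\<lambda>r. if r = 3 then Ret 0 else push i (r - 1) ;; push i 2 ;; Ret 0)"

definition negw :: "nat list \<Rightarrow> nat list" where
  "negw w = (if hd w = 2 then tl w else 2 # w)"

lemma wf_prog_flip_word [simp]: "i < K \<Longrightarrow> 4 \<le> B \<Longrightarrow> wf_prog B K (flip_word i)"
  by (auto simp: flip_word_def)

lemma exec_flip_word:
  assumes "0 < i" "s i = w @ rest" "w \<noteq> []"
  shows "exec (flip_word i) s 6 0 (s(i := negw w @ rest))"
proof -
  obtain x w' where w: "w = x # w'" using assms(3) by (cases w) auto
  show ?thesis
  proof (cases "x = 2")
    case True
    show ?thesis unfolding flip_word_def
      by (rule exec_conv, rule exec_popB, rule assms, use assms w True in simp, rule exec_Ret)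
        (use assms w True in \<open>auto simp: negw_def\<close>)
  next
    case False
    show ?thesis unfolding flip_word_def
      by (rule exec_conv, rule exec_popB, rule assms, use assms w False in simp, rule exec_pushB, rule assms,
          rule exec_pushB, rule assms, rule exec_Ret)
        (use assms w False in \<open>auto simp: negw_def\<close>)
  qed
qed

text \<open>
  Registers from here on: 5 the formula, 7 the given backdoor, 8 the true literals, 14 all literal occurrences of the
  formula, 17 the current backdoor assignment, 18 the round counter, 12 the word to look up, 11 and 16 for reversal;
  9, 10, 13, 15, 19, 20 collect what has been popped from 5, 8, 12, 14, 18, 7. Words end with the comma 3,
  clauses with the bar 4; \<open>pop\<close> returns these as 4 and 5.
\<close>

definition cmp_body :: "nat \<Rightarrow> prog" where
  "cmp_body e = Bind (pop 8) (\<lambda>p. push 10 (p - 1) ;; Bind (pop 12) (\<lambda>r.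
     if p = 4 then (if r = 0 then Ret (if e = 0 then 0 else 2) else push 12 (r - 1) ;; Ret 0)
     else if r = 0 then Ret 1
     else push 13 (r - 1) ;; Ret (if r = p \<and> e \<noteq> 0 then 3 else 1)))"

text \<open>The flag \<open>e\<close> records that no mismatch has occurred. The word on 8 is
  consumed up to its comma even after a mismatch, so that register 8 stays aligned with the word
  boundaries; \<open>take\<close> and \<open>drop\<close> cover a word on 12 that is shorter or
  longer than \<open>y\<close>.\<close>

lemma exec_cmp_loop:
  "s 8 = y @ 3 # rest \<Longrightarrow> 3 \<notin> set y \<Longrightarrow>
    exec (Loop cmp_body e) s (12 * length y + 12) (if e \<noteq> 0 \<and> s 12 = y then 1 else 0)
     (s(8 := rest, 10 := 3 # rev y @ s 10, 12 := drop (length y) (s 12),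
        13 := rev (take (length y) (s 12)) @ s 13))"
proof (induction y arbitrary: s e)
  case Nil
  have "exec (cmp_body e) s 8 (2 * (if e \<noteq> 0 \<and> s 12 = [] then 1 else 0)) (s(8 := rest, 10 := 3 # s 10))"
  proof (cases "s 12")
    case Nil': Nil
    show ?thesis unfolding cmp_body_def
      by (rule exec_conv, rule exec_popB, simp, rule exec_pushB, simp, rule exec_popB, simp,
          simp add: Nil Nil' split del: if_split, rule exec_Ret)
        (use Nil Nil' in \<open>auto simp: fun_eq_iff\<close>)
  next
    case (Cons a x)
    show ?thesis unfolding cmp_body_def
      by (rule exec_conv, rule exec_popB, simp, rule exec_pushB, simp, rule exec_popB, simp,
          simp add: Nil Cons split del: if_split, rule exec_pushB, simp, rule exec_Ret)
        (use Nil Cons in \<open>auto simp: fun_eq_iff\<close>)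
  qed
  from exec_Loop_exit[where f="cmp_body", OF this] show ?case
    by (rule exec_conv) (auto simp: fun_eq_iff)
next
  case (Cons p y)
  have p: "p \<noteq> 3" using Cons.prems(2) by auto
  show ?case
  proof (cases "s 12")
    case Nil
    let ?s = "s(8 := y @ 3 # rest, 10 := p # s 10)"
    have 1: "exec (cmp_body e) s 8 (2 * 0 + 1) ?s" unfolding cmp_body_def
      by (rule exec_conv, rule exec_popB, simp, rule exec_pushB, simp, rule exec_popB, simp,
          simp add: Nil Cons.prems p split del: if_split, rule exec_Ret)
        (use Nil Cons.prems in \<open>auto simp: fun_eq_iff\<close>)
    have 2: "exec (Loop cmp_body 0) ?s (12 * length y + 12) (if 0 \<noteq> (0::nat) \<and> ?s 12 = y then 1 else 0)
     (?s(8 := rest, 10 := 3 # rev y @ ?s 10, 12 := drop (length y) (?s 12),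
        13 := rev (take (length y) (?s 12)) @ ?s 13))"
      by (rule Cons.IH) (use Cons.prems in auto)
    show ?thesis
      by (rule exec_conv[OF exec_Loop_cont[OF 1 2]]) (auto simp: fun_eq_iff Nil)
  next
    case (Cons a x)
    let ?e = "if a = p \<and> e \<noteq> 0 then 1 else 0 :: nat"
    let ?s = "s(8 := y @ 3 # rest, 10 := p # s 10, 12 := x, 13 := a # s 13)"
    have 1: "exec (cmp_body e) s 8 (2 * ?e + 1) ?s" unfolding cmp_body_def
      by (rule exec_conv, rule exec_popB, simp, rule exec_pushB, simp, rule exec_popB, simp,
          simp add: Cons Cons.prems \<open>s 8 = (p # y) @ 3 # rest\<close> p split del: if_split, rule exec_pushB, simp, rule exec_Ret)
        (use Cons \<open>s 8 = (p # y) @ 3 # rest\<close> in \<open>auto simp: fun_eq_iff\<close>)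
    have 2: "exec (Loop cmp_body ?e) ?s (12 * length y + 12) (if ?e \<noteq> 0 \<and> ?s 12 = y then 1 else 0)
     (?s(8 := rest, 10 := 3 # rev y @ ?s 10, 12 := drop (length y) (?s 12),
        13 := rev (take (length y) (?s 12)) @ ?s 13))"
      by (rule Cons.IH) (use \<open>3 \<notin> set (p # y)\<close> in auto)
    show ?thesis
      by (rule exec_conv[OF exec_Loop_cont[OF 1 2]]) (use Cons in \<open>auto simp: fun_eq_iff\<close>)
  qed
qed

definition cmp_word :: prog where
  "cmp_word = Bind (Loop cmp_body 1) (\<lambda>b. mv 13 12 ;; Ret b)"

lemma exec_cmp_word:
  assumes "s 8 = y @ 3 # rest" "3 \<notin> set y" "s 13 = []"
  shows "exec cmp_word s (12 * length y + 10 * length (s 12) + 30) (if s 12 = y then 1 else 0)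
     (s(8 := rest, 10 := 3 # rev y @ s 10))"
  unfolding cmp_word_def
  by (rule exec_conv, rule exec_Bind[OF exec_cmp_loop[of s y rest, OF assms(1,2)]], rule exec_Bind[OF exec_mvg], simp, simp, simp, rule exec_Ret)
    (use assms(3) in \<open>auto simp: fun_eq_iff\<close>)

text \<open>The search runs through all words even after a hit; register 10 then holds the whole
  list, and a single move restores 8.\<close>

definition mem_body :: "nat \<Rightarrow> prog" where
  "mem_body e = Bind (pop 8) (\<lambda>r. if r = 0 then Ret (if e = 0 then 0 else 2)
     else push 8 (r - 1) ;; Bind cmp_word (\<lambda>b. Ret (if b = 0 \<and> e = 0 then 1 else 3)))"

lemma exec_mem_loop:
  "s 8 = wl ws \<Longrightarrow> \<forall>w\<in>set ws. 3 \<notin> set w \<Longrightarrow> s 13 = [] \<Longrightarrow>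
    \<forall>w\<in>set ws. 12 * length w + 10 * length (s 12) + 45 \<le> c \<Longrightarrow> 45 \<le> c \<Longrightarrow>
    exec (Loop mem_body e) s ((length ws + 1) * c) (if e \<noteq> 0 \<or> s 12 \<in> set ws then 1 else 0)
     (s(8 := [], 10 := rev (wl ws) @ s 10))"
proof (induction ws arbitrary: s e)
  case Nil
  have "exec (mem_body e) s 8 (2 * (if e \<noteq> 0 then 1 else 0)) s" unfolding mem_body_def
    by (rule exec_conv, rule exec_popB, simp, simp add: Nil split del: if_split, rule exec_Ret)
      (use Nil in \<open>auto simp: fun_eq_iff\<close>)
  from exec_Loop_exit[where f="mem_body", OF this] show ?case
    by (rule exec_conv) (use Nil in \<open>auto simp: fun_eq_iff\<close>)
next
  case (Cons w ws)
  obtain x r where xr: "w @ 3 # wl ws = x # r" by (cases "w @ 3 # wl ws") auto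
  let ?s = "s(8 := wl ws, 10 := 3 # rev w @ s 10)"
  let ?e = "if e \<noteq> 0 \<or> s 12 = w then 1 else 0 :: nat"
  have s: "s(8 := x # r) = s" "s 8 = x # r" using Cons.prems(1) xr by auto
  have 1: "exec (mem_body e) s (12 * length w + 10 * length (s 12) + 40) (2 * ?e + 1) ?s" unfolding mem_body_def
    by (rule exec_conv, rule exec_popB, simp, simp add: s(2) split del: if_split, rule exec_pushB, simp,
        simp add: s split del: if_split, rule exec_Bind, rule exec_cmp_word[of s w "wl ws"],
        use Cons.prems in simp, use Cons.prems in simp, use Cons.prems in simp, rule exec_Ret)
      (use Cons.prems in \<open>auto simp: fun_eq_iff\<close>)
  have 2: "exec (Loop mem_body ?e) ?s ((length ws + 1) * c) (if ?e \<noteq> 0 \<or> ?s 12 \<in> set ws then 1 else 0)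
     (?s(8 := [], 10 := rev (wl ws) @ ?s 10))"
    by (rule Cons.IH) (use Cons.prems in auto)
  have "12 * length w + 10 * length (s 12) + 45 \<le> c" using Cons.prems(4) by simp
  then show ?case
    by (intro exec_conv[OF exec_Loop_cont[OF 1 2]]) (auto simp: fun_eq_iff)
qed

lemma nat_power_mono: "(1::nat) \<le> M \<Longrightarrow> i \<le> j \<Longrightarrow> M ^ i \<le> M ^ j"
  by (rule power_increasing)

lemma exec_in: "exec p s0 t v s' \<Longrightarrow> s = s0 \<Longrightarrow> exec p s t v s'"
  by simp

definition mem_word :: prog where
  "mem_word = Bind (Loop mem_body 0) (\<lambda>b. mv 10 8 ;; Ret b)"

text \<open>\<open>M\<close> bounds the registers involved. Each enclosing loop multiplies the cost
  by at most \<open>M\<close>: a lookup costs \<open>M ^ 2\<close>, the conflict test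
  \<open>M ^ 4\<close>, a round \<open>M ^ 5\<close> and a check \<open>M ^ 6\<close>, up to
  numerals chosen large enough to absorb the lower-order terms.\<close>

lemma exec_mem_word:
  assumes "s 8 = wl ws" "\<forall>w\<in>set ws. 3 \<notin> set w" "s 10 = []" "s 13 = []"
    and "length (s 8) < M" "length (s 12) < M"
  shows "exec mem_word s (100 * M ^ 2) (if s 12 \<in> set ws then 1 else 0) s"
proof -
  have "\<forall>w\<in>set ws. 12 * length w + 10 * length (s 12) + 45 \<le> 70 * M"
  proof
    fix w assume "w \<in> set ws"
    then have "length w < M" using length_wl_ge[of w ws] assms(1,5) by simp
    then show "12 * length w + 10 * length (s 12) + 45 \<le> 70 * M" using assms(6) by linarith
  qed
  moreover have "45 \<le> 70 * M" using assms(5) by linarith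
  ultimately have 1: "exec (Loop mem_body 0) s ((length ws + 1) * (70 * M)) (if (0::nat) \<noteq> 0 \<or> s 12 \<in> set ws then 1 else 0)
     (s(8 := [], 10 := rev (wl ws) @ s 10))"
    using assms by (intro exec_mem_loop)
  have "length ws + 1 \<le> M" using length_le_wl[of ws] assms(1,5) by simp
  then have "(length ws + 1) * (70 * M) \<le> M * (70 * M)" by (rule mult_le_mono1)
  also have "\<dots> = 70 * M ^ 2" by (simp add: power2_eq_square)
  finally have "(length ws + 1) * (70 * M) \<le> 70 * M ^ 2" .
  moreover have "M \<le> M ^ 2" "1 \<le> M ^ 2" using assms(5) by (auto simp: power2_eq_square)
  ultimately have t: "(length ws + 1) * (70 * M) + (10 * length (wl ws) + 10 + 0 + 1) + 1 \<le> 100 * M ^ 2"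
    using assms(5)[unfolded assms(1)] by linarith
  show ?thesis unfolding mem_word_def
    by (rule exec_conv, rule exec_Bind[OF 1], rule exec_Bind, rule exec_mvg, simp, simp, simp, rule exec_Ret)
      (use t assms in \<open>auto simp: fun_eq_iff\<close>)
qed

text \<open>Started with \<open>e = 1\<close>, the flag survives as long as all literals read so far
  are falsified by the list on 8.\<close>

definition lit_body :: "nat \<Rightarrow> prog" where
  "lit_body e = Bind (pop 5) (\<lambda>r. if r = 5 then push 9 4 ;; Ret (if e = 0 then 0 else 2)
     else push 5 (r - 1) ;; take_word 5 9 11 ;; mv 11 12 ;; flip_word 12 ;;
       Bind mem_word (\<lambda>b. clr 12 ;; Ret (if b = 0 \<or> e = 0 then 1 else 3)))"

definition okw :: "nat list \<Rightarrow> bool" where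
  "okw w \<longleftrightarrow> w \<noteq> [] \<and> 3 \<notin> set w \<and> 4 \<notin> set w"

lemma length_negw: "length (negw w) \<le> Suc (length w)"
  by (auto simp: negw_def)

text \<open>The strict bound on \<open>Suc (length w)\<close> leaves room for the sign that negation
  may add.\<close>

lemma exec_lit_loop:
  "s 5 = wl ws @ 4 # rest \<Longrightarrow> \<forall>w\<in>set ws. okw w \<and> Suc (length w) < M \<Longrightarrow>
    s 8 = wl P \<Longrightarrow> \<forall>w\<in>set P. 3 \<notin> set w \<Longrightarrow> length (s 8) < M \<Longrightarrow>
    s 10 = [] \<Longrightarrow> s 11 = [] \<Longrightarrow> s 12 = [] \<Longrightarrow> s 13 = [] \<Longrightarrow>
    exec (Loop lit_body e) s ((length ws + 1) * (250 * M ^ 2))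
      (if e \<noteq> 0 \<and> (\<forall>w\<in>set ws. negw w \<in> set P) then 1 else 0)
      (s(5 := rest, 9 := 4 # rev (wl ws) @ s 9))"
proof (induction ws arbitrary: s e)
  case Nil
  have M: "1 \<le> M ^ 2" using Nil(5) by simp
  have "exec (lit_body e) s 4 (2 * (if e \<noteq> 0 then 1 else 0)) (s(5 := rest, 9 := 4 # s 9))" unfolding lit_body_def
    by (rule exec_conv, rule exec_popB, simp, simp add: Nil split del: if_split, rule exec_pushB, simp, rule exec_Ret)
      (use Nil in \<open>auto simp: fun_eq_iff\<close>)
  from exec_Loop_exit[where f="lit_body", OF this] show ?case
    by (rule exec_conv) (use Nil M in \<open>auto simp: fun_eq_iff\<close>)
next
  case (Cons w ws)
  have okw: "w \<noteq> []" "3 \<notin> set w" "4 \<notin> set w" "Suc (length w) < M" using Cons.prems(2) by (auto simp: okw_def)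
  then obtain x w' where w: "w = x # w'" "x \<noteq> 3" "x \<noteq> 4" by (cases w) auto
  let ?G = "wl ws @ 4 # rest"
  have s5: "s 5 = x # w' @ 3 # ?G" using Cons.prems(1) w by simp
  have s5': "s(5 := x # w' @ 3 # ?G) = s" using s5 by auto
  let ?s = "s(5 := ?G, 9 := 3 # rev w @ s 9)"
  let ?s1 = "?s(12 := negw w)"
  let ?e = "if e \<noteq> 0 \<and> negw w \<in> set P then 1 else 0 :: nat"
  have mem: "exec mem_word ?s1 (100 * M ^ 2) (if ?s1 12 \<in> set P then 1 else 0) ?s1"
    by (rule exec_mem_word) (use Cons.prems okw length_negw[of w] in auto)
  have M: "M \<le> M ^ 2" "1 \<le> M" using okw(4) by (auto simp: power2_eq_square)
  have len: "10 * length (negw w) + 20 * length w \<le> 30 * M" using length_negw[of w] okw(4) by linarith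
  have 1: "exec (lit_body e) s (240 * M ^ 2) (2 * ?e + 1) ?s" unfolding lit_body_def
    by (rule exec_conv, rule exec_popB, simp, simp add: s5 w split del: if_split, rule exec_pushB, simp,
        simp only: fun_upd_upd fun_upd_same list.sel(3) s5',
        rule exec_Bind, rule exec_take_word[of _ _ _ s w ?G], simp, simp, simp, simp, simp, simp,
        use s5 w in simp, rule okw,
        rule exec_Bind, rule exec_mvg, simp, simp, simp,
        rule exec_Bind, rule exec_flip_word[where w=w and rest="[]"], simp, use Cons.prems in simp, rule okw,
        rule exec_Bind, rule exec_in[OF mem], use Cons.prems in \<open>simp add: fun_eq_iff\<close>,
        rule exec_Bind, rule exec_clr, simp, rule exec_Ret)
      (use Cons.prems M len in \<open>auto simp: fun_eq_iff\<close>)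
  have 2: "exec (Loop lit_body ?e) ?s ((length ws + 1) * (250 * M ^ 2))
      (if ?e \<noteq> 0 \<and> (\<forall>w\<in>set ws. negw w \<in> set P) then 1 else 0)
      (?s(5 := rest, 9 := 4 # rev (wl ws) @ ?s 9))"
    by (rule Cons.IH) (use Cons.prems in auto)
  have "240 * M ^ 2 + 1 \<le> 250 * M ^ 2" using M by linarith
  then show ?case
    by (intro exec_conv[OF exec_Loop_cont[OF 1 2]]) (auto simp: fun_eq_iff)
qed

definition clause_body :: "nat \<Rightarrow> prog" where
  "clause_body f = Bind (pop 5) (\<lambda>r. if r = 0 then Ret (if f = 0 then 0 else 2)
     else push 5 (r - 1) ;; Bind (Loop lit_body 1) (\<lambda>b. Ret (if b = 0 \<and> f = 0 then 1 else 3)))"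

definition gl :: "nat list list list \<Rightarrow> nat list" where
  "gl css = concat (map (\<lambda>ws. wl ws @ [4]) css)"

lemma gl_simps [simp]: "gl [] = []" "gl (ws # css) = wl ws @ 4 # gl css"
  by (simp_all add: gl_def)

lemma length_le_gl: "length css \<le> length (gl css)"
  by (induction css) auto

lemma length_wl_gl: "ws \<in> set css \<Longrightarrow> length (wl ws) < length (gl css)"
  by (induction css) auto

lemma exec_clause_loop:
  "s 5 = gl css \<Longrightarrow> \<forall>ws\<in>set css. length ws < M \<and> (\<forall>w\<in>set ws. okw w \<and> Suc (length w) < M) \<Longrightarrow>
    s 8 = wl P \<Longrightarrow> \<forall>w\<in>set P. 3 \<notin> set w \<Longrightarrow> length (s 8) < M \<Longrightarrow>
    s 10 = [] \<Longrightarrow> s 11 = [] \<Longrightarrow> s 12 = [] \<Longrightarrow> s 13 = [] \<Longrightarrow>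
    exec (Loop clause_body e) s ((length css + 1) * (260 * M ^ 3))
      (if e \<noteq> 0 \<or> (\<exists>ws\<in>set css. \<forall>w\<in>set ws. negw w \<in> set P) then 1 else 0)
      (s(5 := [], 9 := rev (gl css) @ s 9))"
proof (induction css arbitrary: s e)
  case Nil
  have M: "1 \<le> M ^ 3" using Nil(5) by simp
  have "exec (clause_body e) s 4 (2 * (if e \<noteq> 0 then 1 else 0)) s" unfolding clause_body_def
    by (rule exec_conv, rule exec_popB, simp, simp add: Nil split del: if_split, rule exec_Ret)
      (use Nil in \<open>auto simp: fun_eq_iff\<close>)
  from exec_Loop_exit[where f="clause_body", OF this] show ?case
    by (rule exec_conv) (use Nil M in \<open>auto simp: fun_eq_iff\<close>)
next
  case (Cons ws css)
  obtain x r where xr: "wl ws @ 4 # gl css = x # r" by (cases "wl ws @ 4 # gl css") auto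
  have s: "s(5 := x # r) = s" "s 5 = x # r" using Cons.prems(1) xr by auto
  let ?s = "s(5 := gl css, 9 := 4 # rev (wl ws) @ s 9)"
  let ?b = "if (1::nat) \<noteq> 0 \<and> (\<forall>w\<in>set ws. negw w \<in> set P) then 1 else 0 :: nat"
  let ?e = "if e \<noteq> 0 \<or> (\<forall>w\<in>set ws. negw w \<in> set P) then 1 else 0 :: nat"
  have lits: "exec (Loop lit_body 1) s ((length ws + 1) * (250 * M ^ 2)) ?b ?s"
    by (rule exec_lit_loop) (use Cons.prems in auto)
  have "length ws + 1 \<le> M" using Cons.prems(2) by simp
  then have "(length ws + 1) * (250 * M ^ 2) \<le> M * (250 * M ^ 2)" by (rule mult_le_mono1)
  also have "\<dots> = 250 * M ^ 3" using power_Suc[of M 2] by simp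
  finally have t: "(length ws + 1) * (250 * M ^ 2) \<le> 250 * M ^ 3" .
  have M: "1 \<le> M ^ 3" using Cons.prems(5) by simp
  have 1: "exec (clause_body e) s (250 * M ^ 3 + 5) (2 * ?e + 1) ?s" unfolding clause_body_def
    by (rule exec_conv, rule exec_popB, simp, simp add: s(2) split del: if_split, rule exec_pushB, simp,
        simp only: fun_upd_upd fun_upd_same list.sel(3) s,
        rule exec_Bind, rule exec_mono[OF lits t, unfolded One_nat_def], rule exec_Ret)
      (auto simp: fun_eq_iff)
  have 2: "exec (Loop clause_body ?e) ?s ((length css + 1) * (260 * M ^ 3))
      (if ?e \<noteq> 0 \<or> (\<exists>ws\<in>set css. \<forall>w\<in>set ws. negw w \<in> set P) then 1 else 0)
      (?s(5 := [], 9 := rev (gl css) @ ?s 9))"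
    by (rule Cons.IH) (use Cons.prems in auto)
  have "250 * M ^ 3 + 6 \<le> 260 * M ^ 3" using M by linarith
  then show ?case
    by (intro exec_conv[OF exec_Loop_cont[OF 1 2]]) (auto simp: fun_eq_iff)
qed

definition conf_prog :: prog where
  "conf_prog = Bind (Loop clause_body 0) (\<lambda>b. mv 9 5 ;; Ret b)"

lemma exec_conf_words:
  assumes "s 5 = gl css" "\<forall>ws\<in>set css. \<forall>w\<in>set ws. okw w"
    "s 8 = wl P" "\<forall>w\<in>set P. 3 \<notin> set w" "length (s 8) < M" "length (s 5) < M"
    "s 9 = []" "s 10 = []" "s 11 = []" "s 12 = []" "s 13 = []"
  shows "exec conf_prog s (300 * M ^ 4) (if \<exists>ws\<in>set css. \<forall>w\<in>set ws. negw w \<in> set P then 1 else 0) s"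
proof -
  have "length ws < M \<and> (\<forall>w\<in>set ws. okw w \<and> Suc (length w) < M)" if ws: "ws \<in> set css" for ws
  proof -
    have "Suc (length (wl ws)) < M" using length_wl_gl[OF ws] assms(1,6) by simp
    then show ?thesis
      using length_le_wl[of ws] length_wl_ge[of _ ws] assms(2) ws by (fastforce simp del: length_greater_0_conv)
  qed
  then have 1: "exec (Loop clause_body 0) s ((length css + 1) * (260 * M ^ 3))
      (if (0::nat) \<noteq> 0 \<or> (\<exists>ws\<in>set css. \<forall>w\<in>set ws. negw w \<in> set P) then 1 else 0)
      (s(5 := [], 9 := rev (gl css) @ s 9))"
    using assms by (intro exec_clause_loop) auto
  have "length css + 1 \<le> M" using length_le_gl[of css] assms(1,6) by simp
  then have "(length css + 1) * (260 * M ^ 3) \<le> M * (260 * M ^ 3)" by (rule mult_le_mono1)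
  also have "\<dots> = 260 * M ^ 4" using power_Suc[of M 3] by simp
  finally have t: "(length css + 1) * (260 * M ^ 3) \<le> 260 * M ^ 4" .
  have "1 \<le> M" using assms(5) by simp
  then have "M \<le> M ^ 4" using nat_power_mono[of M 1 4] by simp
  then have t2: "(length css + 1) * (260 * M ^ 3) + (10 * length (gl css) + 10 + 0 + 1) + 1 \<le> 300 * M ^ 4"
    using t assms(6)[unfolded assms(1)] by linarith
  show ?thesis unfolding conf_prog_def
    by (rule exec_conv, rule exec_Bind[OF 1], rule exec_Bind, rule exec_mvg, simp, simp, simp, rule exec_Ret)
      (use t2 assms in \<open>auto simp: fun_eq_iff\<close>)
qed

section \<open>Literals as words\<close>

definition lw :: "lit \<Rightarrow> nat list" where
  "lw l = map sym_rank (enc_lit l)"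

lemma sym_rank_inj: "sym_rank a = sym_rank b \<longleftrightarrow> a = b"
  by (cases a; cases b) auto

lemma lw_inj: "lw l = lw k \<longleftrightarrow> l = k"
proof -
  have "inj sym_rank" by (auto simp: inj_def sym_rank_inj)
  then show ?thesis unfolding lw_def by (simp add: inj_map_eq_map enc_lit_inj)
qed

lemma bin_rank: "set (map sym_rank (bin n)) \<subseteq> {0, 1}"
  using set_bin[of n] by auto

lemma bin_rank': "v \<in> set (map sym_rank (bin n)) \<Longrightarrow> v < 2"
proof -
  assume "v \<in> set (map sym_rank (bin n))"
  then have "v \<in> {0, 1}" using bin_rank by (rule subsetD[rotated])
  then show "v < 2" by auto
qed

lemma okw_lw: "okw (lw l)"
proof -
  have "3 \<notin> set (map sym_rank (bin (fst l)))" "4 \<notin> set (map sym_rank (bin (fst l)))"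
    using bin_rank'[of 3 "fst l"] bin_rank'[of 4 "fst l"] by linarith+
  then show ?thesis by (simp add: okw_def lw_def enc_lit_def)
qed

lemma lw_not3: "3 \<notin> set (lw l)"
  using okw_lw by (simp add: okw_def)

lemma lw_nonempty: "lw l \<noteq> []"
  using okw_lw by (simp add: okw_def)

lemma hd_bin: "hd (map sym_rank (bin n)) \<noteq> 2"
proof -
  have "hd (map sym_rank (bin n)) \<in> set (map sym_rank (bin n))"
    by (rule hd_in_set) simp
  from bin_rank'[OF this] show ?thesis by simp
qed

lemma negw_lw: "negw (lw l) = lw (neg l)"
  using hd_bin[of "fst l"] by (cases l) (auto simp: negw_def lw_def enc_lit_def neg_def)

lemma gl_enc: "gl (map (map lw) cs) = map sym_rank (enc_cnf cs)"
proof -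
  have "wl (map lw C) @ [4] = map sym_rank (enc_clause C)" for C
    by (induction C) (auto simp: enc_clause_def lw_def)
  then have "wl (map lw C) @ 4 # x = map sym_rank (enc_clause C) @ x" for C x
    by (metis append.assoc append_Cons append_Nil)
  then show ?thesis by (induction cs) (auto simp: enc_cnf_def)
qed

text \<open>Comparing words decides equality of literals because \<open>lw\<close> is injective, and
  \<open>negw\<close> is negation on these codes.\<close>

lemma exec_conf:
  assumes "s 5 = map sym_rank (enc_cnf cs)" "s 8 = wl (map lw P)" "length (s 8) < M" "length (s 5) < M"
    "s 9 = []" "s 10 = []" "s 11 = []" "s 12 = []" "s 13 = []"
  shows "exec conf_prog s (300 * M ^ 4) (if conf cs P then 1 else 0) s"
proof -
  have "(\<exists>ws\<in>set (map (map lw) cs). \<forall>w\<in>set ws. negw w \<in> set (map lw P)) \<longleftrightarrow> conf cs P"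
    by (simp add: conf_def negw_lw image_iff lw_inj)
  moreover have "exec conf_prog s (300 * M ^ 4)
     (if \<exists>ws\<in>set (map (map lw) cs). \<forall>w\<in>set ws. negw w \<in> set (map lw P) then 1 else 0) s"
    by (rule exec_conf_words) (use assms okw_lw lw_not3 in \<open>auto simp: gl_enc\<close>)
  ultimately show ?thesis by simp
qed

section \<open>Saturation rounds on the stacks\<close>

abbreviation lits :: "lit list \<Rightarrow> nat list" where
  "lits P \<equiv> wl (map lw P)"

text \<open>The negated literal is put on top of register 8 tentatively. After a conflict, flipping
  its sign turns the list into \<open>l # P\<close>; otherwise dropping the word restores
  \<open>P\<close>.\<close>

definition prop_body :: "nat \<Rightarrow> prog" where
  "prop_body e = Bind (pop 14) (\<lambda>r. if r = 0 then Ret 0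
     else push 14 (r - 1) ;; take_word 14 15 11 ;; push 8 3 ;; mv 11 8 ;; flip_word 8 ;;
       Bind conf_prog (\<lambda>b. if b = 0 then drop_word 8 ;; Ret 1 else flip_word 8 ;; Ret 1))"

lemma length_lw_neg: "length (lw (neg l)) \<le> Suc (length (lw l))"
  using length_negw[of "lw l"] by (simp add: negw_lw)

text \<open>A pass adds at most one copy per literal occurrence, so the list stays polynomial
  although duplicates are not removed.\<close>

lemma length_lits_prop1:
  "length (lits (fold (prop1 cs) ls P)) \<le> length (lits P) + length (lits ls)"
proof (induction ls arbitrary: P)
  case (Cons l ls)
  have "length (lits (prop1 cs l P)) \<le> length (lits P) + length (lw l) + 1"
    by (simp add: prop1_def)
  then show ?case using Cons[of "prop1 cs l P"] by simp
qed simp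

lemma exec_prop_loop:
  "s 14 = lits ls \<Longrightarrow> s 8 = lits P \<Longrightarrow> s 5 = map sym_rank (enc_cnf cs) \<Longrightarrow>
    length (lits P) + length (lits ls) + 2 < M \<Longrightarrow> length (s 5) < M \<Longrightarrow>
    s 9 = [] \<Longrightarrow> s 10 = [] \<Longrightarrow> s 11 = [] \<Longrightarrow> s 12 = [] \<Longrightarrow> s 13 = [] \<Longrightarrow>
    exec (Loop prop_body e) s ((length ls + 1) * (400 * M ^ 4)) 0
      (s(14 := [], 15 := rev (lits ls) @ s 15, 8 := lits (fold (prop1 cs) ls P)))"
proof (induction ls arbitrary: s e P)
  case Nil
  have M: "1 \<le> M ^ 4" using Nil(5) by simp
  have "exec (prop_body e) s 4 (2 * 0) s" unfolding prop_body_def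
    by (rule exec_conv, rule exec_popB, simp, simp add: Nil, rule exec_Ret)
      (use Nil in \<open>auto simp: fun_eq_iff\<close>)
  from exec_Loop_exit[where f="prop_body", OF this] show ?case
    by (rule exec_conv) (use Nil M in \<open>auto simp: fun_eq_iff\<close>)
next
  case (Cons l ls)
  obtain x w where w: "lw l = x # w" using lw_nonempty[of l] by (cases "lw l") auto
  have s14: "s 14 = x # w @ 3 # lits ls" using Cons.prems(1) w by simp
  have s14': "s(14 := x # w @ 3 # lits ls) = s" using s14 by auto
  let ?P = "prop1 cs l P"
  let ?s = "s(14 := lits ls, 15 := 3 # rev (lw l) @ s 15, 8 := lits ?P)"
  let ?s1 = "?s(8 := lits (neg l # P))"
  have M1: "1 \<le> M" using Cons.prems(5) by simp
  then have M4: "M \<le> M ^ 4" using nat_power_mono[of M 1 4] by simp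
  have conf: "exec conf_prog ?s1 (300 * M ^ 4) (if conf cs (neg l # P) then 1 else 0) ?s1"
    by (rule exec_conf) (use Cons.prems length_lw_neg[of l] in auto)
  have len: "length (lw l) + 2 < M" using Cons.prems(4) by simp
  have len2: "length (lw (neg l)) < M" using len length_lw_neg[of l] by linarith
  have 1: "exec (prop_body e) s (390 * M ^ 4) (2 * 0 + 1) ?s"
  proof (cases "conf cs (neg l # P)")
    case True
    show ?thesis unfolding prop_body_def
      by (rule exec_conv, rule exec_popB, simp, simp add: s14 split del: if_split, rule exec_pushB, simp,
          simp only: fun_upd_upd fun_upd_same list.sel(3) s14',
          rule exec_Bind, rule exec_take_word[of _ _ _ s "lw l" "lits ls"], simp, simp, simp, simp, simp, simp,
          use s14 w in simp, rule lw_not3,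
          rule exec_pushB, simp,
          rule exec_Bind, rule exec_mvg, simp, simp, simp,
          rule exec_Bind, rule exec_flip_word[where w="lw l" and rest="3 # lits P"], simp, use Cons.prems in simp, rule lw_nonempty,
          rule exec_Bind, rule exec_in[OF conf], use Cons.prems in \<open>simp add: fun_eq_iff negw_lw\<close>,
          simp only: True if_True one_neq_zero if_False,
          rule exec_Bind, rule exec_flip_word[where w="lw (neg l)" and rest="3 # lits P"], simp, simp, rule lw_nonempty, rule exec_Ret)
        (use Cons.prems M4 M1 len len2 True in \<open>auto simp: fun_eq_iff negw_lw prop1_def\<close>)
  next
    case False
    show ?thesis unfolding prop_body_def
      by (rule exec_conv, rule exec_popB, simp, simp add: s14 split del: if_split, rule exec_pushB, simp,
          simp only: fun_upd_upd fun_upd_same list.sel(3) s14',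
          rule exec_Bind, rule exec_take_word[of _ _ _ s "lw l" "lits ls"], simp, simp, simp, simp, simp, simp,
          use s14 w in simp, rule lw_not3,
          rule exec_pushB, simp,
          rule exec_Bind, rule exec_mvg, simp, simp, simp,
          rule exec_Bind, rule exec_flip_word[where w="lw l" and rest="3 # lits P"], simp, use Cons.prems in simp, rule lw_nonempty,
          rule exec_Bind, rule exec_in[OF conf], use Cons.prems in \<open>simp add: fun_eq_iff negw_lw\<close>,
          simp only: False simp_thms if_True if_False,
          rule exec_Bind, rule exec_drop_word[where w="lw (neg l)" and rest="lits P"], simp, simp, rule lw_not3, rule exec_Ret)
        (use Cons.prems M4 M1 len len2 False in \<open>auto simp: fun_eq_iff negw_lw prop1_def\<close>)
  qed
  have "length (lits ?P) + length (lits ls) + 2 < M"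
    using Cons.prems(4) by (auto simp: prop1_def)
  then have 2: "exec (Loop prop_body 0) ?s ((length ls + 1) * (400 * M ^ 4)) 0
      (?s(14 := [], 15 := rev (lits ls) @ ?s 15, 8 := lits (fold (prop1 cs) ls ?P)))"
    by (intro Cons.IH) (use Cons.prems in auto)
  have "390 * M ^ 4 + 1 \<le> 400 * M ^ 4" using M1 M4 by linarith
  then show ?case
    by (intro exec_conv[OF exec_Loop_cont[OF 1 2]]) (auto simp: fun_eq_iff)
qed

definition round_prog :: prog where
  "round_prog = Loop prop_body 0 ;; mv 15 14"

lemma length_ls_lits: "length ls \<le> length (lits ls)"
  using length_le_wl[of "map lw ls"] by simp

lemma exec_round:
  assumes "s 14 = lits (concat cs)" "s 8 = lits P" "s 5 = map sym_rank (enc_cnf cs)"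
    "length (lits P) + length (s 14) + 2 < M" "length (s 5) < M"
    "s 9 = []" "s 10 = []" "s 11 = []" "s 12 = []" "s 13 = []" "s 15 = []"
  shows "exec round_prog s (500 * M ^ 5) 0 (s(8 := lits (up_round cs P)))"
proof -
  have 1: "exec (Loop prop_body 0) s ((length (concat cs) + 1) * (400 * M ^ 4)) 0
      (s(14 := [], 15 := rev (lits (concat cs)) @ s 15, 8 := lits (fold (prop1 cs) (concat cs) P)))"
    by (rule exec_prop_loop) (use assms in auto)
  have "length (concat cs) + 1 \<le> M" using length_ls_lits[of "concat cs"] assms(4)[unfolded assms(1)] by linarith
  then have "(length (concat cs) + 1) * (400 * M ^ 4) \<le> M * (400 * M ^ 4)" by (rule mult_le_mono1)
  also have "\<dots> = 400 * M ^ 5" using power_Suc[of M 4] by simp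
  finally have t: "(length (concat cs) + 1) * (400 * M ^ 4) \<le> 400 * M ^ 5" .
  have "1 \<le> M" using assms(5) by simp
  then have "M \<le> M ^ 5" using nat_power_mono[of M 1 5] by simp
  then have t2: "(length (concat cs) + 1) * (400 * M ^ 4) + (10 * length (lits (concat cs)) + 10) + 1 \<le> 500 * M ^ 5"
    using t assms(4)[unfolded assms(1)] by linarith
  show ?thesis unfolding round_prog_def
    by (rule exec_conv, rule exec_Bind[OF 1], rule exec_mvg, simp, simp, simp)
      (use t2 assms in \<open>auto simp: fun_eq_iff up_round_def\<close>)
qed

text \<open>Register 18 is a unary counter. It holds a copy of the formula, whose length is at least
  the number of literal occurrences and hence enough rounds for
  \<open>backdoor_rounds\<close>.\<close>

definition rounds_body :: "nat \<Rightarrow> prog" where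
  "rounds_body e = Bind (pop 18) (\<lambda>r. if r = 0 then Ret 0 else push 19 (r - 1) ;; round_prog ;; Ret 1)"

lemma exec_rounds_loop:
  "s 18 = us \<Longrightarrow> s 14 = lits (concat cs) \<Longrightarrow> s 8 = lits P \<Longrightarrow> s 5 = map sym_rank (enc_cnf cs) \<Longrightarrow>
    length (lits P) + (length us + 1) * length (s 14) + 2 < M \<Longrightarrow> length (s 5) < M \<Longrightarrow>
    s 9 = [] \<Longrightarrow> s 10 = [] \<Longrightarrow> s 11 = [] \<Longrightarrow> s 12 = [] \<Longrightarrow> s 13 = [] \<Longrightarrow> s 15 = [] \<Longrightarrow>
    exec (Loop rounds_body e) s ((length us + 1) * (510 * M ^ 5)) 0
      (s(18 := [], 19 := rev us @ s 19, 8 := lits ((up_round cs ^^ length us) P)))"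
proof (induction us arbitrary: s e P)
  case Nil
  have M: "1 \<le> M ^ 5" using Nil(6) by simp
  have "exec (rounds_body e) s 4 (2 * 0) s" unfolding rounds_body_def
    by (rule exec_conv, rule exec_popB, simp, simp add: Nil, rule exec_Ret)
      (use Nil in \<open>auto simp: fun_eq_iff\<close>)
  from exec_Loop_exit[where f="rounds_body", OF this] show ?case
    by (rule exec_conv) (use Nil M in \<open>auto simp: fun_eq_iff\<close>)
next
  case (Cons u us)
  let ?P = "up_round cs P"
  let ?sa = "s(18 := us, 19 := u # s 19)"
  let ?s = "?sa(8 := lits ?P)"
  have M: "1 \<le> M ^ 5" using Cons.prems(6) by simp
  have r: "exec round_prog ?sa (500 * M ^ 5) 0 ?s"
    by (rule exec_round) (use Cons.prems in auto)
  have 1: "exec (rounds_body e) s (500 * M ^ 5 + 5) (2 * 0 + 1) ?s" unfolding rounds_body_def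
    by (rule exec_conv, rule exec_popB, simp, simp add: Cons.prems(1) split del: if_split, rule exec_pushB, simp,
        rule exec_Bind, rule exec_in[OF r], use Cons.prems in \<open>simp add: fun_eq_iff\<close>, rule exec_Ret)
      auto
  have "length (lits ?P) \<le> length (lits P) + length (s 14)"
    using length_lits_prop1[of cs "concat cs" P] Cons.prems(2) by (simp add: up_round_def)
  then have "length (lits ?P) + (length us + 1) * length (s 14) + 2 < M"
    using Cons.prems(5) by simp
  then have 2: "exec (Loop rounds_body 0) ?s ((length us + 1) * (510 * M ^ 5)) 0
      (?s(18 := [], 19 := rev us @ ?s 19, 8 := lits ((up_round cs ^^ length us) ?P)))"
    by (intro Cons.IH) (use Cons.prems in auto)
  have "500 * M ^ 5 + 6 \<le> 510 * M ^ 5" using M by linarith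
  then show ?case
    by (intro exec_conv[OF exec_Loop_cont[OF 1 2]]) (auto simp: fun_eq_iff funpow_swap1)
qed

text \<open>All registers are restored, so the next assignment is checked in the same environment.
  The value 1 reports a conflict, that is, failure of the assignment.\<close>

definition check_prog :: prog where
  "check_prog = mv 17 16 ;; mv2 16 17 8 ;; Loop rounds_body 0 ;; mv 19 18 ;; Bind conf_prog (\<lambda>b. clr 8 ;; Ret b)"

lemma length_lits_rounds:
  "length (lits ((up_round cs ^^ n) P)) \<le> length (lits P) + n * length (lits (concat cs))"
proof (induction n)
  case (Suc n)
  then show ?case
    using length_lits_prop1[of cs "concat cs" "(up_round cs ^^ n) P"] by (simp add: up_round_def[of cs "(up_round cs ^^ n) P"])
qed simp

lemma exec_check:
  assumes "s 14 = lits (concat cs)" "s 17 = lits D" "s 5 = map sym_rank (enc_cnf cs)"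
    "length (lits D) + (length (s 18) + 1) * length (s 14) + 2 < M" "length (s 5) < M" "length (s 18) < M"
    "s 8 = []" "s 9 = []" "s 10 = []" "s 11 = []" "s 12 = []" "s 13 = []" "s 15 = []" "s 16 = []" "s 19 = []"
  shows "exec check_prog s (1000 * M ^ 6) (if conf cs ((up_round cs ^^ length (s 18)) D) then 1 else 0) s"
proof -
  let ?Q = "(up_round cs ^^ length (s 18)) D"
  let ?sa = "s(8 := lits D)"
  let ?s1 = "?sa(18 := [], 19 := rev (s 18) @ ?sa 19, 8 := lits ?Q)"
  let ?s2 = "s(8 := lits ?Q)"
  have 1: "exec (Loop rounds_body 0) ?sa ((length (s 18) + 1) * (510 * M ^ 5)) 0 ?s1"
    by (rule exec_rounds_loop) (use assms in auto)
  have lQ: "length (lits ?Q) < M"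
    using length_lits_rounds[where cs=cs and n="length (s 18)" and P=D] assms(4) unfolding assms(1) by simp
  define c where "c = 300 * M ^ 4"
  have 2: "exec conf_prog ?s2 c (if conf cs ?Q then 1 else 0) ?s2"
    unfolding c_def by (rule exec_conf) (use assms lQ in auto)
  have "length (s 18) + 1 \<le> M" using assms(6) by simp
  then have "(length (s 18) + 1) * (510 * M ^ 5) \<le> M * (510 * M ^ 5)" by (rule mult_le_mono1)
  also have "\<dots> = 510 * M ^ 6" using power_Suc[of M 5] by simp
  finally have t: "(length (s 18) + 1) * (510 * M ^ 5) \<le> 510 * M ^ 6" .
  have "1 \<le> M" using assms(5) by simp
  then have M: "M \<le> M ^ 6" "c \<le> 300 * M ^ 6" "1 \<le> M"
    using nat_power_mono[of M 1 6] nat_power_mono[of M 4 6] by (simp_all add: c_def)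
  have len: "length (lits D) < M" using assms(4) by linarith
  show ?thesis unfolding check_prog_def
    by (rule exec_conv, rule exec_Bind, rule exec_mvg, simp, simp, simp,
        rule exec_Bind, rule exec_mv2, simp, simp, simp, simp, simp, simp,
        rule exec_Bind, rule exec_in[OF 1], use assms in \<open>simp add: fun_eq_iff\<close>,
        rule exec_Bind, rule exec_mvg, simp, simp, simp,
        rule exec_Bind, rule exec_in[OF 2], use assms in \<open>simp add: fun_eq_iff\<close>,
        rule exec_Bind, rule exec_clr, simp, rule exec_Ret)
      (use t M len lQ assms in \<open>auto simp: fun_eq_iff\<close>)
qed

section \<open>Enumerating the assignments of a backdoor\<close>

text \<open>A binary counter with the least significant literal first and \<open>True\<close> as
  digit 0; the Boolean component is \<open>False\<close> on overflow.\<close>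

fun inc :: "lit list \<Rightarrow> bool \<times> lit list" where
  "inc [] = (False, [])"
| "inc ((x, True) # D) = (True, (x, False) # D)"
| "inc ((x, False) # D) = (fst (inc D), (x, True) # snd (inc D))"

fun val :: "lit list \<Rightarrow> nat" where
  "val [] = 0"
| "val ((x, b) # D) = (if b then 0 else 1) + 2 * val D"

lemma map_fst_inc: "map fst (snd (inc D)) = map fst D"
  by (induction D rule: inc.induct) auto

lemma val_less: "val D < 2 ^ length D"
  by (induction D rule: val.induct) auto

lemma val_inc: "fst (inc D) \<Longrightarrow> val (snd (inc D)) = val D + 1"
  by (induction D rule: inc.induct) auto

lemma val_inc_overflow: "\<not> fst (inc D) \<Longrightarrow> val D + 1 = 2 ^ length D"
  by (induction D rule: inc.induct) auto

lemma val_inj: "map fst D = map fst D' \<Longrightarrow> val D = val D' \<Longrightarrow> D = D'"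
proof (induction D arbitrary: D' rule: val.induct)
  case (2 x b D)
  obtain c E where D': "D' = (x, c) # E" using 2(2) by (cases D') auto
  have "b = c \<and> val D = val E"
    using 2(3) D' by (auto split: if_splits) presburger+
  then show ?case using 2 D' by auto
qed simp

definition inc_body :: "nat \<Rightarrow> prog" where
  "inc_body e = Bind (pop 17) (\<lambda>r. if r = 0 then Ret 0 else if r = 3 then move_word 17 16 ;; Ret 1
     else push 17 (r - 1) ;; push 17 2 ;; Ret 2)"

lemma lw_False: "lw (x, False) = 2 # lw (x, True)"
  by (simp add: lw_def enc_lit_def)

lemma lw_True: obtains y ys where "lw (x, True) = y # ys" "y < 2"
proof -
  obtain y ys where y: "lw (x, True) = y # ys" using lw_nonempty[of "(x, True)"] by (cases "lw (x, True)") auto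
  then have "y \<in> set (map sym_rank (bin x))" by (simp add: lw_def enc_lit_def)
  then have "y < 2" by (rule bin_rank')
  with y show ?thesis by (rule that)
qed

text \<open>\<open>a\<close> is the part that the carry has passed, reversed on 16, and
  \<open>b\<close> is what is left on 17; the split depends on \<open>D\<close>, hence the
  existential.\<close>

lemma exec_inc_loop:
  "s 17 = lits D \<Longrightarrow> \<forall>l\<in>set D. 10 * length (lw l) + 30 \<le> c \<Longrightarrow> 30 \<le> c \<Longrightarrow>
    \<exists>a b. exec (Loop inc_body e) s ((length D + 1) * c) (if fst (inc D) then 1 else 0) (s(16 := rev a @ s 16, 17 := b)) \<and>
      a @ b = lits (snd (inc D))"
proof (induction D arbitrary: s e rule: inc.induct)
  case 1
  have "exec (inc_body e) s 4 (2 * 0) s" unfolding inc_body_def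
    by (rule exec_conv, rule exec_popB, simp, simp add: 1, rule exec_Ret)
      (use 1 in \<open>auto simp: fun_eq_iff\<close>)
  from exec_Loop_exit[where f="inc_body", OF this]
  have "exec (Loop inc_body e) s ((length [] + 1) * c) (if fst (inc []) then 1 else 0) (s(16 := rev [] @ s 16, 17 := []))"
    by (rule exec_conv) (use 1 in \<open>auto simp: fun_eq_iff\<close>)
  moreover have "[] @ [] = lits (snd (inc []))" by simp
  ultimately show ?case by blast
next
  case (2 x D)
  obtain y ys where y: "lw (x, True) = y # ys" "y < 2" by (rule lw_True)
  then have y2: "y \<noteq> 2" by simp
  let ?b = "lits ((x, False) # D)"
  have "exec (inc_body e) s 10 (2 * 1) (s(17 := ?b))" unfolding inc_body_def
    by (rule exec_conv, rule exec_popB, simp, use y y2 2(1) in simp, rule exec_pushB, simp, rule exec_pushB, simp, rule exec_Ret)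
      (use y 2(1) in \<open>auto simp: fun_eq_iff lw_False\<close>)
  from exec_Loop_exit[where f="inc_body", OF this]
  have "exec (Loop inc_body e) s ((length ((x, True) # D) + 1) * c) (if fst (inc ((x, True) # D)) then 1 else 0)
      (s(16 := rev [] @ s 16, 17 := ?b))"
    by (rule exec_conv) (use 2 in \<open>auto simp: fun_eq_iff\<close>)
  moreover have "[] @ ?b = lits (snd (inc ((x, True) # D)))" by simp
  ultimately show ?case by blast
next
  case (3 x D)
  let ?s = "s(17 := lits D, 16 := 3 # rev (lw (x, True)) @ s 16)"
  have 1: "exec (inc_body e) s (10 * length (lw (x, False)) + 20) (2 * 0 + 1) ?s" unfolding inc_body_def
    by (rule exec_conv, rule exec_popB, simp, use "3.prems"(1) lw_False[of x] in simp,
        rule exec_Bind, rule exec_move_word[where w="lw (x, True)" and rest="lits D"], simp, simp, simp, simp, rule lw_not3, rule exec_Ret)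
      (use "3.prems"(1) in \<open>auto simp: fun_eq_iff lw_False\<close>)
  have "\<exists>a b. exec (Loop inc_body 0) ?s ((length D + 1) * c) (if fst (inc D) then 1 else 0) (?s(16 := rev a @ ?s 16, 17 := b)) \<and>
      a @ b = lits (snd (inc D))"
    by (rule 3(1)) (use "3.prems" in auto)
  then obtain a b where 2: "exec (Loop inc_body 0) ?s ((length D + 1) * c) (if fst (inc D) then 1 else 0) (?s(16 := rev a @ ?s 16, 17 := b))"
    "a @ b = lits (snd (inc D))" by (elim exE conjE)
  let ?a = "lw (x, True) @ 3 # a"
  have "10 * length (lw (x, False)) + 30 \<le> c" using "3.prems"(2) by simp
  then have "exec (Loop inc_body e) s ((length ((x, False) # D) + 1) * c) (if fst (inc ((x, False) # D)) then 1 else 0)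
      (s(16 := rev ?a @ s 16, 17 := b))"
    by (intro exec_conv[OF exec_Loop_cont[OF 1 2(1)]]) (auto simp: fun_eq_iff)
  moreover have "?a @ b = lits (snd (inc ((x, False) # D)))" using 2(2) by simp
  ultimately show ?case by blast
qed

definition inc_prog :: prog where
  "inc_prog = Bind (Loop inc_body 0) (\<lambda>v. mv 16 17 ;; Ret v)"

lemma length_lits_inc: "length (lits (snd (inc D))) \<le> length (lits D) + 1"
  by (induction D rule: inc.induct) (auto simp: lw_False)

lemma length_lw_lits: "l \<in> set D \<Longrightarrow> length (lw l) < length (lits D)"
  by (rule length_wl_ge) simp

lemma exec_inc:
  assumes "s 17 = lits D" "s 16 = []" "length (lits D) < M"
  shows "exec inc_prog s (70 * M ^ 2) (if fst (inc D) then 1 else 0) (s(17 := lits (snd (inc D))))"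
proof -
  have c: "\<forall>l\<in>set D. 10 * length (lw l) + 30 \<le> 40 * M"
  proof
    fix l assume "l \<in> set D"
    then show "10 * length (lw l) + 30 \<le> 40 * M" using length_lw_lits[of l D] assms(3) by linarith
  qed
  have c30: "30 \<le> 40 * M" using assms(3) by linarith
  obtain a b where ab: "exec (Loop inc_body 0) s ((length D + 1) * (40 * M)) (if fst (inc D) then 1 else 0) (s(16 := rev a @ s 16, 17 := b))"
    "a @ b = lits (snd (inc D))"
    using exec_inc_loop[where s=s and D=D and c="40 * M" and e=0, OF assms(1) c c30] by (elim exE conjE)
  have "length D + 1 \<le> M" using length_ls_lits[of D] assms(3) by linarith
  then have "(length D + 1) * (40 * M) \<le> M * (40 * M)" by (rule mult_le_mono1)
  also have "\<dots> = 40 * M ^ 2" by (simp add: power2_eq_square)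
  finally have t: "(length D + 1) * (40 * M) \<le> 40 * M ^ 2" .
  have "length a \<le> M" using arg_cong[OF ab(2), of length] length_lits_inc[of D] assms(3) by simp
  moreover have "M \<le> M ^ 2" "1 \<le> M" using assms(3) by (auto simp: power2_eq_square)
  ultimately have t3: "(length D + 1) * (40 * M) + (10 * length a + 12) \<le> 70 * M ^ 2"
    using t by linarith
  show ?thesis unfolding inc_prog_def
    by (rule exec_conv, rule exec_Bind[OF ab(1)], rule exec_Bind, rule exec_mvg, simp, simp, simp, rule exec_Ret)
      (use t3 ab(2) assms in \<open>auto simp: fun_eq_iff\<close>)
qed

definition env :: "lit list list \<Rightarrow> store \<Rightarrow> bool" where
  "env cs s \<longleftrightarrow> s 14 = lits (concat cs) \<and> s 5 = map sym_rank (enc_cnf cs) \<and> s 18 = map sym_rank (enc_cnf cs) \<and>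
    s 8 = [] \<and> s 9 = [] \<and> s 10 = [] \<and> s 11 = [] \<and> s 12 = [] \<and> s 13 = [] \<and> s 15 = [] \<and> s 16 = [] \<and> s 19 = []"

lemma exec_check_env:
  assumes "env cs s" "s 17 = lits D"
    "length (lits D) + (length (enc_cnf cs) + 1) * length (lits (concat cs)) + 2 < M" "length (enc_cnf cs) < M"
  shows "exec check_prog s (1000 * M ^ 6) (if conf cs ((up_round cs ^^ length (enc_cnf cs)) D) then 1 else 0) s"
  using exec_check[of s cs D M] assms by (simp add: env_def)

definition enum_body :: "nat \<Rightarrow> prog" where
  "enum_body e = Bind check_prog (\<lambda>b. if b = 0 then Ret 2 else Bind inc_prog (\<lambda>v. if v = 0 then Ret 0 else Ret 1))"

text \<open>Induction on the number of assignments not yet tried. The claim concerns only those with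
  \<open>val D \<le> val D'\<close>, which are all of them when the loop starts at value 0. The size
  hypothesis ranges over all sign patterns because words change their lengths along the way.\<close>

lemma exec_enum:
  "env cs s \<Longrightarrow> s 17 = lits D \<Longrightarrow> length (enc_cnf cs) < M \<Longrightarrow>
    \<forall>D'. map fst D' = map fst D \<longrightarrow>
      length (lits D') + (length (enc_cnf cs) + 1) * length (lits (concat cs)) + 2 < M \<Longrightarrow>
    \<exists>s'. exec (Loop enum_body e) s ((2 ^ length D - val D) * (1100 * M ^ 6))
      (if \<exists>D'. map fst D' = map fst D \<and> val D \<le> val D' \<and> \<not> conf cs ((up_round cs ^^ length (enc_cnf cs)) D') then 1 else 0) s'"
proof (induction "2 ^ length D - val D" arbitrary: s D e)
  case 0
  then show ?case using val_less[of D] by simp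
next
  case (Suc k)
  let ?ok = "\<lambda>D. \<not> conf cs ((up_round cs ^^ length (enc_cnf cs)) D)"
  let ?E = "\<exists>D'. map fst D' = map fst D \<and> val D \<le> val D' \<and> ?ok D'"
  have M: "1 \<le> M" using Suc.prems(3) by simp
  have M26: "70 * M ^ 2 \<le> 70 * M ^ 6" "1 \<le> M ^ 6" using nat_power_mono[OF M, of 2 6] nat_power_mono[OF M, of 0 6] by auto
  have k: "1 \<le> 2 ^ length D - val D" using Suc.hyps(2) by linarith
  have "exec check_prog s (1000 * M ^ 6) (if ?ok D then 0 else 1) s"
    by (rule exec_conv[OF exec_check_env[where cs=cs and s=s and D=D, OF Suc.prems(1,2) _ Suc.prems(3)]])
      (use Suc.prems(4) in auto)
  note ch = this
  show ?case
  proof (cases "?ok D")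
    case True
    have "exec (enum_body e) s (1000 * M ^ 6 + 0 + 1) (2 * 1) s" unfolding enum_body_def
      by (rule exec_conv, rule exec_Bind[OF ch], use True in simp, rule exec_Ret) auto
    from exec_Loop_exit[where f=enum_body, OF this]
    have 1: "exec (Loop enum_body e) s (1000 * M ^ 6 + 0 + 1 + 1) 1 s" .
    have "1000 * M ^ 6 + 0 + 1 + 1 \<le> 1 * (1100 * M ^ 6)" using M26 by linarith
    also have "\<dots> \<le> (2 ^ length D - val D) * (1100 * M ^ 6)" by (rule mult_le_mono1[OF k])
    finally have "1000 * M ^ 6 + 0 + 1 + 1 \<le> (2 ^ length D - val D) * (1100 * M ^ 6)" .
    from exec_mono[OF 1 this] show ?thesis using True by auto
  next
    case False
    let ?D = "snd (inc D)"
    let ?s = "s(17 := lits ?D)"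
    have ic: "exec inc_prog s (70 * M ^ 6) (if fst (inc D) then 1 else 0) ?s"
      by (rule exec_mono[OF exec_inc[where M=M] M26(1)]) (use Suc.prems in \<open>auto simp: env_def\<close>)
    show ?thesis
    proof (cases "fst (inc D)")
      case True
      have 1: "exec (enum_body e) s (1000 * M ^ 6 + (70 * M ^ 6 + 0 + 1) + 1) (2 * 0 + 1) ?s" unfolding enum_body_def
        by (rule exec_conv, rule exec_Bind[OF ch], use False in simp, rule exec_Bind[OF ic], use True in simp, rule exec_Ret) auto
      have v: "val ?D = val D + 1" by (rule val_inc[OF True])
      have lenD: "length ?D = length D" using arg_cong[OF map_fst_inc[of D], of length] by simp
      have "\<exists>s'. exec (Loop enum_body 0) ?s ((2 ^ length ?D - val ?D) * (1100 * M ^ 6))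
      (if \<exists>D'. map fst D' = map fst ?D \<and> val ?D \<le> val D' \<and> ?ok D' then 1 else 0) s'"
        by (rule Suc.hyps(1)) (use Suc.hyps(2) Suc.prems v lenD in \<open>auto simp: env_def map_fst_inc\<close>)
      then obtain s' where 2: "exec (Loop enum_body 0) ?s ((2 ^ length ?D - val ?D) * (1100 * M ^ 6))
      (if \<exists>D'. map fst D' = map fst ?D \<and> val ?D \<le> val D' \<and> ?ok D' then 1 else 0) s'" by (elim exE)
      have "(\<exists>D'. map fst D' = map fst ?D \<and> val ?D \<le> val D' \<and> ?ok D') \<longleftrightarrow> ?E"
        unfolding v map_fst_inc
      proof
        assume ?E
        then obtain D' where D': "map fst D' = map fst D" "val D \<le> val D'" "?ok D'" by blast
        \<comment> \<open>\<open>D\<close> itself failed, so a successful assignment has a strictly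
          larger value.\<close>
        then have "val D \<noteq> val D'" using val_inj[of D D'] False by metis
        then show "\<exists>D'. map fst D' = map fst D \<and> val D + 1 \<le> val D' \<and> ?ok D'" using D' by (intro exI[of _ D']) auto
      next
        assume "\<exists>D'. map fst D' = map fst D \<and> val D + 1 \<le> val D' \<and> ?ok D'"
        then obtain D' where "map fst D' = map fst D" "val D + 1 \<le> val D'" "?ok D'" by blast
        then show ?E by (intro exI[of _ D']) auto
      qed
      note E = this
      have "2 ^ length D - val D = (2 ^ length ?D - val ?D) + 1" using v lenD k by simp
      then have "(1000 * M ^ 6 + (70 * M ^ 6 + 0 + 1) + 1) + (2 ^ length ?D - val ?D) * (1100 * M ^ 6) + 1
          \<le> (2 ^ length D - val D) * (1100 * M ^ 6)" using M26 by simp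
      from exec_conv[OF exec_Loop_cont[where f=enum_body, OF 1 2] this refl refl] show ?thesis unfolding E by blast
    next
      case inF: False
      have 1: "exec (enum_body e) s (1000 * M ^ 6 + (70 * M ^ 6 + 0 + 1) + 1) (2 * 0) ?s" unfolding enum_body_def
        by (rule exec_conv, rule exec_Bind[OF ch], use False in simp, rule exec_Bind[OF ic], use inF in simp, rule exec_Ret) auto
      \<comment> \<open>On overflow \<open>D\<close> has the largest possible value, so it was the
        last candidate.\<close>
      have "D' = D" if D': "map fst D' = map fst D" "val D \<le> val D'" for D'
      proof -
        have "length D' = length D" using arg_cong[OF D'(1), of length] by simp
        then have "val D' = val D" using val_less[of D'] val_inc_overflow[OF inF] D'(2) by simp
        then show ?thesis using val_inj D'(1) by metis
      qed
      then have E: "?E \<longleftrightarrow> False" using False by blast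
      have "1000 * M ^ 6 + (70 * M ^ 6 + 0 + 1) + 1 + 1 \<le> 1 * (1100 * M ^ 6)" using M26 by linarith
      also have "\<dots> \<le> (2 ^ length D - val D) * (1100 * M ^ 6)" by (rule mult_le_mono1[OF k])
      finally have t: "1000 * M ^ 6 + (70 * M ^ 6 + 0 + 1) + 1 + 1 \<le> (2 ^ length D - val D) * (1100 * M ^ 6)" .
      from exec_mono[OF exec_Loop_exit[where f=enum_body, OF 1] t] show ?thesis unfolding E by auto
    qed
  qed
qed

text \<open>Without repetitions the enumeration runs over \<open>2 ^ card (set xs)\<close>
  assignments. A new word passes through 11 because moving it reverses it.\<close>

definition dedup_body :: "nat \<Rightarrow> prog" where
  "dedup_body e = Bind (pop 7) (\<lambda>r. if r = 0 then Ret 0 else push 7 (r - 1) ;; take_word 7 20 11 ;; mv 11 12 ;;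
     Bind mem_word (\<lambda>b. if b = 0 then push 8 3 ;; mv 12 11 ;; mv 11 8 ;; Ret 1 else clr 12 ;; Ret 1))"

lemma exec_dedup_loop:
  "s 7 = lits L \<Longrightarrow> s 8 = lits P \<Longrightarrow> length (lits P) + length (lits L) + 1 < M \<Longrightarrow>
    s 10 = [] \<Longrightarrow> s 11 = [] \<Longrightarrow> s 12 = [] \<Longrightarrow> s 13 = [] \<Longrightarrow>
    exec (Loop dedup_body e) s ((length L + 1) * (200 * M ^ 2)) 0
      (s(7 := [], 20 := rev (lits L) @ s 20, 8 := lits (fold List.insert L P)))"
proof (induction L arbitrary: s e P)
  case Nil
  have M: "1 \<le> M ^ 2" using Nil(3) by simp
  have "exec (dedup_body e) s 4 (2 * 0) s" unfolding dedup_body_def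
    by (rule exec_conv, rule exec_popB, simp, simp add: Nil, rule exec_Ret)
      (use Nil in \<open>auto simp: fun_eq_iff\<close>)
  from exec_Loop_exit[where f="dedup_body", OF this] show ?case
    by (rule exec_conv) (use Nil M in \<open>auto simp: fun_eq_iff\<close>)
next
  case (Cons l L)
  obtain x w where w: "lw l = x # w" using lw_nonempty[of l] by (cases "lw l") auto
  have s7: "s 7 = x # w @ 3 # lits L" using Cons.prems(1) w by simp
  have s7': "s(7 := x # w @ 3 # lits L) = s" using s7 by auto
  let ?P = "List.insert l P"
  let ?s = "s(7 := lits L, 20 := 3 # rev (lw l) @ s 20, 8 := lits ?P)"
  let ?s1 = "s(7 := lits L, 20 := 3 # rev (lw l) @ s 20, 12 := lw l)"
  have M: "M \<le> M ^ 2" "1 \<le> M" using Cons.prems(3) by (auto simp: power2_eq_square)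
  have len: "length (lw l) < M" using Cons.prems(3) by simp
  have mem: "exec mem_word ?s1 (100 * M ^ 2) (if l \<in> set P then 1 else 0) ?s1"
  proof -
    have "lw l \<in> lw ` set P \<longleftrightarrow> l \<in> set P" by (simp add: image_iff lw_inj)
    then show ?thesis
      by (intro exec_conv[OF exec_mem_word[of _ "map lw P" M]]) (use Cons.prems lw_not3 in auto)
  qed
  have 1: "exec (dedup_body e) s (190 * M ^ 2) (2 * 0 + 1) ?s"
  proof (cases "l \<in> set P")
    case True
    show ?thesis unfolding dedup_body_def
      by (rule exec_conv, rule exec_popB, simp, simp add: s7 split del: if_split, rule exec_pushB, simp,
          simp only: fun_upd_upd fun_upd_same list.sel(3) s7',
          rule exec_Bind, rule exec_take_word[of _ _ _ s "lw l" "lits L"], simp, simp, simp, simp, simp, simp,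
          use s7 w in simp, rule lw_not3,
          rule exec_Bind, rule exec_mvg, simp, simp, simp,
          rule exec_Bind, rule exec_in[OF mem], use Cons.prems in \<open>simp add: fun_eq_iff\<close>,
          simp only: True if_True one_neq_zero if_False,
          rule exec_Bind, rule exec_clr, simp, rule exec_Ret)
        (use Cons.prems M len True in \<open>auto simp: fun_eq_iff List.insert_def\<close>)
  next
    case False
    show ?thesis unfolding dedup_body_def
      by (rule exec_conv, rule exec_popB, simp, simp add: s7 split del: if_split, rule exec_pushB, simp,
          simp only: fun_upd_upd fun_upd_same list.sel(3) s7',
          rule exec_Bind, rule exec_take_word[of _ _ _ s "lw l" "lits L"], simp, simp, simp, simp, simp, simp,
          use s7 w in simp, rule lw_not3,
          rule exec_Bind, rule exec_mvg, simp, simp, simp,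
          rule exec_Bind, rule exec_in[OF mem], use Cons.prems in \<open>simp add: fun_eq_iff\<close>,
          simp only: False simp_thms if_True if_False, rule exec_pushB, simp,
          rule exec_Bind, rule exec_mvg, simp, simp, simp, rule exec_Bind, rule exec_mvg, simp, simp, simp, rule exec_Ret)
        (use Cons.prems M len False in \<open>auto simp: fun_eq_iff List.insert_def\<close>)
  qed
  have "length (lits ?P) + length (lits L) + 1 < M"
    using Cons.prems(3) by (auto simp: List.insert_def)
  then have 2: "exec (Loop dedup_body 0) ?s ((length L + 1) * (200 * M ^ 2)) 0
      (?s(7 := [], 20 := rev (lits L) @ ?s 20, 8 := lits (fold List.insert L ?P)))"
    by (intro Cons.IH) (use Cons.prems in auto)
  have "190 * M ^ 2 + 1 \<le> 200 * M ^ 2" using M by linarith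
  then show ?case
    by (intro exec_conv[OF exec_Loop_cont[OF 1 2]]) (auto simp: fun_eq_iff)
qed

text \<open>Leaving out the bars between clauses turns the formula into the list of all its literal
  occurrences.\<close>

definition prep_body :: "nat \<Rightarrow> prog" where
  "prep_body e = Bind (pop 4) (\<lambda>r. if r = 0 then Ret 0 else push 5 (r - 1) ;; push 18 (r - 1) ;;
     (if r = 5 then Ret 1 else push 14 (r - 1) ;; Ret 1))"

lemma exec_prep_loop:
  "s 4 = us \<Longrightarrow> exec (Loop prep_body e) s (20 * length us + 20) 0
      (s(4 := [], 5 := rev us @ s 5, 18 := rev us @ s 18, 14 := filter (\<lambda>v. v \<noteq> 4) (rev us) @ s 14))"
proof (induction us arbitrary: s e)
  case Nil
  have "exec (prep_body e) s 4 (2 * 0) s" unfolding prep_body_def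
    by (rule exec_conv, rule exec_popB, simp, simp add: Nil, rule exec_Ret)
      (use Nil in \<open>auto simp: fun_eq_iff\<close>)
  from exec_Loop_exit[where f="prep_body", OF this] show ?case
    by (rule exec_conv) (use Nil in \<open>auto simp: fun_eq_iff\<close>)
next
  case (Cons u us)
  let ?s = "s(4 := us, 5 := u # s 5, 18 := u # s 18, 14 := (if u = 4 then s 14 else u # s 14))"
  have 1: "exec (prep_body e) s 8 (2 * 0 + 1) ?s"
  proof (cases "u = 4")
    case True
    show ?thesis unfolding prep_body_def
      by (rule exec_conv, rule exec_popB, simp, simp add: Cons.prems split del: if_split, rule exec_pushB, simp,
          rule exec_pushB, simp, simp only: True if_True numeral_eq_iff semiring_norm simp_thms, simp, rule exec_Ret)
        (use True in \<open>auto simp: fun_eq_iff\<close>)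
  next
    case False
    show ?thesis unfolding prep_body_def
      by (rule exec_conv, rule exec_popB, simp, simp add: Cons.prems False split del: if_split, rule exec_pushB, simp,
          rule exec_pushB, simp, simp add: False, rule exec_pushB, simp, rule exec_Ret)
        (use False in \<open>auto simp: fun_eq_iff\<close>)
  qed
  have 2: "exec (Loop prep_body 0) ?s (20 * length us + 20) 0
      (?s(4 := [], 5 := rev us @ ?s 5, 18 := rev us @ ?s 18, 14 := filter (\<lambda>v. v \<noteq> 4) (rev us) @ ?s 14))"
    by (rule Cons.IH) simp
  show ?case
    by (rule exec_conv[OF exec_Loop_cont[OF 1 2]]) (auto simp: fun_eq_iff)
qed

section \<open>The complete program and its cost\<close>

definition dup_prog :: prog where
  "dup_prog = mv 4 5 ;; mv2 5 1 4"

definition solve_prog :: prog where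
  "solve_prog = Loop prep_body 0 ;; Loop dedup_body 0 ;; mv 8 16 ;; mv 16 17 ;; Loop enum_body 0"

text \<open>A simulated machine consumes its input, so \<open>G\<close> is duplicated before the
  decider and again before the second transducer. The move from 6 to 7 reverses the output, since
  the words are then read from their first symbol.\<close>

definition main_prog :: "tm \<Rightarrow> tm \<Rightarrow> tm \<Rightarrow> prog" where
  "main_prog M1 MA M2 = run_transducer M1 1 4 ;; dup_prog ;; Bind (run_decider MA 1) (\<lambda>v. if v = 0 then Ret 0
     else dup_prog ;; run_transducer M2 1 6 ;; mv 6 7 ;; solve_prog)"

lemma wf_prog_main:
  assumes "dtm M1" "dtm MA" "dtm M2"
  shows "\<exists>B K. wf_prog B K (main_prog M1 MA M2) \<and> 6 \<le> B \<and> 2 \<le> K"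
proof -
  \<comment> \<open>\<open>b M\<close> exceeds all states and symbols of \<open>M\<close> in the
    doubled form used by \<open>sim_body\<close>; the summand 20 below covers the fixed constants,
    and the registers 0 to 20 give 21 tracks.\<close>
  define b where "b M = (\<Sum>(q, a, q', b, d)\<in>M. 2 * q' + 2 * b + 3)" for M :: tm
  have b: "\<forall>(q, a, q', y, d)\<in>M. 2 * q' + 1 < b M \<and> 2 * y + 2 < b M" if "dtm M" for M
  proof -
    have f: "finite M" using that unfolding dtm_def ntm_def by blast
    have "(case x of (q, a, q', y, d) \<Rightarrow> 2 * q' + 2 * y + 3) \<le> b M" if "x \<in> M" for x
      unfolding b_def by (rule member_le_sum[OF that _ f]) simp
    then show ?thesis by fastforce
  qed
  let ?B = "20 + b M1 + b MA + b M2"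
  have sim: "wf_prog ?B 21 (Loop (sim_body M1) 0)" "wf_prog ?B 21 (Loop (sim_body MA) 0)" "wf_prog ?B 21 (Loop (sim_body M2) 0)"
    using b[OF assms(1)] b[OF assms(2)] b[OF assms(3)] by (intro wf_prog_sim; fastforce)+
  have 1: "wf_prog ?B 21 (run_transducer M1 1 4)" "wf_prog ?B 21 (run_transducer M2 1 6)" "wf_prog ?B 21 (run_decider MA 1)"
    unfolding run_transducer_def run_decider_def using sim by simp_all
  have mem: "wf_prog ?B 21 mem_word"
    by (auto simp: mem_word_def mem_body_def cmp_word_def cmp_body_def)
  have conf: "wf_prog ?B 21 conf_prog"
    using mem by (auto simp: conf_prog_def clause_body_def lit_body_def)
  have round: "wf_prog ?B 21 round_prog"
    using conf by (auto simp: round_prog_def prop_body_def)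
  have check: "wf_prog ?B 21 check_prog"
    using conf round by (auto simp: check_prog_def rounds_body_def)
  have inc: "wf_prog ?B 21 inc_prog"
    by (auto simp: inc_prog_def inc_body_def)
  have "wf_prog ?B 21 solve_prog"
    using check inc mem by (auto simp: solve_prog_def prep_body_def dedup_body_def enum_body_def)
  then have "wf_prog ?B 21 (main_prog M1 MA M2)"
    using 1 by (auto simp: main_prog_def dup_prog_def)
  then show ?thesis by (intro exI[of _ ?B] exI[of _ "21::nat"]) auto
qed

lemma filter_enc: "filter (\<lambda>v. v \<noteq> 4) (map sym_rank (enc_cnf cs)) = lits (concat cs)"
proof -
  have 1: "filter (\<lambda>v. v \<noteq> 4) (lits C) = lits C" for C
  proof (induction C)
    case (Cons l C)
    have "filter (\<lambda>v. v \<noteq> 4) (lw l) = lw l"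
      using okw_lw[of l] by (auto simp: okw_def filter_id_conv)
    then show ?case using Cons by simp
  qed simp
  have "filter (\<lambda>v. v \<noteq> 4) (gl (map (map lw) cs)) = lits (concat cs)"
    by (induction cs) (simp_all add: 1)
  then show ?thesis by (simp only: gl_enc)
qed

text \<open>A positive literal has no sign, so the code of a variable list is at once the code of
  the all-\<open>True\<close> assignment, the counter value 0.\<close>

lemma enc_vars_lits: "map sym_rank (enc_vars xs) = lits (map (\<lambda>x. (x, True)) xs)"
  by (induction xs) (auto simp: enc_vars_def lw_def enc_lit_def)

lemma fold_insert_props:
  "set (fold List.insert L P) = set L \<union> set P"
  "distinct P \<Longrightarrow> distinct (fold List.insert L P)"
  "length (lits (fold List.insert L P)) \<le> length (lits L) + length (lits P)"
proof -
  show "set (fold List.insert L P) = set L \<union> set P"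
    by (induction L arbitrary: P) auto
  show "distinct P \<Longrightarrow> distinct (fold List.insert L P)"
    by (induction L arbitrary: P) auto
  show "length (lits (fold List.insert L P)) \<le> length (lits L) + length (lits P)"
  proof (induction L arbitrary: P)
    case (Cons l L)
    have "length (lits (List.insert l P)) \<le> length (lw l) + 1 + length (lits P)"
      by (simp add: List.insert_def)
    then show ?case using Cons[of "List.insert l P"] by simp
  qed simp
qed

text \<open>A negation adds one symbol to a word, and there are no more words than symbols.\<close>

lemma length_lits_signs:
  "map fst D' = map fst D \<Longrightarrow> \<forall>l\<in>set D. snd l \<Longrightarrow> length (lits D') \<le> 2 * length (lits D)"
proof (induction D arbitrary: D')
  case (Cons l D)
  then obtain l' E where D': "D' = l' # E" "fst l' = fst l" "map fst E = map fst D" by (cases D') auto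
  obtain x where l: "l = (x, True)" using Cons.prems(2) by (cases l) auto
  have "length (lw l') \<le> length (lw l) + 1" using D'(2) l by (cases l'; cases "snd l'") (auto simp: lw_False)
  then show ?case using Cons.IH[of E] Cons.prems D' by simp
qed simp

lemma val_True: "\<forall>l\<in>set D. snd l \<Longrightarrow> val D = 0"
  by (induction D rule: val.induct) auto

definition dedup_vars :: "nat list \<Rightarrow> lit list" where
  "dedup_vars xs = fold List.insert (map (\<lambda>x. (x, True)) xs) []"

lemma dedup_vars:
  "set (map fst (dedup_vars xs)) = set xs" "distinct (map fst (dedup_vars xs))"
  "\<forall>l\<in>set (dedup_vars xs). snd l" "length (lits (dedup_vars xs)) \<le> length (enc_vars xs)"
  "length (dedup_vars xs) = card (set xs)"
proof -
  have s: "set (dedup_vars xs) = (\<lambda>x. (x, True)) ` set xs"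
    using fold_insert_props(1) by (auto simp: dedup_vars_def)
  then show 1: "set (map fst (dedup_vars xs)) = set xs" by (auto simp: image_iff)
  have "distinct (dedup_vars xs)" unfolding dedup_vars_def by (rule fold_insert_props(2)) simp
  moreover have "inj_on fst (set (dedup_vars xs))" unfolding s by (auto simp: inj_on_def)
  ultimately show 2: "distinct (map fst (dedup_vars xs))" by (simp add: distinct_map)
  show "\<forall>l\<in>set (dedup_vars xs). snd l" using s by auto
  show "length (lits (dedup_vars xs)) \<le> length (enc_vars xs)"
    using fold_insert_props(3)[of "map (\<lambda>x. (x, True)) xs" "[]"] arg_cong[OF enc_vars_lits[of xs], of length]
    by (simp add: dedup_vars_def)
  show "length (dedup_vars xs) = card (set xs)" using distinct_card[OF 2] 1 by simp
qed

text \<open>\<open>M\<close> is quadratic in \<open>N\<close> because each round may add a copy of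
  every literal occurrence, so the list of true literals can reach about \<open>N * N\<close>
  symbols.\<close>

lemma exec_solve:
  assumes N: "length (enc_cnf cs) < N" "length (enc_vars xs) < N"
  defines "M \<equiv> 10 * N ^ 2"
  shows "\<exists>s'. exec solve_prog ((\<lambda>_. [])(4 := rev (map sym_rank (enc_cnf cs)), 7 := map sym_rank (enc_vars xs)))
     (2 ^ card (set xs) * (1500 * M ^ 6))
     (if \<exists>D. map fst D = map fst (dedup_vars xs) \<and> \<not> conf cs ((up_round cs ^^ length (enc_cnf cs)) D) then 1 else 0) s'"
proof -
  let ?D = "dedup_vars xs"
  let ?g = "map sym_rank (enc_cnf cs)"
  let ?L = "map (\<lambda>x. (x, True)) xs"
  let ?sa = "(\<lambda>_. [])(5 := ?g, 18 := ?g, 14 := lits (concat cs), 7 := lits ?L)"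
  let ?sb = "(\<lambda>_. [])(5 := ?g, 18 := ?g, 14 := lits (concat cs), 20 := rev (lits ?L), 8 := lits ?D)"
  let ?sc = "(\<lambda>_. [])(5 := ?g, 18 := ?g, 14 := lits (concat cs), 20 := rev (lits ?L), 17 := lits ?D)"
  have N1: "1 \<le> N" using N by simp
  have N2: "N \<le> N ^ 2" using N1 by (simp add: power2_eq_square)
  have M: "1 \<le> M" "N \<le> M" using N2 N1 by (auto simp: M_def)
  have lx: "length (lits ?L) < N" using N(2) arg_cong[OF enc_vars_lits[of xs], of length] by simp
  have lD: "length (lits ?D) < N" using dedup_vars(4)[of xs] N(2) by linarith
  have lc: "length (lits (concat cs)) < N"
    using arg_cong[OF filter_enc[of cs], of length] N(1) length_filter_le[of "\<lambda>v. v \<noteq> 4" ?g] by simp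
  have 1: "exec (Loop prep_body 0) ((\<lambda>_. [])(4 := rev ?g, 7 := map sym_rank (enc_vars xs)))
      (20 * length (rev ?g) + 20) 0 ?sa"
    by (rule exec_conv[OF exec_prep_loop[where us="rev ?g"]]) (auto simp: fun_eq_iff filter_enc[symmetric] enc_vars_lits)
  have 2: "exec (Loop dedup_body 0) ?sa ((length ?L + 1) * (200 * M ^ 2)) 0 ?sb"
    by (rule exec_conv[OF exec_dedup_loop[where L="?L" and P="[]" and M=M]])
      (use lx M N1 N2 in \<open>auto simp: fun_eq_iff dedup_vars_def M_def\<close>)
  have "env cs ?sc" by (simp add: env_def)
  moreover have "length (lits D') + (length (enc_cnf cs) + 1) * length (lits (concat cs)) + 2 < M"
    if D': "map fst D' = map fst ?D" for D'
  proof -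
    have "length (lits D') \<le> 2 * N" using length_lits_signs[OF D' dedup_vars(3)] lD by linarith
    moreover have "(length (enc_cnf cs) + 1) * length (lits (concat cs)) \<le> N * N"
      by (rule mult_le_mono) (use N(1) lc in auto)
    moreover have "N * N = N ^ 2" by (simp add: power2_eq_square)
    ultimately show ?thesis unfolding M_def using N1 N2 by linarith
  qed
  moreover have "length (enc_cnf cs) < M" using N M by linarith
  ultimately obtain s' where 3: "exec (Loop enum_body 0) ?sc ((2 ^ length ?D - val ?D) * (1100 * M ^ 6))
      (if \<exists>D'. map fst D' = map fst ?D \<and> val ?D \<le> val D' \<and> \<not> conf cs ((up_round cs ^^ length (enc_cnf cs)) D') then 1 else 0) s'"
    using exec_enum[of cs ?sc ?D M 0] by auto
  have v: "val ?D = 0" by (rule val_True[OF dedup_vars(3)])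
  have "length ?L + 1 \<le> M" using length_ls_lits[of ?L] lx M by linarith
  then have "(length ?L + 1) * (200 * M ^ 2) \<le> M * (200 * M ^ 2)" by (rule mult_le_mono1)
  also have "\<dots> = 200 * M ^ 3" using power_Suc[of M 2] by simp
  also have "\<dots> \<le> 200 * M ^ 6" using nat_power_mono[OF M(1), of 3 6] by simp
  finally have t: "(length ?L + 1) * (200 * M ^ 2) \<le> 200 * M ^ 6" .
  have M6: "M \<le> M ^ 6" using nat_power_mono[OF M(1), of 1 6] by simp
  let ?c = "20 * length (rev ?g) + 20 + ((length ?L + 1) * (200 * M ^ 2) + (10 * length (lits ?D) + 10 +
      (10 * length (lits ?D) + 10 + 2 ^ card (set xs) * (1100 * M ^ 6) + 1) + 1) + 1) + 1"
  have "?c \<le> 400 * M ^ 6 + 2 ^ card (set xs) * (1100 * M ^ 6)"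
    using t M6 lD N(1) M(1,2) length_map[of sym_rank "enc_cnf cs"] length_rev[of ?g] by linarith
  also have "\<dots> \<le> 2 ^ card (set xs) * (400 * M ^ 6) + 2 ^ card (set xs) * (1100 * M ^ 6)"
    using mult_le_mono1[of 1 "2 ^ card (set xs)" "400 * M ^ 6"] by simp
  also have "\<dots> = 2 ^ card (set xs) * (1500 * M ^ 6)" by simp
  finally have c: "?c \<le> 2 ^ card (set xs) * (1500 * M ^ 6)" .
  have en: "exec (Loop enum_body 0) ?sc (2 ^ card (set xs) * (1100 * M ^ 6))
      (if \<exists>D'. map fst D' = map fst ?D \<and> \<not> conf cs ((up_round cs ^^ length (enc_cnf cs)) D') then 1 else 0) s'"
    using 3 by (simp add: v dedup_vars(5))
  have m1: "exec (mv 8 16) ?sb (10 * length (lits ?D) + 10) 0 (?sb(8 := [], 16 := rev (lits ?D)))"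
    by (rule exec_conv[OF exec_mvg]) auto
  have m2: "exec (mv 16 17) (?sb(8 := [], 16 := rev (lits ?D))) (10 * length (lits ?D) + 10) 0 ?sc"
    by (rule exec_conv[OF exec_mvg]) (auto simp: fun_eq_iff)
  show ?thesis unfolding solve_prog_def
    by (rule exI, rule exec_mono[OF _ c], rule exec_Bind[OF 1], rule exec_Bind[OF 2], rule exec_Bind[OF m1],
        rule exec_Bind[OF m2], rule en)
qed

definition outputs :: "config \<Rightarrow> sym list \<Rightarrow> bool" where
  "outputs cf u \<longleftrightarrow> map sym_code u = map (\<lambda>i. tape cf (int i)) [0..<length u] \<and> tape cf (int (length u)) = 0"

lemma exec_dup:
  "exec dup_prog ((\<lambda>_. [])(4 := rev g)) (20 * length g + 30) 0 ((\<lambda>_. [])(1 := rev g, 4 := rev g))"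
  unfolding dup_prog_def
  by (rule exec_conv, rule exec_Bind, rule exec_mvg, simp, simp, simp, rule exec_mv2) (auto simp: fun_eq_iff)

lemma exec_main:
  assumes M: "dtm M1" "dtm MA" "dtm M2"
    and 1: "(step M1 ^^ n1) (init w) cf1" "state cf1 = 1" "outputs cf1 G"
    and A: "(step MA ^^ nA) (init G) cfA" "state cfA \<in> {1, 2}"
    and N: "length w + n1 < N" "length G + nA < N"
  shows "state cfA \<noteq> 1 \<Longrightarrow> \<exists>s'. exec (main_prog M1 MA M2) (start w) (1000 * N) 0 s'"
    and "state cfA = 1 \<Longrightarrow> (step M2 ^^ n2) (init G) cf2 \<Longrightarrow> state cf2 = 1 \<Longrightarrow> outputs cf2 (enc_vars xs) \<Longrightarrow>
      G = enc_cnf cs \<Longrightarrow> length G + n2 + length (enc_vars xs) < N \<Longrightarrow>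
      \<exists>s'. exec (main_prog M1 MA M2) (start w) (2 ^ card (set xs) * (4000 * (10 * N ^ 2) ^ 6))
       (if \<exists>D. map fst D = map fst (dedup_vars xs) \<and> \<not> conf cs ((up_round cs ^^ length G) D) then 1 else 0) s'"
proof -
  let ?g = "map sym_rank G"
  let ?sa = "(\<lambda>_. [])(4 := rev ?g)"
  let ?sb = "(\<lambda>_. [])(1 := rev ?g, 4 := rev ?g)"
  have t1: "exec (run_transducer M1 1 4) (start w) (300 * (length w + n1 + 1)) 0 ?sa"
    by (rule exec_conv[OF exec_run_transducer(1)[OF M(1) 1(1,2), of G 1 4]])
      (use 1(3) in \<open>auto simp: outputs_def start_def fun_eq_iff\<close>)
  have d: "exec dup_prog ?sa (20 * length ?g + 30) 0 ?sb" by (rule exec_dup)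
  have tA: "exec (run_decider MA 1) ?sb (300 * (length G + nA + 1)) (if state cfA = 1 then 1 else 0) ?sa"
    by (rule exec_conv[OF exec_run_decider[OF M(2) A, of 1]]) (auto simp: fun_eq_iff)
  show "\<exists>s'. exec (main_prog M1 MA M2) (start w) (1000 * N) 0 s'" if a: "state cfA \<noteq> 1"
    unfolding main_prog_def
    by (rule exI, rule exec_conv, rule exec_Bind[OF t1], rule exec_Bind[OF d], rule exec_Bind[OF tA],
        use a in simp, rule exec_Ret) (use N in auto)
  show "\<exists>s'. exec (main_prog M1 MA M2) (start w) (2 ^ card (set xs) * (4000 * (10 * N ^ 2) ^ 6))
       (if \<exists>D. map fst D = map fst (dedup_vars xs) \<and> \<not> conf cs ((up_round cs ^^ length G) D) then 1 else 0) s'"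
    if a: "state cfA = 1" "(step M2 ^^ n2) (init G) cf2" "state cf2 = 1" "outputs cf2 (enc_vars xs)"
      "G = enc_cnf cs" "length G + n2 + length (enc_vars xs) < N"
  proof -
    let ?x = "map sym_rank (enc_vars xs)"
    let ?sc = "(\<lambda>_. [])(4 := rev ?g, 6 := rev ?x)"
    let ?sd = "(\<lambda>_. [])(4 := rev ?g, 7 := ?x)"
    let ?M = "10 * N ^ 2"
    let ?v = "if \<exists>D. map fst D = map fst (dedup_vars xs) \<and> \<not> conf cs ((up_round cs ^^ length G) D) then 1 else 0 :: nat"
    have t2: "exec (run_transducer M2 1 6) ?sb (300 * (length G + n2 + 1)) 0 ?sc"
      by (rule exec_conv[OF exec_run_transducer(1)[OF M(3) a(2,3), of "enc_vars xs" 1 6]])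
        (use a(4) in \<open>auto simp: outputs_def fun_eq_iff\<close>)
    have mo: "exec (mv 6 7) ?sc (10 * length ?x + 10) 0 ?sd"
      by (rule exec_conv[OF exec_mvg]) (auto simp: fun_eq_iff)
    obtain s' where so: "exec solve_prog ?sd (2 ^ card (set xs) * (1500 * ?M ^ 6)) ?v s'"
      using exec_solve[of cs N xs] a(5,6) by (auto simp del: power_mult_distrib)
    let ?c = "300 * (length w + n1 + 1) + (20 * length ?g + 30 + (300 * (length G + nA + 1) +
        (20 * length ?g + 30 + (300 * (length G + n2 + 1) + (10 * length ?x + 10 +
          2 ^ card (set xs) * (1500 * ?M ^ 6) + 1) + 1) + 1) + 1) + 1) + 1"
    have N1: "1 \<le> N" using N by simp
    have "N \<le> ?M" using N1 by (simp add: power2_eq_square)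
    also have "?M \<le> ?M ^ 6" using nat_power_mono[of ?M 1 6] N1 by simp
    finally have N6: "N \<le> ?M ^ 6" .
    have "300 * (length w + n1 + 1) + (20 * length ?g + 30 + (300 * (length G + nA + 1) +
        (20 * length ?g + 30 + (300 * (length G + n2 + 1) + (10 * length ?x + 10 +
          X + 1) + 1) + 1) + 1) + 1) + 1 \<le> 2000 * N + X" for X
    proof -
      have "length w + n1 + 1 \<le> N" "length G + nA + 1 \<le> N" "length G + n2 + 1 \<le> N" "length G \<le> N"
        "length (enc_vars xs) \<le> N"
        using N a(6) by auto
      then have "300 * (length w + n1 + 1) \<le> 300 * N" "300 * (length G + nA + 1) \<le> 300 * N"
        "300 * (length G + n2 + 1) \<le> 300 * N" "20 * length ?g \<le> 20 * N" "10 * length ?x \<le> 10 * N"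
        unfolding length_map by (simp_all only: mult_le_mono2)
      then show ?thesis using N1 by linarith
    qed
    then have "?c \<le> 2000 * N + 2 ^ card (set xs) * (1500 * ?M ^ 6)" .
    also have "\<dots> \<le> 2 ^ card (set xs) * (2000 * ?M ^ 6) + 2 ^ card (set xs) * (1500 * ?M ^ 6)"
      using mult_le_mono[of 1 "2 ^ card (set xs)" "2000 * N" "2000 * ?M ^ 6"] N6 by simp
    also have "\<dots> = 2 ^ card (set xs) * (3500 * ?M ^ 6)" by (simp del: power_mult_distrib)
    also have "\<dots> \<le> 2 ^ card (set xs) * (4000 * ?M ^ 6)" by (intro mult_le_mono) auto
    finally have c: "?c \<le> 2 ^ card (set xs) * (4000 * ?M ^ 6)" .
    show ?thesis unfolding main_prog_def
      by (rule exI, rule exec_mono[OF _ c], rule exec_Bind[OF t1], rule exec_Bind[OF d], rule exec_Bind[OF tA],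
          simp only: a(1) simp_thms if_True if_False one_neq_zero, rule exec_Bind[OF d], rule exec_Bind[OF t2], rule exec_Bind[OF mo], rule so)
  qed
qed

section \<open>Time bounds\<close>

text \<open>Since the base is at least 2, the factor \<open>c\<close> is at most its
  \<open>c\<close>-th power. Pure powers of \<open>m + 2\<close> are easier to compose along a chain
  of machines than polynomials with coefficients.\<close>

lemma poly_le_power:
  fixes m k c :: nat
  shows "c * m ^ k + c \<le> (m + 2) ^ (k + c + 1)"
proof -
  have "m ^ k \<le> (m + 2) ^ k" by (rule power_mono) auto
  then have "c * m ^ k \<le> c * (m + 2) ^ k" by simp
  moreover have "c \<le> c * (m + 2) ^ k" by simp
  ultimately have "c * m ^ k + c \<le> c * (m + 2) ^ k + c * (m + 2) ^ k" by (rule add_mono)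
  also have "\<dots> = (m + 2) ^ k * (c * 2)" by (simp add: algebra_simps)
  also have "c \<le> 2 ^ c" using less_exp[of c] by simp
  also have "(2::nat) ^ c \<le> (m + 2) ^ c" by (rule power_mono) auto
  finally have "c * m ^ k + c \<le> (m + 2) ^ k * ((m + 2) ^ c * 2)" by simp
  also have "\<dots> \<le> (m + 2) ^ k * ((m + 2) ^ c * (m + 2))" by simp
  also have "\<dots> = (m + 2) ^ (k + c + 1)" by (simp only: power_add power_one_right mult.assoc)
  finally show ?thesis .
qed

text \<open>The definition of \<open>FP\<close> bounds only the running time. The bound on the
  output length comes from the stack simulation, whose lists are linear in the input length plus the
  number of steps.\<close>

lemma FP_machine:
  assumes "f \<in> FP"
  shows "\<exists>M k. dtm M \<and> (\<forall>w. \<exists>n cf. (step M ^^ n) (init w) cf \<and> state cf = 1 \<and> outputs cf (f w) \<and>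
    n \<le> (length w + 2) ^ k \<and> length (f w) \<le> (length w + 2) ^ k)"
proof -
  from assms obtain M k where M: "dtm M" and run: "\<forall>w. \<exists>n cf. (step M ^^ n) (init w) cf \<and> state cf = 1 \<and>
            map sym_code (f w) = map (\<lambda>i. tape cf (int i)) [0..<length (f w)] \<and>
            tape cf (int (length (f w))) = 0 \<and> n \<le> length w ^ k + k"
    unfolding FP_def by blast
  have "\<exists>n cf. (step M ^^ n) (init w) cf \<and> state cf = 1 \<and> outputs cf (f w) \<and>
    n \<le> (length w + 2) ^ (2 * k + 5) \<and> length (f w) \<le> (length w + 2) ^ (2 * k + 5)" for w
  proof -
    let ?q = "length w + 2"
    obtain n cf where n: "(step M ^^ n) (init w) cf" "state cf = 1"
      "map sym_code (f w) = map (\<lambda>i. tape cf (int i)) [0..<length (f w)]"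
      "tape cf (int (length (f w))) = 0" "n \<le> length w ^ k + k"
      using run by blast
    have len: "length (f w) \<le> length w + 2 * n + 3"
      by (rule exec_run_transducer(2)[OF M n(1-4), where s="(\<lambda>_. [])(1 := rev (map sym_rank w))" and i=1 and j=4]) auto
    have "length w ^ k + k \<le> (k + 1) * length w ^ k + (k + 1)" by simp
    \<comment> \<open>The exponent is \<open>k + (k + 1) + 1\<close>, from
      \<open>poly_le_power\<close> with the factor \<open>k + 1\<close>.\<close>
    then have nk: "n \<le> ?q ^ (2 * k + 2)" using n(5) poly_le_power[of "k + 1" "length w" k] by (simp add: mult_2)
    have "?q \<le> ?q ^ (2 * k + 2)" by (rule self_le_power) auto
    moreover have "1 \<le> ?q ^ (2 * k + 2)" by (rule one_le_power) simp
    ultimately have "length (f w) \<le> 4 * ?q ^ (2 * k + 2)" using len nk by linarith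
    also have "\<dots> \<le> ?q ^ 3 * ?q ^ (2 * k + 2)"
    proof (rule mult_le_mono1)
      have "(2::nat) ^ 3 \<le> ?q ^ 3" by (rule power_mono) auto
      then show "4 \<le> ?q ^ 3" by simp
    qed
    also have "\<dots> = ?q ^ (2 * k + 5)" by (simp only: power_add[symmetric]) (simp add: add.commute)
    finally have l: "length (f w) \<le> ?q ^ (2 * k + 5)" .
    have "?q ^ (2 * k + 2) \<le> ?q ^ (2 * k + 5)" by (rule power_increasing) auto
    then have "n \<le> ?q ^ (2 * k + 5)" using nk by linarith
    then show ?thesis using n l unfolding outputs_def by blast
  qed
  then show ?thesis using M by blast
qed

lemma finite_short: "finite {w :: sym list. length w < n}"
proof -
  have "x \<in> {S0, S1, SNeg, SComma, SBar}" for x :: sym by (cases x) auto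
  then have "finite (UNIV :: sym set)" by (intro finite_subset[of UNIV "{S0, S1, SNeg, SComma, SBar}"]) auto
  then have "finite {w :: sym list. set w \<subseteq> UNIV \<and> length w \<le> n}" by (rule finite_lists_length_le)
  then show ?thesis by (rule rev_finite_subset) auto
qed

lemma P_machine:
  assumes "A \<in> Pclass"
  shows "\<exists>M k. dtm M \<and> (\<forall>w. \<exists>n cf. (step M ^^ n) (init w) cf \<and> state cf \<in> {1, 2} \<and>
    (state cf = 1 \<longleftrightarrow> w \<in> A) \<and> n \<le> (length w + 2) ^ k)"
proof -
  from assms obtain k M c n0 where M: "dtm M" and run: "\<forall>w. \<exists>n cf. (step M ^^ n) (init w) cf \<and> state cf \<in> {1, 2} \<and>
            (state cf = 1 \<longleftrightarrow> w \<in> A) \<and> (length w \<ge> n0 \<longrightarrow> real n \<le> c * real (length w) ^ k)"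
    unfolding Pclass_def DTIME_def by blast
  then obtain N where N: "\<And>w. \<exists>cf. (step M ^^ N w) (init w) cf \<and> state cf \<in> {1, 2} \<and>
            (state cf = 1 \<longleftrightarrow> w \<in> A) \<and> (length w \<ge> n0 \<longrightarrow> real (N w) \<le> c * real (length w) ^ k)"
    by metis
  let ?S = "{w :: sym list. length w < n0}"
  \<comment> \<open>The time bound holds only from length \<open>n0\<close> on; the finitely many
    shorter words are covered by adding up their running times.\<close>
  define C where "C = nat \<lceil>\<bar>c\<bar>\<rceil> + (\<Sum>w\<in>?S. N w)"
  have "N w \<le> C * length w ^ k + C" for w
  proof (cases "length w < n0")
    case True
    then have "N w \<le> (\<Sum>w\<in>?S. N w)" using finite_short by (intro member_le_sum) auto
    then show ?thesis by (simp add: C_def)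
  next
    case False
    then have "real (N w) \<le> c * real (length w) ^ k" using N[of w] by auto
    also have "\<dots> \<le> real C * real (length w) ^ k"
    proof (rule mult_right_mono)
      have "c \<le> real (nat \<lceil>\<bar>c\<bar>\<rceil>)" by linarith
      also have "\<dots> \<le> real C" unfolding C_def of_nat_le_iff by (rule le_add1)
      finally show "c \<le> real C" .
    qed simp
    also have "\<dots> = real (C * length w ^ k)" by simp
    finally have "N w \<le> C * length w ^ k" by (simp only: of_nat_le_iff)
    then show ?thesis by simp
  qed
  then have "N w \<le> (length w + 2) ^ (k + C + 1)" for w
    using poly_le_power[of C "length w" k] le_trans by blast
  then show ?thesis using M N by blast
qed

lemma length_concat_enc: "length (concat cs) \<le> length (enc_cnf cs)"
proof -
  have "length C \<le> length (enc_clause C)" for C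
    by (induction C) (auto simp: enc_clause_def)
  then show ?thesis by (induction cs) (auto simp: enc_cnf_def intro: add_mono)
qed

lemma cnf_of_enc:
  assumes "is_formula w"
  obtains cs where "enc_cnf cs = w" "cnf_of w = set (map set cs)"
proof -
  have "\<exists>F cs. enc_cnf cs = w \<and> F = set (map set cs)" using assms by (auto simp: is_formula_def)
  then have "\<exists>cs. enc_cnf cs = w \<and> cnf_of w = set (map set cs)"
    unfolding cnf_of_def by (rule someI_ex)
  then show ?thesis using that by blast
qed

lemma card_vars_le:
  "card (vars (set (map set cs))) \<le> length (enc_cnf cs)"
proof -
  have "vars (set (map set cs)) = fst ` set (concat cs)" by (auto simp: vars_def)
  then have "card (vars (set (map set cs))) \<le> length (concat cs)"
    using card_image_le[of "set (concat cs)" fst] card_length[of "concat cs"] by simp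
  then show ?thesis using length_concat_enc[of cs] by linarith
qed

text \<open>The logarithm of the left side is of order \<open>n powr (\<epsilon> / 2)\<close>, up to
  a term logarithmic in \<open>n\<close>, and hence of lower order than
  \<open>n powr \<epsilon>\<close>.\<close>

lemma subexponential_bound:
  fixes C \<epsilon> :: real and e c :: nat
  assumes "0 < \<epsilon>" "0 < C"
  shows "\<forall>\<^sub>F n in sequentially. real c * (real n + 2) ^ e * 2 powr (C * (real n + 2) powr (\<epsilon> / 2) + C) \<le> 2 powr (real n powr \<epsilon>)"
  using assms by real_asymp

text \<open>\<open>m\<close> stands for the number of variables of a formula, polynomial in the
  input length \<open>n\<close>. A root of order above \<open>e / \<epsilon>\<close> outweighs the
  exponent \<open>e\<close>. Monotonicity of \<open>r\<close> is not assumed, so the bound covers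
  every \<open>m\<close> up to the power.\<close>

lemma backdoor_size_bound:
  fixes \<epsilon> :: real and r :: "nat \<Rightarrow> nat" and e :: nat
  assumes a: "\<forall>k::nat. k \<ge> 1 \<longrightarrow> (\<lambda>n. real (r n)) \<in> O(\<lambda>n. real n powr (1 / real k))" and \<epsilon>: "0 < \<epsilon>"
  shows "\<exists>C>0. \<forall>n m. m \<le> (n + 2) ^ e \<longrightarrow> real (r m) \<le> C * (real n + 2) powr \<epsilon> + C"
proof -
  obtain j :: nat where j: "real e / \<epsilon> < real j" using reals_Archimedean2 by blast
  let ?j = "Suc j"
  have ej: "real e / real ?j \<le> \<epsilon>" using j \<epsilon> by (simp add: field_simps)
  obtain c where c: "0 < c" "\<forall>\<^sub>F n in sequentially. norm (real (r n)) \<le> c * norm (real n powr (1 / real ?j))"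
    using landau_o.bigE[OF a[rule_format, of ?j]] by auto
  then obtain n0 where n0: "\<And>n. n0 \<le> n \<Longrightarrow> real (r n) \<le> c * real n powr (1 / real ?j)"
    unfolding eventually_sequentially by auto
  \<comment> \<open>The asymptotic bound is valid only from \<open>n0\<close> on; adding the
    finitely many earlier values of \<open>r\<close> makes it valid everywhere.\<close>
  let ?C = "c + (\<Sum>i<n0. real (r i))"
  have s: "0 \<le> (\<Sum>i<n0. real (r i))" by (rule sum_nonneg) simp
  have "real (r m) \<le> ?C * (real n + 2) powr \<epsilon> + ?C" if m: "m \<le> (n + 2) ^ e" for n m
  proof (cases "m < n0")
    case True
    then have "real (r m) \<le> (\<Sum>i<n0. real (r i))" by (intro member_le_sum) auto
    moreover have "0 \<le> ?C * (real n + 2) powr \<epsilon>" using s c(1) by (intro mult_nonneg_nonneg) auto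
    ultimately show ?thesis using c(1) by linarith
  next
    case False
    then have "real (r m) \<le> c * real m powr (1 / real ?j)" using n0 by simp
    also have "\<dots> \<le> c * ((real n + 2) ^ e) powr (1 / real ?j)"
    proof (intro mult_left_mono powr_mono2)
      show "real m \<le> (real n + 2) ^ e" using m by (metis of_nat_add of_nat_le_iff of_nat_numeral of_nat_power)
    qed (use c(1) in auto)
    also have "((real n + 2) ^ e) powr (1 / real ?j) = (real n + 2) powr (real e / real ?j)"
      by (simp add: powr_realpow[symmetric] powr_powr)
    also have "c * \<dots> \<le> c * (real n + 2) powr \<epsilon>"
      using c(1) ej by (intro mult_left_mono powr_mono) auto
    also have "\<dots> \<le> ?C * (real n + 2) powr \<epsilon>" using s by (intro mult_right_mono) auto
    finally show ?thesis using s c(1) by linarith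
  qed
  then show ?thesis using s c(1) by (intro exI[of _ ?C]) auto
qed

lemma steps_bound:
  fixes T w n :: nat
  assumes "n \<le> 2 + T * (30 * (w + T + 1))" "w + 1 \<le> T"
  shows "n \<le> 62 * T ^ 2"
proof -
  have "T * (30 * (w + T + 1)) \<le> T * (30 * (T + T))" using assms(2) by (intro mult_le_mono) auto
  also have "\<dots> = 60 * T ^ 2" by (simp add: power2_eq_square)
  finally have "n \<le> 2 + 60 * T ^ 2" using assms(1) by linarith
  moreover have "1 \<le> T ^ 2" using assms(2) by simp
  ultimately show ?thesis by linarith
qed

theorem theorem2:
  fixes r :: "sym list \<Rightarrow> nat" and A :: "sym list set"
  assumes r_poly: "r \<in> FP_nat"
    and a: "\<forall>k::nat. k \<ge> 1 \<longrightarrow>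
              (\<lambda>n. real (r (zeros n))) \<in> O(\<lambda>n. real n powr (1 / real k))"
    and A_formulas: "A \<subseteq> {w. is_formula w}"
    and b1: "A \<in> Pclass"
    and b2: "NP_complete (A \<inter> SAT)"
    and c: "\<forall>G\<in>A. \<exists>S. strong_backdoor_up (cnf_of G) S \<and>
              card S \<le> r (zeros (card (vars (cnf_of G))))"
    and d: "\<exists>f\<in>FP. \<forall>G\<in>A. \<exists>xs. f G = enc_vars xs \<and>
              strong_backdoor_up (cnf_of G) (set xs) \<and>
              card (set xs) \<le> r (zeros (card (vars (cnf_of G))))"
  shows "\<forall>\<epsilon>::real. \<epsilon> > 0 \<longrightarrow> NPclass \<subseteq> DTIME (\<lambda>n. 2 powr (real n powr \<epsilon>))"
proof (intro allI impI subsetI)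
  fix \<epsilon> :: real and L assume \<epsilon>: "\<epsilon> > 0" and L: "L \<in> NPclass"
  obtain f1 where f1: "f1 \<in> FP" "\<And>w. w \<in> L \<longleftrightarrow> f1 w \<in> A \<inter> SAT"
    using b2 L unfolding NP_complete_def pm_reduces_def by blast
  obtain f2 where f2: "f2 \<in> FP" "\<forall>G\<in>A. \<exists>xs. f2 G = enc_vars xs \<and>
              strong_backdoor_up (cnf_of G) (set xs) \<and>
              card (set xs) \<le> r (zeros (card (vars (cnf_of G))))"
    using d by blast
  obtain M1 k1 where M1: "dtm M1" "\<forall>w. \<exists>n cf. (step M1 ^^ n) (init w) cf \<and> state cf = 1 \<and> outputs cf (f1 w) \<and>
    n \<le> (length w + 2) ^ k1 \<and> length (f1 w) \<le> (length w + 2) ^ k1"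
    using FP_machine[OF f1(1)] by blast
  obtain M2 k2 where M2: "dtm M2" "\<forall>w. \<exists>n cf. (step M2 ^^ n) (init w) cf \<and> state cf = 1 \<and> outputs cf (f2 w) \<and>
    n \<le> (length w + 2) ^ k2 \<and> length (f2 w) \<le> (length w + 2) ^ k2"
    using FP_machine[OF f2(1)] by blast
  obtain MA kA where MA: "dtm MA" "\<forall>w. \<exists>n cf. (step MA ^^ n) (init w) cf \<and> state cf \<in> {1, 2} \<and>
    (state cf = 1 \<longleftrightarrow> w \<in> A) \<and> n \<le> (length w + 2) ^ kA"
    using P_machine[OF b1] by blast
  obtain B K where BK: "wf_prog B K (main_prog M1 MA M2)" "6 \<le> B" "2 \<le> K"
    using wf_prog_main[OF M1(1) MA(1) M2(1)] by blast
  obtain M where M: "dtm M" "\<forall>w t v s'. exec (main_prog M1 MA M2) (start w) t v s' \<longrightarrow> v \<in> {0, 1} \<longrightarrow>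
    (\<exists>n cf. (step M ^^ n) (init w) cf \<and> state cf = (if v = 1 then 1 else 2) \<and>
        n \<le> 2 + t * (30 * (length w + t + 1)))"
    using prog_machine[OF BK] by blast
  \<comment> \<open>\<open>length G + 2\<close> is at most \<open>(length w + 2) ^ (k1 + 2)\<close>,
    and \<open>MA\<close> and \<open>M2\<close> run on \<open>G\<close> with exponents
    \<open>kA\<close> and \<open>k2\<close>; \<open>E\<close> dominates all exponents that
    result.\<close>
  define E where "E = (k1 + 2) * (kA + k2 + 1)"
  \<comment> \<open>Half of \<epsilon> is kept in reserve for the polynomial factors and for
    squaring the number of assignments.\<close>
  obtain C where C: "0 < C" "\<And>n m. m \<le> (n + 2) ^ k1 \<Longrightarrow> real (r (zeros m)) \<le> C * (real n + 2) powr (\<epsilon> / 2) + C"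
    using backdoor_size_bound[where r="\<lambda>n. r (zeros n)", OF a, of "\<epsilon> / 2" k1] \<epsilon> by auto
  \<comment> \<open>The constant of \<open>steps_bound\<close> times the square of the numerals in
    \<open>4000 * (10 * N ^ 2) ^ 6\<close>; the power \<open>N ^ 12\<close> contained there is
    squared too, hence the exponent \<open>24 * (E + 3)\<close> below.\<close>
  define c0 :: nat where "c0 = 62 * (4000 * 10 ^ 6) ^ 2"
  \<comment> \<open>\<open>k\<close> will be the size of the computed backdoor, or 0 if the
    reduction leads outside \<open>A\<close>.\<close>
  have main: "\<exists>n cf k. (step M ^^ n) (init w) cf \<and> state cf \<in> {1, 2} \<and> (state cf = 1 \<longleftrightarrow> w \<in> L) \<and>
      n \<le> c0 * (length w + 2) ^ (24 * (E + 3)) * 4 ^ k \<and> real k \<le> C * (real (length w) + 2) powr (\<epsilon> / 2) + C" for w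
  proof -
    let ?q = "length w + 2"
    \<comment> \<open>The additional factor \<open>?q ^ 3\<close> is at least 8, so \<open>N\<close>
      exceeds sums of a few terms of size \<open>?q ^ E\<close>.\<close>
    define N where "N = ?q ^ (E + 3)"
    define G where "G = f1 w"
    obtain n1 cf1 where 1: "(step M1 ^^ n1) (init w) cf1" "state cf1 = 1" "outputs cf1 G"
      "n1 \<le> ?q ^ k1" "length G \<le> ?q ^ k1"
      using M1(2) unfolding G_def by blast
    obtain nA cfA where nA: "(step MA ^^ nA) (init G) cfA" "state cfA \<in> {1, 2}"
      "state cfA = 1 \<longleftrightarrow> G \<in> A" "nA \<le> (length G + 2) ^ kA"
      using MA(2) by blast
    obtain n2 cf2 where 2: "(step M2 ^^ n2) (init G) cf2" "state cf2 = 1" "outputs cf2 (f2 G)"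
      "n2 \<le> (length G + 2) ^ k2" "length (f2 G) \<le> (length G + 2) ^ k2"
      using M2(2) by blast
    have pw: "?q ^ i \<le> ?q ^ j" if "i \<le> j" for i j using that by (intro power_increasing) auto
    have "length G + 2 \<le> ?q ^ (k1 + 2)"
    proof -
      have "length G + 2 \<le> 1 * ?q ^ k1 + 2 * ?q ^ k1" using 1(5) one_le_power[of ?q k1] by linarith
      also have "\<dots> \<le> 4 * ?q ^ k1" by simp
      also have "\<dots> \<le> ?q ^ 2 * ?q ^ k1"
      proof (rule mult_le_mono1)
        have "(2::nat) ^ 2 \<le> ?q ^ 2" by (rule power_mono) auto
        then show "4 \<le> ?q ^ 2" by simp
      qed
      also have "\<dots> = ?q ^ (k1 + 2)" by (simp only: power_add mult.commute)
      finally show ?thesis .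
    qed
    then have gp: "(length G + 2) ^ k \<le> ?q ^ E" if "k \<le> kA + k2 + 1" for k
    proof -
      have "(length G + 2) ^ k \<le> (?q ^ (k1 + 2)) ^ k" using \<open>length G + 2 \<le> _\<close> by (rule power_mono) simp
      also have "\<dots> = ?q ^ ((k1 + 2) * k)" by (simp only: power_mult)
      also have "\<dots> \<le> ?q ^ E" unfolding E_def using that by (intro pw mult_le_mono) auto
      finally show ?thesis .
    qed
    have "?q ^ k1 \<le> ?q ^ E" unfolding E_def by (intro pw) simp
    then have b: "n1 \<le> ?q ^ E" "length G \<le> ?q ^ E" using 1(4,5) by linarith+
    have b2: "nA \<le> ?q ^ E" "n2 \<le> ?q ^ E" "length (f2 G) \<le> ?q ^ E"
      using nA(4) 2(4,5) gp[of kA] gp[of k2] by linarith+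
    have "?q ^ 1 \<le> ?q ^ E" unfolding E_def by (intro pw) simp
    then have b3: "length w + 2 \<le> ?q ^ E" by simp
    have "(2::nat) ^ 3 \<le> ?q ^ 3" by (rule power_mono) auto
    then have "8 * ?q ^ E \<le> ?q ^ 3 * ?q ^ E" by (intro mult_le_mono1) simp
    also have "\<dots> = N" unfolding N_def by (simp only: power_add mult.commute)
    finally have N8: "8 * ?q ^ E \<le> N" .
    have N: "length w + n1 < N" "length G + nA < N" "length G + n2 + length (f2 G) < N" "length w + 1 \<le> N"
      using b b2 b3 N8 by linarith+
    then have N1: "1 \<le> N" by linarith
    have M6: "4000 * (10 * N ^ 2) ^ 6 = 4000 * 10 ^ 6 * N ^ 12"
      by (simp add: power_mult_distrib power_mult[symmetric])
    have bound: "n \<le> c0 * ?q ^ (24 * (E + 3)) * 4 ^ k"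
      if "n \<le> 2 + t * (30 * (length w + t + 1))" "t \<le> 2 ^ k * (4000 * (10 * N ^ 2) ^ 6)" for n t k
    proof -
      let ?T = "2 ^ k * (4000 * 10 ^ 6 * N ^ 12)"
      have t: "t \<le> ?T" using that(2) unfolding M6 .
      have "n \<le> 2 + ?T * (30 * (length w + ?T + 1))"
        by (rule le_trans[OF that(1)]) (intro add_left_mono mult_le_mono add_le_mono le_refl t)
      moreover have "length w + 1 \<le> ?T"
      proof -
        have "N \<le> N ^ 12" using nat_power_mono[OF N1, of 1 12] by simp
        also have "1 * N ^ 12 \<le> 2 ^ k * (4000 * 10 ^ 6 * N ^ 12)" by (rule mult_le_mono) auto
        finally show ?thesis using N(4) by simp
      qed
      ultimately have "n \<le> 62 * ?T ^ 2" by (rule steps_bound)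
      also have "\<dots> = c0 * (N ^ 12) ^ 2 * (2 ^ k) ^ 2" unfolding c0_def by (simp only: power_mult_distrib ac_simps)
      also have "(N ^ 12) ^ 2 = ?q ^ (24 * (E + 3))" unfolding N_def by (simp only: power_mult[symmetric]) (simp add: algebra_simps)
      also have "((2::nat) ^ k) ^ 2 = (2 ^ 2) ^ k" by (simp only: power_mult[symmetric] mult.commute)
      also have "(2::nat) ^ 2 = 4" by simp
      finally show ?thesis .
    qed
    show ?thesis
    proof (cases "G \<in> A")
      case False
      then have "state cfA \<noteq> 1" using nA(3) by simp
      then obtain s' where exec: "exec (main_prog M1 MA M2) (start w) (1000 * N) 0 s'"
        using exec_main(1)[OF M1(1) MA(1) M2(1) 1(1-3) nA(1,2) N(1,2)] by blast
      then obtain n cf where n: "(step M ^^ n) (init w) cf" "state cf = 2"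
        "n \<le> 2 + (1000 * N) * (30 * (length w + (1000 * N) + 1))"
        using M(2)[rule_format, OF exec] by auto
      have "1000 * N \<le> 2 ^ 0 * (4000 * (10 * N ^ 2) ^ 6)"
      proof -
        have "N \<le> N ^ 12" using nat_power_mono[OF N1, of 1 12] by simp
        then show ?thesis unfolding M6 by simp
      qed
      from bound[OF n(3) this] have "n \<le> c0 * ?q ^ (24 * (E + 3)) * 4 ^ 0" .
      moreover have "w \<notin> L" using f1(2)[of w] False by (simp add: G_def)
      moreover have "real 0 \<le> C * (real (length w) + 2) powr (\<epsilon> / 2) + C" using C(1) by simp
      ultimately show ?thesis using n(1,2) by (intro exI[of _ n] exI[of _ cf] exI[of _ "0::nat"]) simp
    next
      case True
      obtain xs where xs: "f2 G = enc_vars xs" "strong_backdoor_up (cnf_of G) (set xs)"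
        "card (set xs) \<le> r (zeros (card (vars (cnf_of G))))"
        using f2(2) True by blast
      have "is_formula G" using A_formulas True by blast
      then obtain cs where cs: "enc_cnf cs = G" "cnf_of G = set (map set cs)" by (rule cnf_of_enc)
      \<comment> \<open>\<open>length G\<close> rounds suffice, as a formula is at least as long as
        its number of literal occurrences.\<close>
      let ?ok = "\<exists>D. map fst D = map fst (dedup_vars xs) \<and> \<not> conf cs ((up_round cs ^^ length G) D)"
      have "satisfiable (cnf_of G) \<longleftrightarrow> ?ok"
        unfolding cs(2)
        by (rule backdoor_rounds) (use xs(2) cs dedup_vars(1,2)[of xs] length_concat_enc[of cs] in auto)
      then have wL: "w \<in> L \<longleftrightarrow> ?ok"
        using f1(2)[of w] True \<open>is_formula G\<close> unfolding G_def[symmetric] by (simp add: SAT_def)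
      have st: "state cfA = 1" using True nA(3) by simp
      obtain s' where exec: "exec (main_prog M1 MA M2) (start w) (2 ^ card (set xs) * (4000 * (10 * N ^ 2) ^ 6))
         (if ?ok then 1 else 0) s'"
        using exec_main(2)[OF M1(1) MA(1) M2(1) 1(1-3) nA(1,2) N(1,2) st 2(1,2), of xs cs] 2(3) N(3) xs(1) cs(1)
        by (auto simp del: power_mult_distrib)
      then obtain n cf where n: "(step M ^^ n) (init w) cf" "state cf = (if ?ok then 1 else 2)"
        "n \<le> 2 + (2 ^ card (set xs) * (4000 * (10 * N ^ 2) ^ 6)) * (30 * (length w + (2 ^ card (set xs) * (4000 * (10 * N ^ 2) ^ 6)) + 1))"
        using M(2)[rule_format, OF exec] by (cases ?ok) auto
      have "n \<le> c0 * ?q ^ (24 * (E + 3)) * 4 ^ card (set xs)" by (rule bound[OF n(3) le_refl])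
      moreover have "real (card (set xs)) \<le> C * (real (length w) + 2) powr (\<epsilon> / 2) + C"
      proof -
        have "card (vars (cnf_of G)) \<le> ?q ^ k1"
          using card_vars_le[of cs] 1(5) unfolding cs by linarith
        from C(2)[OF this] show ?thesis using xs(3) by linarith
      qed
      moreover have "state cf \<in> {1, 2}" "state cf = 1 \<longleftrightarrow> w \<in> L" using n(2) wL by auto
      ultimately show ?thesis using n(1) by blast
    qed
  qed
  \<comment> \<open>The constant is \<open>2 * C\<close> because \<open>4 ^ k\<close> equals
    \<open>2 powr (2 * real k)\<close>.\<close>
  obtain n0 where n0: "\<And>n. n0 \<le> n \<Longrightarrow> real c0 * (real n + 2) ^ (24 * (E + 3)) *
      2 powr (2 * C * (real n + 2) powr (\<epsilon> / 2) + 2 * C) \<le> 2 powr (real n powr \<epsilon>)"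
    using subexponential_bound[OF \<epsilon>, of "2 * C" c0 "24 * (E + 3)"] C(1)
    unfolding eventually_sequentially by auto
  have "\<exists>n cf. (step M ^^ n) (init w) cf \<and> state cf \<in> {1, 2} \<and> (state cf = 1 \<longleftrightarrow> w \<in> L) \<and>
      (n0 \<le> length w \<longrightarrow> real n \<le> 1 * 2 powr (real (length w) powr \<epsilon>))" for w
  proof -
    obtain n cf k where n: "(step M ^^ n) (init w) cf" "state cf \<in> {1, 2}" "state cf = 1 \<longleftrightarrow> w \<in> L"
      "n \<le> c0 * (length w + 2) ^ (24 * (E + 3)) * 4 ^ k" "real k \<le> C * (real (length w) + 2) powr (\<epsilon> / 2) + C"
      using main[of w] by blast
    have "real n \<le> real (c0 * (length w + 2) ^ (24 * (E + 3)) * 4 ^ k)" using n(4) by (simp only: of_nat_le_iff)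
    also have "\<dots> = real c0 * (real (length w) + 2) ^ (24 * (E + 3)) * 4 ^ k" by (simp add: add.commute)
    also have "(4::real) ^ k = 2 powr (2 * real k)"
    proof -
      have "(2::real) powr (2 * real k) = (2 powr 2) powr real k" by (simp only: powr_powr)
      then show ?thesis by (simp add: powr_realpow)
    qed
    also have "real c0 * (real (length w) + 2) ^ (24 * (E + 3)) * 2 powr (2 * real k) \<le>
      real c0 * (real (length w) + 2) ^ (24 * (E + 3)) * 2 powr (2 * C * (real (length w) + 2) powr (\<epsilon> / 2) + 2 * C)"
      using n(5) by (intro mult_left_mono powr_mono) auto
    finally have "n0 \<le> length w \<longrightarrow> real n \<le> 1 * 2 powr (real (length w) powr \<epsilon>)" using n0[of "length w"] by linarith
    then show ?thesis using n(1-3) by blast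
  qed
  then show "L \<in> DTIME (\<lambda>n. 2 powr (real n powr \<epsilon>))"
    unfolding DTIME_def using M(1) by blast
qed

end
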